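(* Let $\psi$ and $\varphi$ be pure states on finite dimensional bipartite quantum systems $\mathcal H$ and $\mathcal H'$, with distributions of squared Schmidt coefficients $P_\psi$ and $P_\varphi$, and let $N$ be a natural number. Then $$F^{\mathcal Q}(\psi\to\varphi|N)=F^{\mathcal M}(P_\psi\to P_\varphi|N).$$
   Context: $\mathcal S(\mathcal H)$ is the set of density operators on $\mathcal H$. LOCC means local operations and classical communication between the two parties of a bipartite system. $F(\rho,\sigma)=\mathrm{Tr}\,|\sqrt\rho\sqrt\sigma|$ is the quantum fidelity. With $\mathcal H_{qubit}=\mathbb C^2\otimes\mathbb C^2$ (one qubit for each party), $$F^{\mathcal Q}(\psi\to\varphi|N)=\sup_{\Gamma,\Gamma'}F(\Gamma'\circ\Gamma(\psi),\varphi),$$ the supremum over LOCC maps $\Gamma:\mathcal S(\mathcal H)\to\mathcal S(\mathcal H_{qubit}^{\otimes N})$ and $\Gamma':\mathcal S(\mathcal H_{qubit}^{\otimes N})\to\mathcal S(\mathcal H')$. For probability distributions $P\in\mathcal P(\mathcal X)$, $Q\in\mathcal P(\mathcal Y)$ on finite sets: $F(Q,Q')=\sum_y\sqrt{Q(y)}\sqrt{Q'(y)}$; $P^\downarrow_i$ is the $i$-th largest value of $P$ ($0$ beyond the size of the set); $P\prec Q$ means $\sum_{i\le l}P^\downarrow_i\le\sum_{i\le l}Q^\downarrow_i$ for all $l$ (sets may differ); $$F^{\mathcal M}(P\to Q|N)=\sup\{F(P'',Q)\mid P''\in\mathcal P(\mathcal Y),\ \exists P'\in\mathcal P(\{0,1\}^N):\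 P\prec P'\prec P''\}.$$ *)

theory Defs
  imports "Jordan_Normal_Form.Schur_Decomposition" "HOL-Library.Multiset"
begin

section \<open>States on finite-dimensional systems\<close>

text \<open>
  A system of dimension \<open>n\<close> is \<open>\<complex>\<^sup>n\<close>, with operators in \<open>carrier_mat n n\<close>. A bipartite system has
  a dimension \<open>dA\<close> for the first party and \<open>dB\<close> for the second one; the basis vector
  \<open>e\<^sub>i \<otimes> e\<^sub>j\<close> of the product has index \<open>i * dB + j\<close>.
\<close>

definition mat_trace :: "complex mat \<Rightarrow> complex" where
  "mat_trace A = (\<Sum>i<dim_row A. A $$ (i, i))"

definition mat_sum :: "nat \<Rightarrow> (nat \<Rightarrow> complex mat) \<Rightarrow> nat \<Rightarrow> complex mat" where
  "mat_sum n A m = mat n n (\<lambda>(i, j). \<Sum>k<m. A k $$ (i, j))"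

definition tensor_mat :: "complex mat \<Rightarrow> complex mat \<Rightarrow> complex mat" where
  "tensor_mat A B = mat (dim_row A * dim_row B) (dim_col A * dim_col B)
     (\<lambda>(i, j). A $$ (i div dim_row B, j div dim_col B) * B $$ (i mod dim_row B, j mod dim_col B))"

definition tensor_vec :: "complex vec \<Rightarrow> complex vec \<Rightarrow> complex vec" where
  "tensor_vec v w = vec (dim_vec v * dim_vec w)
     (\<lambda>i. v $ (i div dim_vec w) * w $ (i mod dim_vec w))"

text \<open>In the order on \<open>complex\<close>, \<open>0 \<le> z\<close> says that \<open>z\<close> is real and nonnegative.\<close>

definition positive_semidefinite :: "nat \<Rightarrow> complex mat \<Rightarrow> bool" where
  "positive_semidefinite n A \<longleftrightarrow>
     A \<in> carrier_mat n n \<and> (\<forall>v \<in> carrier_vec n. 0 \<le> (A *\<^sub>v v) \<bullet>c v)"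

definition pure_state :: "nat \<Rightarrow> complex vec \<Rightarrow> bool" where
  "pure_state n \<psi> \<longleftrightarrow> \<psi> \<in> carrier_vec n \<and> \<psi> \<bullet>c \<psi> = 1"

definition ket_bra :: "complex vec \<Rightarrow> complex mat" where
  "ket_bra \<psi> = mat (dim_vec \<psi>) (dim_vec \<psi>) (\<lambda>(i, j). \<psi> $ i * cnj (\<psi> $ j))"

definition orthonormal_family :: "nat \<Rightarrow> 'a set \<Rightarrow> ('a \<Rightarrow> complex vec) \<Rightarrow> bool" where
  "orthonormal_family n X a \<longleftrightarrow> (\<forall>x \<in> X. a x \<in> carrier_vec n) \<and>
     (\<forall>x \<in> X. \<forall>y \<in> X. a x \<bullet>c a y = (if x = y then 1 else 0))"


section \<open>Fidelity of operators\<close>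

text \<open>The unique positive semidefinite root; a meaningful value only for positive semidefinite \<open>A\<close>.\<close>

definition mat_sqrt :: "complex mat \<Rightarrow> complex mat" where
  "mat_sqrt A = (THE B. positive_semidefinite (dim_row A) B \<and> B * B = A)"

definition mat_abs :: "complex mat \<Rightarrow> complex mat" where
  "mat_abs A = mat_sqrt (mat_adjoint A * A)"

definition fidelity :: "complex mat \<Rightarrow> complex mat \<Rightarrow> real" where
  "fidelity \<rho> \<sigma> = Re (mat_trace (mat_abs (mat_sqrt \<rho> * mat_sqrt \<sigma>)))"


section \<open>Local operations and classical communication\<close>

definition kraus_apply :: "complex mat \<Rightarrow> complex mat \<Rightarrow> complex mat" where
  "kraus_apply K \<rho> = K * \<rho> * mat_adjoint K"

text \<open>
  \<open>locc dA dB dA' dB' \<Gamma>\<close>: the map \<open>\<Gamma>\<close> from operators on \<open>\<complex>\<^bsup>dA\<^esup> \<otimes> \<complex>\<^bsup>dB\<^esup>\<close> to operators on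
  \<open>\<complex>\<^bsup>dA'\<^esup> \<otimes> \<complex>\<^bsup>dB'\<^esup>\<close> is implemented by a protocol with finitely many rounds. In a round one of
  the parties applies a generalized measurement with Kraus operators \<open>K 0, \<dots>, K (m - 1)\<close>, which
  may change the dimension of that party's system, and announces the outcome \<open>k\<close>; the rest of the
  protocol may depend on \<open>k\<close>. The outcomes are not recorded in the final state, so \<open>\<Gamma>\<close> sums over
  them. A general instrument, with several Kraus operators for one announced outcome, is
  the case in which the continuations for these Kraus operators agree; in particular, arbitrary
  local channels are included (including those that add or discard a local ancilla).
\<close>

inductive locc :: "nat \<Rightarrow> nat \<Rightarrow> nat \<Rightarrow> nat \<Rightarrow> (complex mat \<Rightarrow> complex mat) \<Rightarrow> bool" where
  locc_stop: "locc dA dB dA dB (\<lambda>\<rho>. \<rho>)"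
| locc_fst:
    "\<lbrakk>\<forall>k<m. K k \<in> carrier_mat (d k) dA;
      mat_sum dA (\<lambda>k. mat_adjoint (K k) * K k) m = 1\<^sub>m dA;
      \<forall>k<m. locc (d k) dB dA' dB' (\<Gamma> k)\<rbrakk> \<Longrightarrow>
     locc dA dB dA' dB'
       (\<lambda>\<rho>. mat_sum (dA' * dB') (\<lambda>k. \<Gamma> k (kraus_apply (tensor_mat (K k) (1\<^sub>m dB)) \<rho>)) m)"
| locc_snd:
    "\<lbrakk>\<forall>k<m. K k \<in> carrier_mat (d k) dB;
      mat_sum dB (\<lambda>k. mat_adjoint (K k) * K k) m = 1\<^sub>m dB;
      \<forall>k<m. locc dA (d k) dA' dB' (\<Gamma> k)\<rbrakk> \<Longrightarrow>
     locc dA dB dA' dB'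
       (\<lambda>\<rho>. mat_sum (dA' * dB') (\<lambda>k. \<Gamma> k (kraus_apply (tensor_mat (1\<^sub>m dA) (K k)) \<rho>)) m)"

text \<open>
  \<open>N\<close> pairs of qubits, one qubit of each pair for each party, give each party a system of
  dimension \<open>2 ^ N\<close>; the tensor factors of \<open>(\<complex>\<^sup>2 \<otimes> \<complex>\<^sup>2)\<^bsup>\<otimes>N\<^esup>\<close> are grouped by party.
\<close>

definition locc_fidelity ::
  "nat \<Rightarrow> nat \<Rightarrow> nat \<Rightarrow> nat \<Rightarrow> complex mat \<Rightarrow> complex mat \<Rightarrow> nat \<Rightarrow> real" where
  "locc_fidelity dA dB dA' dB' \<rho> \<sigma> N =
     Sup {fidelity ((\<Gamma>' \<circ> \<Gamma>) \<rho>) \<sigma> | \<Gamma> \<Gamma>'.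
            locc dA dB (2 ^ N) (2 ^ N) \<Gamma> \<and> locc (2 ^ N) (2 ^ N) dA' dB' \<Gamma>'}"


section \<open>Probability distributions and majorization\<close>

text \<open>Values of a distribution outside of its finite set \<open>X\<close> are irrelevant.\<close>

definition distributions :: "'a set \<Rightarrow> ('a \<Rightarrow> real) set" where
  "distributions X = {P. finite X \<and> (\<forall>x \<in> X. 0 \<le> P x) \<and> sum P X = 1}"

text \<open>Indices start from \<open>0\<close>: \<open>decreasing X P 0\<close> is the largest value.\<close>

definition decreasing :: "'a set \<Rightarrow> ('a \<Rightarrow> real) \<Rightarrow> nat \<Rightarrow> real" where
  "decreasing X P i =
     (let vs = rev (sorted_list_of_multiset (image_mset P (mset_set X)))
      in if i < length vs then vs ! i else 0)"

definition majorized :: "'a set \<Rightarrow> ('a \<Rightarrow> real) \<Rightarrow> 'b set \<Rightarrow> ('b \<Rightarrow> real) \<Rightarrow> bool" where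
  "majorized X P Y Q \<longleftrightarrow> (\<forall>l. (\<Sum>i<l. decreasing X P i) \<le> (\<Sum>i<l. decreasing Y Q i))"

definition dist_fidelity :: "'a set \<Rightarrow> ('a \<Rightarrow> real) \<Rightarrow> ('a \<Rightarrow> real) \<Rightarrow> real" where
  "dist_fidelity Y Q Q' = (\<Sum>y\<in>Y. sqrt (Q y) * sqrt (Q' y))"

definition bit_strings :: "nat \<Rightarrow> bool list set" where
  "bit_strings N = {bs. length bs = N}"

definition majorization_fidelity ::
  "'a set \<Rightarrow> ('a \<Rightarrow> real) \<Rightarrow> 'b set \<Rightarrow> ('b \<Rightarrow> real) \<Rightarrow> nat \<Rightarrow> real" where
  "majorization_fidelity X P Y Q N =
     Sup {dist_fidelity Y P'' Q | P''. P'' \<in> distributions Y \<and>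
            (\<exists>P' \<in> distributions (bit_strings N).
               majorized X P (bit_strings N) P' \<and> majorized (bit_strings N) P' Y P'')}"

text \<open>
  \<open>P\<close> is the distribution, indexed by \<open>X\<close>, of squared Schmidt coefficients of \<open>\<psi>\<close>: there is a
  Schmidt decomposition \<open>\<psi> = (\<Sum>x\<in>X. sqrt (P x) (a x \<otimes> b x))\<close>. Zero coefficients are allowed but
  not required, so \<open>card X\<close> can be any number from the Schmidt rank of \<open>\<psi>\<close> to \<open>min dA dB\<close>.
\<close>

definition schmidt_distribution ::
  "nat \<Rightarrow> nat \<Rightarrow> complex vec \<Rightarrow> 'a set \<Rightarrow> ('a \<Rightarrow> real) \<Rightarrow> bool" where
  "schmidt_distribution dA dB \<psi> X P \<longleftrightarrow> P \<in> distributions X \<and>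
     (\<exists>a b. orthonormal_family dA X a \<and> orthonormal_family dB X b \<and>
        (\<forall>i < dA * dB. \<psi> $ i =
           (\<Sum>x\<in>X. complex_of_real (sqrt (P x)) * tensor_vec (a x) (b x) $ i)))"

end

theory Submission
  imports Defs "HOL-Analysis.L2_Norm" "HOL-Combinatorics.Permutations"
    "HOL-Computational_Algebra.Fundamental_Theorem_Algebra"
begin

text \<open>
  For the upper bound, write the two LOCC maps in Kraus form. A local measurement does not decrease
  the average of a Ky Fan norm (the sum of the \<open>l\<close> largest squared Schmidt coefficients), so the
  averages \<open>p'\<close> and \<open>p''\<close> of the ordered Schmidt distributions after the first and after the second map
  satisfy \<open>P\<^sub>\<psi> \<prec> p' \<prec> p''\<close>, and \<open>p'\<close> has at most \<open>2 ^ N\<close> nonzero entries. The squared fidelity with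
  \<open>\<phi>\<close> is the average of the squared overlaps; an overlap is at most the fidelity of the ordered
  Schmidt distributions (von Neumann's trace inequality), and Minkowski's inequality in \<open>\<ell>\<^sup>2\<close> bounds
  the average by the fidelity of \<open>p''\<close>. Conversely, Nielsen's protocol realizes \<open>P\<^sub>\<psi> \<prec> P' \<prec> P''\<close>.
\<close>

section \<open>Orthonormal systems and the spectral theorem\<close>

text \<open>Vectors that occur along a protocol are left unnormalized: the squared norm of a branch
  is its probability, so averages over outcomes are plain sums over Kraus operators. Ky Fan norms
  carry the upper bound because they are maxima over orthonormal families of one party. They can
  therefore be compared under an operation of the other party, and they do not depend on which
  Schmidt decomposition is used, so uniqueness of the coefficients is never invoked. In the
  converse, \<phi> itself is in general out of reach; the target is the vector with the Schmidt
  families of \<phi> and the weights \<open>P''\<close>, whose overlap with \<phi> is exactly the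
  fidelity of the two distributions. The analytic part treats vectors and matrices as functions on
  indices with the dimension as a parameter, because dimensions change from outcome to
  outcome.\<close>

definition cip :: "nat \<Rightarrow> (nat \<Rightarrow> complex) \<Rightarrow> (nat \<Rightarrow> complex) \<Rightarrow> complex" where
  "cip n u v = (\<Sum>i<n. u i * cnj (v i))"

definition sqn :: "nat \<Rightarrow> (nat \<Rightarrow> complex) \<Rightarrow> real" where
  "sqn n u = (\<Sum>i<n. (cmod (u i))\<^sup>2)"

definition mv :: "nat \<Rightarrow> (nat \<Rightarrow> nat \<Rightarrow> complex) \<Rightarrow> (nat \<Rightarrow> complex) \<Rightarrow> nat \<Rightarrow> complex" where
  "mv n H v = (\<lambda>i. \<Sum>j<n. H i j * v j)"

definition ons :: "nat \<Rightarrow> 'a set \<Rightarrow> ('a \<Rightarrow> nat \<Rightarrow> complex) \<Rightarrow> bool" where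
  "ons n X a \<longleftrightarrow> (\<forall>x\<in>X. \<forall>y\<in>X. cip n (a x) (a y) = (if x = y then 1 else 0))"

section \<open>Calculus of the inner product and Bessel's inequality\<close>

lemma cip_cong: "(\<And>i. i < n \<Longrightarrow> u i = u' i) \<Longrightarrow> (\<And>i. i < n \<Longrightarrow> v i = v' i) \<Longrightarrow> cip n u v = cip n u' v'"
  unfolding cip_def by (intro sum.cong) auto

lemma cnj_cip: "cnj (cip n u v) = cip n v u"
  unfolding cip_def by (simp add: mult.commute)

lemma cip_self: "cip n u u = of_real (sqn n u)"
  unfolding cip_def sqn_def of_real_sum
  by (intro sum.cong refl) (metis complex_norm_square)

lemma sqn_nonneg: "0 \<le> sqn n u"
  unfolding sqn_def by (intro sum_nonneg) auto

lemma sqn_eq_0_iff: "sqn n u = 0 \<longleftrightarrow> (\<forall>i<n. u i = 0)"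
  unfolding sqn_def by (subst sum_nonneg_eq_0_iff) auto

lemma cip_scale_left: "cip n (\<lambda>i. c * u i) v = c * cip n u v"
  unfolding cip_def by (simp add: sum_distrib_left mult.assoc)

lemma cip_scale_right: "cip n u (\<lambda>i. c * v i) = cnj c * cip n u v"
  unfolding cip_def by (simp add: sum_distrib_left ac_simps)

lemma cip_diff_left: "cip n (\<lambda>i. u i - w i) v = cip n u v - cip n w v"
  unfolding cip_def by (simp add: sum_subtractf algebra_simps)

lemma cip_add_left: "cip n (\<lambda>i. u i + w i) v = cip n u v + cip n w v"
  unfolding cip_def by (simp add: sum.distrib algebra_simps)

lemma cip_diff_right: "cip n v (\<lambda>i. u i - w i) = cip n v u - cip n v w"
  unfolding cip_def by (simp add: sum_subtractf algebra_simps)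

lemma cip_sum_left: "cip n (\<lambda>i. \<Sum>x\<in>X. c x * a x i) v = (\<Sum>x\<in>X. c x * cip n (a x) v)"
proof -
  have "cip n (\<lambda>i. \<Sum>x\<in>X. c x * a x i) v = (\<Sum>i<n. \<Sum>x\<in>X. c x * a x i * cnj (v i))"
    unfolding cip_def by (simp add: sum_distrib_right)
  also have "\<dots> = (\<Sum>x\<in>X. \<Sum>i<n. c x * a x i * cnj (v i))"
    by (rule sum.swap)
  finally show ?thesis
    unfolding cip_def by (simp add: sum_distrib_left mult.assoc)
qed

lemma cip_sum_right: "cip n v (\<lambda>i. \<Sum>x\<in>X. c x * a x i) = (\<Sum>x\<in>X. cnj (c x) * cip n v (a x))"
  using arg_cong[OF cip_sum_left[where v = v], of cnj]
  by (simp add: cnj_cip)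

lemma ons_mono: "ons n X a \<Longrightarrow> Y \<subseteq> X \<Longrightarrow> ons n Y a"
  unfolding ons_def by blast

lemma onsD: "ons n X a \<Longrightarrow> x \<in> X \<Longrightarrow> y \<in> X \<Longrightarrow> cip n (a x) (a y) = (if x = y then 1 else 0)"
  unfolding ons_def by blast

lemma cip_ons_sum_left:
  assumes "ons n X a" "finite X" "y \<in> X"
  shows "cip n (\<lambda>i. \<Sum>x\<in>X. c x * a x i) (a y) = c y"
proof -
  have "(\<Sum>x\<in>X. c x * cip n (a x) (a y)) = (\<Sum>x\<in>X. if x = y then c x else 0)"
    using assms by (intro sum.cong) (auto simp: onsD)
  then show ?thesis using assms by (simp add: cip_sum_left)
qed

lemma sqn_ons_sum:
  assumes "ons n X a" "finite X"
  shows "sqn n (\<lambda>i. \<Sum>x\<in>X. c x * a x i) = (\<Sum>x\<in>X. (cmod (c x))\<^sup>2)"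
proof -
  have "cip n (\<lambda>i. \<Sum>x\<in>X. c x * a x i) (\<lambda>i. \<Sum>x\<in>X. c x * a x i) = (\<Sum>x\<in>X. cnj (c x) * c x)"
    unfolding cip_sum_right using assms by (intro sum.cong refl) (simp add: cip_ons_sum_left)
  also have "\<dots> = of_real (\<Sum>x\<in>X. (cmod (c x))\<^sup>2)"
    unfolding of_real_sum by (intro sum.cong refl) (metis complex_norm_square mult.commute)
  finally show ?thesis by (simp only: cip_self of_real_eq_iff)
qed

text \<open>The defect in Bessel's inequality is an exact square: the projection \<open>?w\<close>
  has the same inner product with \<open>v\<close> as with itself, so the mixed terms
  collapse.\<close>

lemma bessel_eq:
  assumes "ons n X a" "finite X"
  shows "sqn n v - (\<Sum>x\<in>X. (cmod (cip n v (a x)))\<^sup>2) = sqn n (\<lambda>i. v i - (\<Sum>x\<in>X. cip n v (a x) * a x i))"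
proof -
  let ?w = "\<lambda>i. \<Sum>x\<in>X. cip n v (a x) * a x i"
  have 1: "cip n ?w v = (\<Sum>x\<in>X. cip n v (a x) * cnj (cip n v (a x)))"
    by (simp add: cip_sum_left cnj_cip)
  also have "\<dots> = of_real (\<Sum>x\<in>X. (cmod (cip n v (a x)))\<^sup>2)"
    unfolding of_real_sum by (intro sum.cong refl) (metis complex_norm_square)
  finally have wv: "cip n ?w v = of_real (\<Sum>x\<in>X. (cmod (cip n v (a x)))\<^sup>2)" .
  have vw: "cip n v ?w = of_real (\<Sum>x\<in>X. (cmod (cip n v (a x)))\<^sup>2)"
    using arg_cong[OF wv, of cnj] by (simp only: cnj_cip complex_cnj_complex_of_real)
  have ww: "cip n ?w ?w = of_real (\<Sum>x\<in>X. (cmod (cip n v (a x)))\<^sup>2)"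
    by (subst cip_self, subst sqn_ons_sum[OF assms]) (rule refl)
  have "cip n (\<lambda>i. v i - ?w i) (\<lambda>i. v i - ?w i) = of_real (sqn n v - (\<Sum>x\<in>X. (cmod (cip n v (a x)))\<^sup>2))"
    by (simp only: cip_diff_left cip_diff_right wv vw ww cip_self[of n v]) simp
  then show ?thesis by (simp only: cip_self of_real_eq_iff)
qed

lemma bessel:
  assumes "ons n X a" "finite X"
  shows "(\<Sum>x\<in>X. (cmod (cip n v (a x)))\<^sup>2) \<le> sqn n v"
  using bessel_eq[OF assms, of v] sqn_nonneg[of n "\<lambda>i. v i - (\<Sum>x\<in>X. cip n v (a x) * a x i)"]
  by linarith

text \<open>The \<open>k\<close> equations, padded with zero rows, form a square matrix; expansion
  along row \<open>k\<close>, the first zero row, gives determinant 0.\<close>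

lemma exists_kernel_vector:
  fixes C :: "nat \<Rightarrow> nat \<Rightarrow> complex"
  assumes "k < n"
  shows "\<exists>v. (\<exists>i<n. v i \<noteq> 0) \<and> (\<forall>r<k. (\<Sum>j<n. C r j * v j) = 0)"
proof -
  define A where "A = mat n n (\<lambda>(i, j). if i < k then C i j else 0)"
  have A: "A \<in> carrier_mat n n" by (simp add: A_def)
  have "det A = (\<Sum>j<n. A $$ (k, j) * cofactor A k j)"
    by (rule laplace_expansion_row[OF A assms])
  also have "\<dots> = 0" using assms by (intro sum.neutral) (auto simp: A_def)
  finally have "det A = 0" .
  then obtain v where v: "v \<in> carrier_vec n" "v \<noteq> 0\<^sub>v n" "A *\<^sub>v v = 0\<^sub>v n"
    using det_0_iff_vec_prod_zero_field[OF A] by blast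
  have "\<exists>i<n. v $ i \<noteq> 0"
    using v(1,2) by (metis carrier_vecD eq_vecI index_zero_vec(1) index_zero_vec(2))
  moreover have "(\<Sum>j<n. C r j * v $ j) = 0" if "r < k" for r
  proof -
    have "(A *\<^sub>v v) $ r = (\<Sum>j<n. C r j * v $ j)"
      using that assms A v(1)
      by (auto simp: scalar_prod_def A_def atLeast0LessThan intro!: sum.cong)
    then show ?thesis using v(3) that assms by simp
  qed
  ultimately show ?thesis by blast
qed

text \<open>A square matrix with orthonormal rows has its adjoint as a right inverse, hence also as
  a left inverse; the latter is the resolution of the identity by the projectors onto the
  \<open>u k\<close>.\<close>

lemma complete_ons:
  assumes "ons n {..<n} u" and "i < n" "j < n"
  shows "(\<Sum>k<n. u k i * cnj (u k j)) = (if i = j then 1 else 0)"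
proof -
  define A where "A = mat n n (\<lambda>(k, i). u k i)"
  define B where "B = mat n n (\<lambda>(i, k). cnj (u k i))"
  have "A * B = 1\<^sub>m n"
    using assms(1)
    by (intro eq_matI) (auto simp: A_def B_def scalar_prod_def atLeast0LessThan ons_def cip_def)
  then have "B * A = 1\<^sub>m n"
    by (rule mat_mult_left_right_inverse[rotated 2]) (auto simp: A_def B_def)
  then have "(B * A) $$ (j, i) = (if i = j then 1 else 0)"
    using assms by auto
  moreover have "(B * A) $$ (j, i) = (\<Sum>k<n. u k i * cnj (u k j))"
    using assms by (auto simp: A_def B_def scalar_prod_def atLeast0LessThan intro!: sum.cong)
  ultimately show ?thesis by simp
qed

lemma expand_ons:
  assumes "ons n {..<n} u" "i < n"
  shows "v i = (\<Sum>k<n. cip n v (u k) * u k i)"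
proof -
  have "(\<Sum>k<n. cip n v (u k) * u k i) = (\<Sum>k<n. \<Sum>j<n. v j * (u k i * cnj (u k j)))"
    by (simp add: cip_def sum_distrib_right sum_distrib_left ac_simps)
  also have "\<dots> = (\<Sum>j<n. v j * (\<Sum>k<n. u k i * cnj (u k j)))"
    by (subst sum.swap) (simp add: sum_distrib_left)
  also have "\<dots> = (\<Sum>j<n. if j = i then v j else 0)"
    using assms by (intro sum.cong) (auto simp: complete_ons)
  finally show ?thesis using assms(2) by simp
qed

section \<open>Matrices acting on vectors, Hermitian matrices and eigenvectors\<close>

lemma mv_scale: "mv n H (\<lambda>i. c * v i) = (\<lambda>i. c * mv n H v i)"
  by (auto simp: mv_def sum_distrib_left ac_simps)

lemma mv_add: "mv n H (\<lambda>i. v i + w i) = (\<lambda>i. mv n H v i + mv n H w i)"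
  by (auto simp: mv_def sum.distrib algebra_simps)

lemma mv_sum: "mv n H (\<lambda>i. \<Sum>x\<in>X. c x * a x i) = (\<lambda>i. \<Sum>x\<in>X. c x * mv n H (a x) i)"
proof
  fix i
  have "mv n H (\<lambda>i. \<Sum>x\<in>X. c x * a x i) i = (\<Sum>j<n. \<Sum>x\<in>X. c x * (H i j * a x j))"
    by (simp add: mv_def sum_distrib_left mult.left_commute)
  also have "\<dots> = (\<Sum>x\<in>X. \<Sum>j<n. c x * (H i j * a x j))" by (rule sum.swap)
  finally show "mv n H (\<lambda>i. \<Sum>x\<in>X. c x * a x i) i = (\<Sum>x\<in>X. c x * mv n H (a x) i)"
    by (simp add: mv_def sum_distrib_left)
qed

lemma mv_cong: "(\<And>i. i < n \<Longrightarrow> v i = v' i) \<Longrightarrow> mv n H v = mv n H v'"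
  unfolding mv_def by (intro ext sum.cong) auto

definition hermitian :: "nat \<Rightarrow> (nat \<Rightarrow> nat \<Rightarrow> complex) \<Rightarrow> bool" where
  "hermitian n H \<longleftrightarrow> (\<forall>i<n. \<forall>j<n. H j i = cnj (H i j))"

lemma cip_mv_adjoint: "cip n (mv m H u) v = cip m u (mv n (\<lambda>i j. cnj (H j i)) v)"
proof -
  have "cip n (mv m H u) v = (\<Sum>i<n. \<Sum>j<m. H i j * u j * cnj (v i))"
    by (simp add: cip_def mv_def sum_distrib_right)
  also have "\<dots> = (\<Sum>j<m. \<Sum>i<n. H i j * u j * cnj (v i))" by (rule sum.swap)
  finally show ?thesis by (simp add: cip_def mv_def sum_distrib_left ac_simps)
qed

lemma cip_hermitian:
  assumes "hermitian n H"
  shows "cip n (mv n H u) v = cip n u (mv n H v)"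
proof -
  have "mv n (\<lambda>i j. cnj (H j i)) v i = mv n H v i" if "i < n" for i
    unfolding mv_def using assms that by (intro sum.cong refl) (metis hermitian_def lessThan_iff)
  then show ?thesis unfolding cip_mv_adjoint by (intro cip_cong) auto
qed

text \<open>The vector \<open>p(H) w\<close>, by Horner's scheme.\<close>

definition poly_mv :: "nat \<Rightarrow> (nat \<Rightarrow> nat \<Rightarrow> complex) \<Rightarrow> (nat \<Rightarrow> complex) \<Rightarrow> complex poly \<Rightarrow> nat \<Rightarrow> complex" where
  "poly_mv n H w p = fold_coeffs (\<lambda>a v i. a * w i + mv n H v i) p (\<lambda>i. 0)"

lemma poly_mv_0 [simp]: "poly_mv n H w 0 = (\<lambda>i. 0)"
  by (simp add: poly_mv_def)

lemma poly_mv_pCons: "poly_mv n H w (pCons a p) = (\<lambda>i. a * w i + mv n H (poly_mv n H w p) i)"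
  by (cases "pCons a p = 0") (auto simp: poly_mv_def mv_def)

lemma poly_mv_add: "poly_mv n H w (p + q) = (\<lambda>i. poly_mv n H w p i + poly_mv n H w q i)"
  by (induction p q rule: poly_induct2) (auto simp: poly_mv_pCons mv_add algebra_simps)

lemma poly_mv_smult: "poly_mv n H w (smult c p) = (\<lambda>i. c * poly_mv n H w p i)"
  by (induction p) (auto simp: poly_mv_pCons mv_scale algebra_simps)

lemma poly_mv_monom: "poly_mv n H w (monom c i) = (\<lambda>r. c * (mv n H ^^ i) w r)"
proof (induction i)
  case 0
  then show ?case by (auto simp: monom_0 poly_mv_pCons mv_def)
next
  case (Suc i)
  then show ?case by (auto simp: monom_Suc poly_mv_pCons mv_scale)
qed

lemma poly_mv_sum: "poly_mv n H w (sum f A) = (\<lambda>i. \<Sum>x\<in>A. poly_mv n H w (f x) i)"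
  by (induction A rule: infinite_finite_induct) (auto simp: poly_mv_add)

lemma poly_mv_root: "poly_mv n H w ([:-l, 1:] * p) i = mv n H (poly_mv n H w p) i - l * poly_mv n H w p i"
proof -
  have "[:-l, 1:] * p = smult (-l) p + pCons 0 p" by simp
  then show ?thesis
    by (simp only: poly_mv_add poly_mv_smult poly_mv_pCons) simp
qed

text \<open>Krylov argument: a polynomial of least degree with \<open>p(H) w = 0\<close> has a root
  \<open>l\<close>, and for \<open>p = (x - l) q\<close> the vector \<open>q(H) w\<close> is nonzero
  by minimality and killed by \<open>H - l\<close>. It stays in \<open>W\<close> as a combination of
  \<open>w\<close>, \<open>H w\<close> and so on. Describing the subspace by a predicate avoids
  choosing a basis for the restriction of \<open>H\<close>.\<close>

lemma exists_eigenvector_in_invariant_subspace: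
  assumes inv: "\<And>v. W v \<Longrightarrow> W (mv n H v)"
    and lin: "\<And>v w c. W v \<Longrightarrow> W w \<Longrightarrow> W (\<lambda>i. c * v i + w i)"
    and w: "W w" and w0: "\<exists>i<n. w i \<noteq> 0"
  shows "\<exists>v l. W v \<and> (\<exists>i<n. v i \<noteq> 0) \<and> (\<forall>i<n. mv n H v i = l * v i)"
proof -
  have W0: "W (\<lambda>i. 0)" using lin[OF w w, of "-1"] by simp
  have WK: "W (poly_mv n H w p)" for p
    by (induction p) (auto simp: poly_mv_pCons W0 intro!: lin inv w)
  \<comment> \<open>The \<open>n + 1\<close> Krylov vectors live in dimension \<open>n\<close>: each
    coordinate gives one linear equation for the \<open>n + 1\<close> coefficients.\<close>
  obtain c where c: "\<exists>i<Suc n. c i \<noteq> (0::complex)"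
    "\<forall>r<n. (\<Sum>j<Suc n. (mv n H ^^ j) w r * c j) = 0"
    using exists_kernel_vector[of n "Suc n" "\<lambda>r j. (mv n H ^^ j) w r"] by auto
  define p0 where "p0 = (\<Sum>j<Suc n. monom (c j) j)"
  obtain i0 where "i0 < Suc n" "c i0 \<noteq> 0" using c(1) by blast
  have "coeff p0 i0 = (\<Sum>j<Suc n. if j = i0 then c j else 0)"
    unfolding p0_def coeff_sum by (intro sum.cong) auto
  then have "coeff p0 i0 = c i0" using \<open>i0 < Suc n\<close> by (simp del: sum.lessThan_Suc)
  then have p0: "p0 \<noteq> 0" using \<open>c i0 \<noteq> 0\<close> by auto
  have "\<forall>r<n. poly_mv n H w p0 r = 0"
    using c(2) by (simp only: p0_def poly_mv_sum poly_mv_monom mult.commute)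
  with p0 have ex: "\<exists>p. p \<noteq> 0 \<and> (\<forall>r<n. poly_mv n H w p r = 0)" by blast
  define p where "p = (ARG_MIN degree p. p \<noteq> 0 \<and> (\<forall>r<n. poly_mv n H w p r = 0))"
  have p: "p \<noteq> 0" "\<forall>r<n. poly_mv n H w p r = 0"
    using arg_min_natI[of "\<lambda>p. p \<noteq> 0 \<and> (\<forall>r<n. poly_mv n H w p r = 0)" _ degree] ex
    unfolding p_def by blast+
  have min: "degree p \<le> degree q" if "q \<noteq> 0" "\<forall>r<n. poly_mv n H w q r = 0" for q
    unfolding p_def using that by (intro arg_min_nat_le) auto
  \<comment> \<open>A nonzero constant polynomial would send \<open>w\<close> to a nonzero multiple
    of itself.\<close>
  have "degree p \<noteq> 0"
  proof
    assume "degree p = 0"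
    then obtain a where "p = [:a:]" by (metis degree_eq_zeroE)
    with p w0 show False by (auto simp: poly_mv_pCons mv_def)
  qed
  then have "\<not> constant (poly p)" by (simp add: constant_degree)
  then obtain l where "poly p l = 0" using fundamental_theorem_of_algebra by blast
  then obtain q where q: "p = [:-l, 1:] * q" by (auto simp: poly_eq_0_iff_dvd)
  have q0: "q \<noteq> 0" using p(1) q by auto
  have "degree p = Suc (degree q)"
    unfolding q using q0 by (subst degree_mult_eq) auto
  then have "\<exists>i<n. poly_mv n H w q i \<noteq> 0" using min[OF q0] by fastforce
  moreover have "\<forall>i<n. mv n H (poly_mv n H w q) i = l * poly_mv n H w q i"
    using p(2) unfolding q poly_mv_root by simp
  ultimately show ?thesis using WK by blast
qed

text \<open>Eigenvectors are found one at a time: the orthogonal complement of those already found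
  is invariant because \<open>H\<close> is Hermitian, and it is nonzero as long as
  \<open>m < n\<close>, so it contains a further one.\<close>

theorem spectral:
  assumes H: "hermitian n H"
  shows "\<exists>u (l :: nat \<Rightarrow> real). ons n {..<n} u \<and> (\<forall>k<n. \<forall>i<n. mv n H (u k) i = of_real (l k) * u k i)"
proof -
  have "\<exists>u (l :: nat \<Rightarrow> real). ons n {..<m} u \<and> (\<forall>k<m. \<forall>i<n. mv n H (u k) i = of_real (l k) * u k i)"
    if "m \<le> n" for m
    using that
  proof (induction m)
    case 0
    then show ?case by (auto simp: ons_def)
  next
    case (Suc m)
    then obtain u and l :: "nat \<Rightarrow> real" where u: "ons n {..<m} u"
      and l: "\<forall>k<m. \<forall>i<n. mv n H (u k) i = of_real (l k) * u k i"
      by auto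
    define W where "W = (\<lambda>v. \<forall>x<m. cip n v (u x) = 0)"
    obtain w where w: "\<exists>i<n. w i \<noteq> 0" "\<forall>r<m. (\<Sum>j<n. cnj (u r j) * w j) = 0"
      using exists_kernel_vector[of m n "\<lambda>r j. cnj (u r j)"] Suc.prems by auto
    have "\<exists>v e. W v \<and> (\<exists>i<n. v i \<noteq> 0) \<and> (\<forall>i<n. mv n H v i = e * v i)"
    proof (rule exists_eigenvector_in_invariant_subspace)
      show "W (mv n H v)" if "W v" for v
        unfolding W_def
      proof (intro allI impI)
        fix x assume x: "x < m"
        have "cip n (mv n H v) (u x) = cip n v (\<lambda>i. of_real (l x) * u x i)"
          unfolding cip_hermitian[OF H] using l x by (intro cip_cong) auto
        then show "cip n (mv n H v) (u x) = 0"
          using that x by (simp add: cip_scale_right W_def)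
      qed
      show "W (\<lambda>i. c * v i + w i)" if "W v" "W w" for v w c
        using that by (auto simp: W_def cip_add_left cip_scale_left)
      show "W w" using w(2) by (auto simp: W_def cip_def mult.commute)
    qed (use w in auto)
    then obtain v e where v: "W v" "\<exists>i<n. v i \<noteq> 0" "\<forall>i<n. mv n H v i = e * v i" by blast
    have pos: "sqn n v > 0" using v(2) sqn_nonneg[of n v] sqn_eq_0_iff[of n v] by force
    \<comment> \<open>Moving \<open>H\<close> across the inner product turns \<open>e\<close> into
      its conjugate, so the eigenvalue is real.\<close>
    have "e * cip n v v = cip n (mv n H v) v"
      unfolding cip_scale_left[symmetric] using v by (intro cip_cong) auto
    also have "\<dots> = cip n v (mv n H v)" by (rule cip_hermitian[OF H])
    also have "\<dots> = cnj e * cip n v v"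
      unfolding cip_scale_right[symmetric] using v by (intro cip_cong) auto
    finally have "e = cnj e" using pos by (simp add: cip_self)
    then have e: "e = of_real (Re e)" by (metis Reals_cnj_iff of_real_Re)
    define v' where "v' = (\<lambda>i. of_real (1 / sqrt (sqn n v)) * v i)"
    define u' where "u' = u(m := v')"
    have vv: "cip n v' v' = 1"
      using pos unfolding v'_def cip_scale_left cip_scale_right cip_self
      by (simp flip: of_real_mult)
    have vu: "cip n v' (u x) = 0" if "x < m" for x
      using v(1) that unfolding v'_def by (simp only: cip_scale_left W_def) simp
    have uv: "cip n (u x) v' = 0" if "x < m" for x
      using arg_cong[OF vu[OF that], of cnj] by (simp add: cnj_cip)
    have "ons n {..<Suc m} u'"
      using u vv vu uv by (auto simp: ons_def u'_def)
    moreover have "\<forall>k<Suc m. \<forall>i<n. mv n H (u' k) i = of_real ((l(m := Re e)) k) * u' k i"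
    proof (intro allI impI)
      fix k i assume "k < Suc m" "i < n"
      then show "mv n H (u' k) i = of_real ((l(m := Re e)) k) * u' k i"
        using l v(3) e[symmetric] unfolding u'_def v'_def
        by (cases "k = m") (simp_all only: fun_upd_same fun_upd_other mv_scale less_Suc_eq mult.left_commute simp_thms not_False_eq_True)
    qed
    ultimately show ?case by blast
  qed
  then show ?thesis by auto
qed

section \<open>Schmidt decomposition and Ky Fan norms\<close>

lemma decreasing_eqI:
  assumes g: "bij_betw g {..<n} Y" and f: "\<And>i. i < n \<Longrightarrow> P (g i) = f i"
    and mono: "\<And>i j. i \<le> j \<Longrightarrow> j < n \<Longrightarrow> f j \<le> f i"
  shows "decreasing Y P i = (if i < n then f i else 0)"
proof -
  have "image_mset P (mset_set Y) = image_mset P (image_mset g (mset_set {..<n}))"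
    using g by (simp add: image_mset_mset_set bij_betw_def)
  also have "\<dots> = image_mset (\<lambda>i. P (g i)) (mset_set {..<n})"
    by (simp add: multiset.map_comp comp_def)
  also have "\<dots> = image_mset f (mset_set {..<n})"
    using f by (intro image_mset_cong) auto
  also have "\<dots> = mset (map f [0..<n])"
    by (simp add: atLeast0LessThan flip: mset_set_upto_eq_mset_upto)
  also have "\<dots> = mset (rev (map f [0..<n]))" by simp
  finally have "sorted_list_of_multiset (image_mset P (mset_set Y)) = sort (rev (map f [0..<n]))"
    by (simp only: sorted_list_of_multiset_mset)
  also have "\<dots> = rev (map f [0..<n])"
    using mono by (intro sort_key_id_if_sorted) (auto simp: sorted_iff_nth_mono rev_nth)
  finally show ?thesis by (simp add: decreasing_def)
qed

text \<open>Sorting happens only here; later arguments work with the bijection \<open>g\<close> and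
  never with the sorted list in the definition of \<open>decreasing\<close>.\<close>

lemma decreasing_enumeration:
  assumes "finite X"
  obtains g where "bij_betw g {..<card X} X" "\<forall>i<card X. P (g i) = decreasing X P i"
    "\<forall>i j. i \<le> j \<longrightarrow> j < card X \<longrightarrow> P (g j) \<le> P (g i)"
proof -
  obtain xs where xs: "set xs = X" "distinct xs" using finite_distinct_list[OF assms] by blast
  define ys where "ys = rev (sort_key P xs)"
  have ys: "set ys = X" "distinct ys" using xs by (simp_all add: ys_def)
  then have len: "length ys = card X" by (metis distinct_card)
  have bij: "bij_betw ((!) ys) {..<card X} X"
    using ys len by (intro bij_betw_nth) auto
  have mono: "P (ys ! j) \<le> P (ys ! i)" if "i \<le> j" "j < card X" for i j
  proof -
    have "sorted (rev (map P ys))" by (simp add: ys_def rev_map)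
    then show ?thesis
      using sorted_rev_nth_mono[of "map P ys" i j] that len by simp
  qed
  have "P (ys ! i) = decreasing X P i" if "i < card X" for i
    using decreasing_eqI[OF bij, of P "\<lambda>i. P (ys ! i)"] mono that by simp
  with bij mono show ?thesis by (intro that) auto
qed

lemma decreasing_eq_0:
  assumes "finite X" "card X \<le> i"
  shows "decreasing X P i = 0"
proof -
  obtain g where g: "bij_betw g {..<card X} X" "\<forall>i<card X. P (g i) = decreasing X P i"
    "\<forall>i j. i \<le> j \<longrightarrow> j < card X \<longrightarrow> P (g j) \<le> P (g i)"
    by (rule decreasing_enumeration[OF assms(1)])
  show ?thesis
    using decreasing_eqI[OF g(1) refl, of P i] g(3) assms(2) by simp
qed

lemma decreasing_nonneg:
  assumes "finite X" "\<And>x. x \<in> X \<Longrightarrow> 0 \<le> P x"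
  shows "0 \<le> decreasing X P i"
proof -
  obtain g where g: "bij_betw g {..<card X} X" "\<forall>i<card X. P (g i) = decreasing X P i"
    "\<forall>i j. i \<le> j \<longrightarrow> j < card X \<longrightarrow> P (g j) \<le> P (g i)"
    by (rule decreasing_enumeration[OF assms(1)])
  show ?thesis
    using g(1,2) assms(2)[of "g i"] decreasing_eq_0[OF assms(1), of i P]
    by (cases "i < card X") (auto simp: bij_betw_def)
qed

lemma antimono_decreasing:
  assumes "finite X" "\<And>x. x \<in> X \<Longrightarrow> 0 \<le> P x"
  shows "antimono (decreasing X P)"
proof (rule antimonoI)
  fix i j :: nat assume "i \<le> j"
  obtain g where g: "bij_betw g {..<card X} X" "\<forall>i<card X. P (g i) = decreasing X P i"
    "\<forall>i j. i \<le> j \<longrightarrow> j < card X \<longrightarrow> P (g j) \<le> P (g i)"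
    by (rule decreasing_enumeration[OF assms(1)])
  show "decreasing X P j \<le> decreasing X P i"
    using g(2,3) \<open>i \<le> j\<close> decreasing_eq_0[OF assms(1), of j P] decreasing_nonneg[of X P i, OF assms]
    by (cases "j < card X") auto
qed

lemma sum_decreasing:
  assumes "finite X"
  shows "(\<Sum>i<card X. decreasing X P i) = sum P X"
proof -
  obtain g where g: "bij_betw g {..<card X} X" "\<forall>i<card X. P (g i) = decreasing X P i"
    "\<forall>i j. i \<le> j \<longrightarrow> j < card X \<longrightarrow> P (g j) \<le> P (g i)"
    by (rule decreasing_enumeration[OF assms(1)])
  have "(\<Sum>i<card X. decreasing X P i) = (\<Sum>i<card X. P (g i))" using g(2) by simp
  also have "\<dots> = sum P X" by (rule sum.reindex_bij_betw[OF g(1)])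
  finally show ?thesis .
qed

text \<open>\<open>M\<close> is the matrix of coefficients of a vector of \<open>\<complex>\<^bsup>dA\<^esup> \<otimes> \<complex>\<^bsup>dB\<^esup>\<close>.\<close>

definition schmidt ::
  "nat \<Rightarrow> nat \<Rightarrow> (nat \<Rightarrow> nat \<Rightarrow> complex) \<Rightarrow> nat \<Rightarrow> (nat \<Rightarrow> real) \<Rightarrow>
   (nat \<Rightarrow> nat \<Rightarrow> complex) \<Rightarrow> (nat \<Rightarrow> nat \<Rightarrow> complex) \<Rightarrow> bool" where
  "schmidt dA dB M r s a b \<longleftrightarrow> antimono s \<and> (\<forall>i. 0 \<le> s i) \<and> (\<forall>i\<ge>r. s i = 0) \<and>
     ons dA {..<r} a \<and> ons dB {..<r} b \<and>
     (\<forall>i<dA. \<forall>j<dB. M i j = (\<Sum>x<r. of_real (sqrt (s x)) * a x i * b x j))"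

text \<open>Singular value decomposition: take the eigenvectors \<open>u k\<close> of the Gram
  matrix of the rows of \<open>M\<close>. The components \<open>y k\<close> of \<open>M\<close>
  along them are pairwise orthogonal with squared norms \<open>l k\<close>; the normalized nonzero
  ones form the second family, and a decreasing enumeration of the \<open>l k\<close> sorts the
  coefficients.\<close>

lemma schmidt_exists: "\<exists>r s a b. r \<le> dA \<and> schmidt dA dB M r s a b"
proof -
  define H where "H = (\<lambda>i i'. cip dB (M i) (M i'))"
  have "hermitian dA H" by (auto simp: hermitian_def H_def cnj_cip)
  then obtain u and l :: "nat \<Rightarrow> real" where u: "ons dA {..<dA} u"
    and l: "\<forall>k<dA. \<forall>i<dA. mv dA H (u k) i = of_real (l k) * u k i"
    using spectral by blast
  define y where "y = (\<lambda>k j. cip dA (\<lambda>i. M i j) (u k))"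
  have yy: "cip dB (y k) (y k') = (if k = k' then of_real (l k) else 0)" if "k < dA" "k' < dA" for k k'
  proof -
    have y_eq: "y k = (\<lambda>j. \<Sum>i<dA. cnj (u k i) * M i j)" for k
      by (simp add: y_def cip_def mult.commute)
    have "cip dB (y k) (y k') = (\<Sum>i<dA. cnj (u k i) * (\<Sum>i'<dA. u k' i' * cip dB (M i) (M i')))"
      unfolding y_eq by (simp add: cip_sum_left cip_sum_right)
    also have "\<dots> = (\<Sum>i<dA. cnj (u k i) * mv dA H (u k') i)"
      by (simp add: mv_def H_def mult.commute)
    also have "\<dots> = (\<Sum>i<dA. of_real (l k') * (u k' i * cnj (u k i)))"
      using l that by (intro sum.cong) auto
    also have "\<dots> = of_real (l k') * cip dA (u k') (u k)"
      by (simp add: cip_def sum_distrib_left)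
    finally show ?thesis using onsD[OF u] that by simp
  qed
  have l_sqn: "l k = sqn dB (y k)" if "k < dA" for k
    using yy[OF that that] by (simp add: cip_self)
  \<comment> \<open>Indices with eigenvalue 0 are dropped, since their \<open>y k\<close> vanishes
    and cannot be normalized.\<close>
  define X where "X = {k. k < dA \<and> l k \<noteq> 0}"
  have X: "finite X" "X \<subseteq> {..<dA}" by (auto simp: X_def)
  have y0: "y k j = 0" if "k < dA" "k \<notin> X" "j < dB" for k j
    using l_sqn that sqn_eq_0_iff[of dB "y k"] by (auto simp: X_def)
  have pos: "l k > 0" if "k \<in> X" for k
    using that l_sqn[of k] sqn_nonneg[of dB "y k"] by (auto simp: X_def)
  obtain g where g: "bij_betw g {..<card X} X" and gs: "\<forall>i<card X. l (g i) = decreasing X l i"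
    by (rule decreasing_enumeration[OF X(1)])
  define a where "a = (\<lambda>x. u (g x))"
  define b where "b = (\<lambda>x j. of_real (1 / sqrt (l (g x))) * y (g x) j)"
  have gX: "g x \<in> X" if "x < card X" for x using g that by (auto simp: bij_betw_def)
  have g_lt: "g x < dA" if "x < card X" for x using gX[OF that] by (auto simp: X_def)
  have g_inj: "g x = g x' \<longleftrightarrow> x = x'" if "x < card X" "x' < card X" for x x'
    using g that by (auto simp: bij_betw_def inj_on_def)
  have "ons dA {..<card X} a"
    using u g_lt g_inj by (auto simp: ons_def a_def)
  moreover have "ons dB {..<card X} b"
    unfolding ons_def
  proof (intro ballI)
    fix x x' assume x: "x \<in> {..<card X}" "x' \<in> {..<card X}"
    then show "cip dB (b x) (b x') = (if x = x' then 1 else 0)"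
      using pos[OF gX, of x] unfolding b_def
      by (simp only: cip_scale_left cip_scale_right)
        (auto simp: yy g_lt g_inj simp flip: of_real_mult of_real_divide)
  qed
  moreover have "M i j = (\<Sum>x<card X. of_real (sqrt (decreasing X l x)) * a x i * b x j)"
    if "i < dA" "j < dB" for i j
  proof -
    have "M i j = (\<Sum>k<dA. y k j * u k i)"
      using expand_ons[OF u that(1), of "\<lambda>i. M i j"] by (simp add: y_def)
    also have "\<dots> = (\<Sum>k\<in>X. y k j * u k i)"
      using X y0 that by (intro sum.mono_neutral_right) auto
    also have "\<dots> = (\<Sum>x<card X. y (g x) j * u (g x) i)"
      by (rule sum.reindex_bij_betw[OF g, symmetric])
    also have "\<dots> = (\<Sum>x<card X. of_real (sqrt (decreasing X l x)) * a x i * b x j)"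
    proof (intro sum.cong refl)
      fix x assume "x \<in> {..<card X}"
      then show "y (g x) j * u (g x) i = of_real (sqrt (decreasing X l x)) * a x i * b x j"
        using pos[OF gX, of x] gs by (simp add: a_def b_def flip: of_real_mult)
    qed
    finally show ?thesis .
  qed
  moreover have "card X \<le> dA" using card_mono[OF _ X(2)] by simp
  moreover have "antimono (decreasing X l)" "\<forall>i. 0 \<le> decreasing X l i"
    "\<forall>i\<ge>card X. decreasing X l i = 0"
    using X less_imp_le[OF pos]
    by (auto intro!: antimono_decreasing decreasing_nonneg decreasing_eq_0)
  ultimately show ?thesis unfolding schmidt_def by blast
qed

lemma schmidt_transpose:
  "schmidt dA dB M r s a b \<Longrightarrow> schmidt dB dA (\<lambda>j i. M i j) r s b a"
  unfolding schmidt_def by (auto simp: ac_simps)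

text \<open>Lowering \<open>f\<close> by its value at \<open>l\<close> makes the terms before
  \<open>l\<close> nonnegative and the later ones nonpositive, so full weight on the first
  \<open>l\<close> indices is optimal. The correction, \<open>f l\<close> times the total weight, is
  controlled because that weight is at most \<open>l\<close>.\<close>

lemma sum_mult_le_prefix_sum:
  fixes f c :: "nat \<Rightarrow> real"
  assumes f: "antimono f" "\<And>i. 0 \<le> f i"
    and c: "\<And>x. x < r \<Longrightarrow> 0 \<le> c x" "\<And>x. x < r \<Longrightarrow> c x \<le> 1" "(\<Sum>x<r. c x) \<le> real l"
  shows "(\<Sum>x<r. f x * c x) \<le> (\<Sum>i<l. f i)"
proof -
  have "(\<Sum>x<r. (f x - f l) * c x) \<le> (\<Sum>x<r. if x < l then f x - f l else 0)"
  proof (intro sum_mono)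
    fix x assume x: "x \<in> {..<r}"
    show "(f x - f l) * c x \<le> (if x < l then f x - f l else 0)"
    proof (cases "x < l")
      case True
      then have "f l \<le> f x" using f(1) by (auto simp: antimono_def)
      then show ?thesis using c(2)[of x] x True mult_left_le[of "c x" "f x - f l"] by simp
    next
      case False
      then have "f x \<le> f l" using f(1) by (auto simp: antimono_def)
      then show ?thesis using c(1)[of x] x False by (simp add: mult_nonpos_nonneg)
    qed
  qed
  also have "\<dots> = (\<Sum>x\<in>{..<r} \<inter> {..<l}. f x - f l)"
    by (simp add: sum.If_cases lessThan_def)
  also have "\<dots> \<le> (\<Sum>x<l. f x - f l)"
    using f(1) by (intro sum_mono2) (auto simp: antimono_def)
  finally have "(\<Sum>x<r. f x * c x) - f l * (\<Sum>x<r. c x) \<le> (\<Sum>x<l. f x) - f l * real l"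
    by (simp add: sum_subtractf algebra_simps sum_distrib_left)
  moreover have "f l * (\<Sum>x<r. c x) \<le> f l * real l"
    using c(3) f(2) by (intro mult_left_mono) auto
  ultimately show ?thesis by linarith
qed

text \<open>Summation by parts. With \<open>D l\<close> the prefix sum of the differences, the
  invariant is that the partial sum is at least \<open>f l * D l\<close>; replacing
  \<open>f l\<close> by \<open>f (Suc l)\<close> only shrinks the boundary term because
  \<open>D\<close> is nonnegative.\<close>

lemma sum_mult_mono_prefix:
  fixes f R T :: "nat \<Rightarrow> real"
  assumes f: "antimono f" "\<And>i. 0 \<le> f i"
    and le: "\<And>l. l \<le> n \<Longrightarrow> (\<Sum>i<l. R i) \<le> (\<Sum>i<l. T i)"
  shows "(\<Sum>i<n. f i * R i) \<le> (\<Sum>i<n. f i * T i)"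
proof -
  define D where "D = (\<lambda>l. \<Sum>i<l. T i - R i)"
  have D: "0 \<le> D l" if "l \<le> n" for l using le[OF that] by (simp add: D_def sum_subtractf)
  have "f l * D l \<le> (\<Sum>i<l. f i * (T i - R i))" if "l \<le> n" for l
    using that
  proof (induction l)
    case 0
    then show ?case by (simp add: D_def)
  next
    case (Suc l)
    have "f (Suc l) * D (Suc l) \<le> f l * D (Suc l)"
      using D[OF Suc.prems] f(1) by (intro mult_right_mono) (auto simp: antimono_def)
    also have "\<dots> = f l * D l + f l * (T l - R l)" by (simp add: D_def algebra_simps)
    finally show ?case using Suc by simp
  qed
  from this[of n] D[of n] f(2)[of n] have "0 \<le> (\<Sum>i<n. f i * (T i - R i))"
    by (meson order.refl order.trans mult_nonneg_nonneg)
  then show ?thesis by (simp add: algebra_simps sum_subtractf)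
qed

section \<open>Ky Fan norms and overlaps through partial inner products\<close>

lemma schmidtD:
  assumes "schmidt dA dB M r s a b"
  shows "antimono s" "\<And>i. 0 \<le> s i" "\<And>i. i \<ge> r \<Longrightarrow> s i = 0" "ons dA {..<r} a" "ons dB {..<r} b"
    "\<And>i j. i < dA \<Longrightarrow> j < dB \<Longrightarrow> M i j = (\<Sum>x<r. of_real (sqrt (s x)) * a x i * b x j)"
  using assms unfolding schmidt_def by blast+

lemma schmidt_partial_inner:
  assumes "schmidt dA dB M r s a b" "j < dB"
  shows "cip dA (\<lambda>i. M i j) e = (\<Sum>x<r. (of_real (sqrt (s x)) * cip dA (a x) e) * b x j)"
proof -
  have "cip dA (\<lambda>i. M i j) e = cip dA (\<lambda>i. \<Sum>x<r. (of_real (sqrt (s x)) * b x j) * a x i) e"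
    using schmidtD(6)[OF assms(1) _ assms(2)] by (intro cip_cong) (simp_all add: ac_simps)
  also have "\<dots> = (\<Sum>x<r. (of_real (sqrt (s x)) * b x j) * cip dA (a x) e)"
    by (rule cip_sum_left)
  finally show ?thesis by (simp add: ac_simps)
qed

text \<open>Contracting the first party with \<open>e\<close> leaves a vector of the second one. Its
  squared norm is the expectation in \<open>e\<close> of the reduced state, which is diagonal in the
  \<open>a x\<close> because the \<open>b x\<close> are orthonormal.\<close>

lemma sqn_schmidt_partial_inner:
  assumes "schmidt dA dB M r s a b"
  shows "sqn dB (\<lambda>j. cip dA (\<lambda>i. M i j) e) = (\<Sum>x<r. s x * (cmod (cip dA (a x) e))\<^sup>2)"
proof -
  have "sqn dB (\<lambda>j. cip dA (\<lambda>i. M i j) e) =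
     sqn dB (\<lambda>j. \<Sum>x<r. (of_real (sqrt (s x)) * cip dA (a x) e) * b x j)"
    unfolding sqn_def using schmidt_partial_inner[OF assms] by (intro sum.cong) auto
  also have "\<dots> = (\<Sum>x<r. (cmod (of_real (sqrt (s x)) * cip dA (a x) e))\<^sup>2)"
    using schmidtD(5)[OF assms] by (intro sqn_ons_sum) auto
  finally show ?thesis
    using schmidtD(2)[OF assms] by (simp add: norm_mult power_mult_distrib)
qed

lemma cmod_cip_commute: "cmod (cip n u v) = cmod (cip n v u)"
  by (metis cnj_cip complex_mod_cnj)

lemma sqn_ons: "ons n X a \<Longrightarrow> x \<in> X \<Longrightarrow> sqn n (a x) = 1"
  using onsD[of n X a x x] by (simp add: cip_self)

text \<open>Ky Fan's principle. The left side combines the \<open>s x\<close> with weights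
  \<open>c x\<close>, the squared norms of the projections of \<open>a x\<close> to the span of the
  \<open>e y\<close>. Bessel's inequality for either family bounds each weight by 1 and their sum by
  \<open>card J\<close>.\<close>

lemma ky_fan_le:
  assumes S: "schmidt dA dB M r s a b" and e: "ons dA J e" "finite J" "card J \<le> l"
  shows "(\<Sum>y\<in>J. sqn dB (\<lambda>j. cip dA (\<lambda>i. M i j) (e y))) \<le> (\<Sum>i<l. s i)"
proof -
  define c where "c = (\<lambda>x. \<Sum>y\<in>J. (cmod (cip dA (a x) (e y)))\<^sup>2)"
  have a1: "sqn dA (a x) = 1" if "x < r" for x using sqn_ons[OF schmidtD(4)[OF S]] that by simp
  have "(\<Sum>x<r. c x) = (\<Sum>y\<in>J. \<Sum>x<r. (cmod (cip dA (e y) (a x)))\<^sup>2)"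
    unfolding c_def by (subst sum.swap) (simp add: cmod_cip_commute)
  also have "\<dots> \<le> (\<Sum>y\<in>J. sqn dA (e y))"
    using schmidtD(4)[OF S] by (intro sum_mono bessel) auto
  also have "\<dots> = real (card J)" using sqn_ons[OF e(1)] by simp
  finally have "(\<Sum>x<r. c x) \<le> real l" using e(3) by simp
  moreover have "c x \<le> 1" if "x < r" for x
    using bessel[OF e(1,2), of "a x"] a1[OF that] by (simp add: c_def)
  moreover have "0 \<le> c x" for x by (simp add: c_def sum_nonneg)
  ultimately have "(\<Sum>x<r. s x * c x) \<le> (\<Sum>i<l. s i)"
    using schmidtD(1,2)[OF S] by (intro sum_mult_le_prefix_sum) auto
  moreover have "(\<Sum>y\<in>J. sqn dB (\<lambda>j. cip dA (\<lambda>i. M i j) (e y))) = (\<Sum>x<r. s x * c x)"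
    unfolding sqn_schmidt_partial_inner[OF S] c_def sum_distrib_left by (rule sum.swap)
  ultimately show ?thesis by simp
qed

text \<open>The Schmidt vectors are the maximizers. There are only \<open>r\<close> of them, hence
  \<open>min l r\<close>; coefficients from \<open>r\<close> on vanish.\<close>

lemma ky_fan_attained:
  assumes S: "schmidt dA dB M r s a b"
  shows "(\<Sum>y<min l r. sqn dB (\<lambda>j. cip dA (\<lambda>i. M i j) (a y))) = (\<Sum>i<l. s i)"
proof -
  have "sqn dB (\<lambda>j. cip dA (\<lambda>i. M i j) (a y)) = s y" if "y < r" for y
  proof -
    have "(\<Sum>x<r. s x * (cmod (cip dA (a x) (a y)))\<^sup>2) = (\<Sum>x<r. if x = y then s x else 0)"
      using that onsD[OF schmidtD(4)[OF S]] by (intro sum.cong) auto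
    then show ?thesis using that by (simp add: sqn_schmidt_partial_inner[OF S])
  qed
  then have "(\<Sum>y<min l r. sqn dB (\<lambda>j. cip dA (\<lambda>i. M i j) (a y))) = (\<Sum>y<min l r. s y)"
    by simp
  also have "\<dots> = (\<Sum>i<l. s i)"
    using schmidtD(3)[OF S] by (intro sum.mono_neutral_left) auto
  finally show ?thesis .
qed

lemma sum_schmidt_coefficients:
  assumes "schmidt dA dB M r s a b"
  shows "(\<Sum>i<dA. sqn dB (M i)) = (\<Sum>x<r. s x)"
proof -
  have "(\<Sum>i<dA. sqn dB (M i)) = (\<Sum>j<dB. sqn dA (\<lambda>i. M i j))"
    unfolding sqn_def by (rule sum.swap)
  also have "\<dots> = (\<Sum>j<dB. \<Sum>x<r. (cmod (of_real (sqrt (s x)) * b x j))\<^sup>2)"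
  proof (intro sum.cong refl)
    fix j assume "j \<in> {..<dB}"
    then have "sqn dA (\<lambda>i. M i j) = sqn dA (\<lambda>i. \<Sum>x<r. (of_real (sqrt (s x)) * b x j) * a x i)"
      unfolding sqn_def using schmidtD(6)[OF assms] by (intro sum.cong refl) (simp add: ac_simps)
    then show "sqn dA (\<lambda>i. M i j) = (\<Sum>x<r. (cmod (of_real (sqrt (s x)) * b x j))\<^sup>2)"
      using schmidtD(4)[OF assms] by (simp only: sqn_ons_sum finite_lessThan)
  qed
  also have "\<dots> = (\<Sum>x<r. s x * sqn dB (b x))"
    unfolding sqn_def using schmidtD(2)[OF assms]
    by (subst sum.swap) (simp add: norm_mult power_mult_distrib sum_distrib_left)
  also have "\<dots> = (\<Sum>x<r. s x)"
    using sqn_ons[OF schmidtD(5)[OF assms]] by simp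
  finally show ?thesis .
qed

text \<open>Von Neumann's trace inequality. Products of overlaps between the two pairs of families
  are replaced by the doubly substochastic \<open>D\<close>. This bounds the prefix sums of
  \<open>R\<close> by those of \<open>sqrt (s y)\<close>, and summation by parts against the
  decreasing \<open>sqrt (q y)\<close> concludes.\<close>

lemma overlap_le:
  assumes S: "schmidt dA dB M r s a b" and T: "schmidt dA dB L r' q c d"
  shows "cmod (\<Sum>i<dA. cip dB (M i) (L i)) \<le> (\<Sum>y<r'. sqrt (s y) * sqrt (q y))"
proof -
  note SD = schmidtD[OF S] and TD = schmidtD[OF T]
  define R where "R = (\<lambda>y. cmod (\<Sum>x<r. of_real (sqrt (s x)) * cip dA (a x) (c y) * cip dB (b x) (d y)))"
  \<comment> \<open>By the arithmetic-geometric mean inequality the product of the two moduli is at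
    most \<open>D x y\<close>; Bessel's inequality bounds row and column sums of \<open>D\<close> by
    1.\<close>
  define D where "D = (\<lambda>x y. ((cmod (cip dA (a x) (c y)))\<^sup>2 + (cmod (cip dB (b x) (d y)))\<^sup>2) / 2)"
  have D0: "0 \<le> D x y" for x y by (simp add: D_def)
  have R_le: "R y \<le> (\<Sum>x<r. sqrt (s x) * D x y)" for y
    unfolding R_def
  proof (rule sum_norm_le)
    fix x
    have "cmod (cip dA (a x) (c y)) * cmod (cip dB (b x) (d y)) \<le> D x y"
      using sum_squares_bound[of "cmod (cip dA (a x) (c y))" "cmod (cip dB (b x) (d y))"]
      by (simp add: D_def)
    then show "cmod (of_real (sqrt (s x)) * cip dA (a x) (c y) * cip dB (b x) (d y)) \<le> sqrt (s x) * D x y"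
      using SD(2)[of x] by (simp add: norm_mult mult.assoc mult_left_mono)
  qed
  have prefix: "(\<Sum>y<l. R y) \<le> (\<Sum>i<l. sqrt (s i))" if l: "l \<le> r'" for l
  proof -
    have ons': "ons dA {..<l} c" "ons dB {..<l} d"
      using ons_mono[OF TD(4), of "{..<l}"] ons_mono[OF TD(5), of "{..<l}"] l by auto
    have "(\<Sum>y<l. R y) \<le> (\<Sum>y<l. \<Sum>x<r. sqrt (s x) * D x y)" by (intro sum_mono R_le)
    also have "\<dots> = (\<Sum>x<r. sqrt (s x) * (\<Sum>y<l. D x y))"
      by (subst sum.swap) (simp add: sum_distrib_left)
    also have "\<dots> \<le> (\<Sum>i<l. sqrt (s i))"
    proof (rule sum_mult_le_prefix_sum)
      show "antimono (\<lambda>x. sqrt (s x))" using SD(1) by (auto simp: antimono_def)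
      show "0 \<le> sqrt (s i)" for i using SD(2) by simp
      show "0 \<le> (\<Sum>y<l. D x y)" for x by (simp add: D0 sum_nonneg)
      show "(\<Sum>y<l. D x y) \<le> 1" if "x < r" for x
      proof -
        have "(\<Sum>y<l. D x y) = ((\<Sum>y<l. (cmod (cip dA (a x) (c y)))\<^sup>2) + (\<Sum>y<l. (cmod (cip dB (b x) (d y)))\<^sup>2)) / 2"
          by (simp add: D_def sum.distrib flip: sum_divide_distrib)
        also have "\<dots> \<le> (sqn dA (a x) + sqn dB (b x)) / 2"
          using bessel[OF ons'(1), of "a x"] bessel[OF ons'(2), of "b x"] by simp
        also have "\<dots> = 1" using that sqn_ons[OF SD(4)] sqn_ons[OF SD(5)] by simp
        finally show ?thesis .
      qed
      have "(\<Sum>x<r. \<Sum>y<l. D x y) = (\<Sum>y<l. \<Sum>x<r. D x y)" by (rule sum.swap)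
      also have "\<dots> \<le> (\<Sum>y<l. 1)"
      proof (intro sum_mono)
        fix y assume y: "y \<in> {..<l}"
        have "(\<Sum>x<r. D x y) = ((\<Sum>x<r. (cmod (cip dA (c y) (a x)))\<^sup>2) + (\<Sum>x<r. (cmod (cip dB (d y) (b x)))\<^sup>2)) / 2"
          by (simp add: D_def sum.distrib cmod_cip_commute[of dA "c y"] cmod_cip_commute[of dB "d y"] flip: sum_divide_distrib)
        also have "\<dots> \<le> (sqn dA (c y) + sqn dB (d y)) / 2"
          using bessel[OF SD(4), of "c y"] bessel[OF SD(5), of "d y"] by simp
        also have "\<dots> = 1" using y sqn_ons[OF ons'(1)] sqn_ons[OF ons'(2)] by simp
        finally show "(\<Sum>x<r. D x y) \<le> 1" .
      qed
      finally show "(\<Sum>x<r. \<Sum>y<l. D x y) \<le> real l" by simp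
    qed
    finally show ?thesis .
  qed
  have "(\<Sum>i<dA. cip dB (M i) (L i)) =
     (\<Sum>i<dA. \<Sum>y<r'. \<Sum>x<r. of_real (sqrt (q y)) * (of_real (sqrt (s x)) * (a x i * cnj (c y i)) * cip dB (b x) (d y)))"
  proof (intro sum.cong refl)
    fix i assume i: "i \<in> {..<dA}"
    have "cip dB (M i) (L i) = cip dB (\<lambda>j. \<Sum>x<r. (of_real (sqrt (s x)) * a x i) * b x j)
        (\<lambda>j. \<Sum>y<r'. (of_real (sqrt (q y)) * c y i) * d y j)"
      using SD(6) TD(6) i by (intro cip_cong) auto
    also have "\<dots> = (\<Sum>x<r. \<Sum>y<r'. of_real (sqrt (q y)) * (of_real (sqrt (s x)) * (a x i * cnj (c y i)) * cip dB (b x) (d y)))"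
      unfolding cip_sum_left cip_sum_right by (simp add: sum_distrib_left ac_simps)
    finally show "cip dB (M i) (L i) = (\<Sum>y<r'. \<Sum>x<r. of_real (sqrt (q y)) * (of_real (sqrt (s x)) * (a x i * cnj (c y i)) * cip dB (b x) (d y)))"
      by (subst sum.swap)
  qed
  also have "\<dots> = (\<Sum>y<r'. \<Sum>i<dA. \<Sum>x<r. of_real (sqrt (q y)) * (of_real (sqrt (s x)) * (a x i * cnj (c y i)) * cip dB (b x) (d y)))"
    by (rule sum.swap)
  also have "\<dots> = (\<Sum>y<r'. of_real (sqrt (q y)) * (\<Sum>x<r. of_real (sqrt (s x)) * cip dA (a x) (c y) * cip dB (b x) (d y)))"
    unfolding cip_def[of dA]
    by (intro sum.cong refl, subst sum.swap)
      (simp add: sum_distrib_left sum_distrib_right mult.assoc)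
  finally have "cmod (\<Sum>i<dA. cip dB (M i) (L i)) \<le>
      (\<Sum>y<r'. cmod (of_real (sqrt (q y)) * (\<Sum>x<r. of_real (sqrt (s x)) * cip dA (a x) (c y) * cip dB (b x) (d y))))"
    by (simp only: norm_sum)
  also have "\<dots> = (\<Sum>y<r'. sqrt (q y) * R y)"
    using TD(2) by (simp add: norm_mult R_def)
  also have "\<dots> \<le> (\<Sum>y<r'. sqrt (q y) * sqrt (s y))"
  proof (rule sum_mult_mono_prefix)
    show "antimono (\<lambda>x. sqrt (q x))" using TD(1) by (auto simp: antimono_def)
    show "0 \<le> sqrt (q i)" for i using TD(2) by simp
  qed (rule prefix)
  finally show ?thesis by (simp add: mult.commute)
qed

section \<open>Majorization and permutations\<close>

lemma sum_lessThan_split_at: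
  fixes f :: "nat \<Rightarrow> real"
  assumes "j < l"
  shows "(\<Sum>i<l. f i) = (\<Sum>i<j. f i) + f j + (\<Sum>i=Suc j..<l. f i)"
proof -
  have "(\<Sum>i<l. f i) = (\<Sum>i=0..<Suc j. f i) + (\<Sum>i=Suc j..<l. f i)"
    using assms by (subst sum.atLeastLessThan_concat) (auto simp: atLeast0LessThan)
  then show ?thesis by (simp add: atLeast0LessThan)
qed

text \<open>
  The inductive step moves mass \<open>\<delta>\<close> from \<open>q j\<close> to \<open>q k\<close>, where \<open>p j < q j\<close> and \<open>k > j\<close> is the first
  index with \<open>p k > q k\<close>; this is a convex combination of \<open>q\<close> and its composition with a transposition.
\<close>

lemma majorized_imp_convex_combination_of_permutations:
  fixes p q :: "nat \<Rightarrow> real"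
  assumes p: "\<And>i j. i \<le> j \<Longrightarrow> j < n \<Longrightarrow> p j \<le> p i"
    and le: "\<And>l. l \<le> n \<Longrightarrow> (\<Sum>i<l. p i) \<le> (\<Sum>i<l. q i)"
    and eq: "(\<Sum>i<n. p i) = (\<Sum>i<n. q i)"
  shows "\<exists>t. (\<forall>\<pi>. 0 \<le> t \<pi>) \<and> (\<Sum>\<pi> | \<pi> permutes {..<n}. t \<pi>) = 1 \<and>
     (\<forall>i<n. p i = (\<Sum>\<pi> | \<pi> permutes {..<n}. t \<pi> * q (\<pi> i)))"
  using le eq
proof (induction "card {i. i < n \<and> p i \<noteq> q i}" arbitrary: q rule: less_induct)
  case less
  have fin: "finite {\<pi>. \<pi> permutes {..<n}}" by (simp add: finite_permutations)
  show ?case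
  proof (cases "\<forall>i<n. p i = q i")
    case True
    define t where "t = (\<lambda>\<pi> :: nat \<Rightarrow> nat. if \<pi> = id then 1 else 0 :: real)"
    have "(\<Sum>\<pi> | \<pi> permutes {..<n}. t \<pi> * f \<pi>) = f id" for f
    proof -
      have "(\<Sum>\<pi> | \<pi> permutes {..<n}. t \<pi> * f \<pi>) = (\<Sum>\<pi> | \<pi> permutes {..<n}. if \<pi> = id then f \<pi> else 0)"
        by (intro sum.cong) (auto simp: t_def)
      then show ?thesis using fin permutes_id[of "{..<n}"] by simp
    qed
    from this[of "\<lambda>_. 1"] this[of "\<lambda>\<pi>. q (\<pi> _)"] True show ?thesis
      by (intro exI[of _ t]) (auto simp: t_def)
  next
    case False
    have "\<exists>j<n. p j < q j"
    proof (rule ccontr)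
      assume "\<not> ?thesis"
      then have ge: "\<forall>i<n. 0 \<le> p i - q i" by auto
      have "(\<Sum>i<n. p i - q i) = 0" using less.prems(2) by (simp add: sum_subtractf)
      then have "\<forall>i\<in>{..<n}. p i - q i = 0"
        using ge by (subst sum_nonneg_eq_0_iff[symmetric]) auto
      with False show False by auto
    qed
    then obtain j where j: "j < n" "p j < q j" by blast
    have ex: "\<exists>k. j < k \<and> k < n \<and> q k < p k"
    proof (rule ccontr)
      assume "\<not> ?thesis"
      then have "(\<Sum>i=Suc j..<n. p i) \<le> (\<Sum>i=Suc j..<n. q i)"
        by (intro sum_mono) auto
      with less.prems(1)[of j] less.prems(2) j
        sum_lessThan_split_at[OF j(1), of p] sum_lessThan_split_at[OF j(1), of q]
      show False by simp
    qed
    define k where "k = (LEAST k. j < k \<and> k < n \<and> q k < p k)"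
    have k: "j < k" "k < n" "q k < p k" using LeastI_ex[OF ex] unfolding k_def by auto
    have between: "p i \<le> q i" if "j < i" "i < k" for i
      using not_less_Least[of i "\<lambda>k. j < k \<and> k < n \<and> q k < p k"] that k(2)
      unfolding k_def by force
    \<comment> \<open>The smaller of the two defects: the transfer makes \<open>p\<close> and
      \<open>q\<close> agree at \<open>j\<close> or at \<open>k\<close> and spoils no index where
      they agreed, so the number of disagreements drops.\<close>
    define \<delta> where "\<delta> = min (q j - p j) (p k - q k)"
    have \<delta>: "0 < \<delta>" "\<delta> \<le> q j - p j" "\<delta> \<le> p k - q k" using j k by (auto simp: \<delta>_def)
    \<comment> \<open>\<open>q\<close> is not assumed decreasing, as the transfer can destroy that;
      \<open>q k < p k \<le> p j < q j\<close> follows from the order of \<open>p\<close>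
      alone.\<close>
    have pjk: "p k \<le> p j" using p[of j k] k by simp
    define \<epsilon> where "\<epsilon> = \<delta> / (q j - q k)"
    have pos: "0 < q j - q k" using pjk j k by linarith
    have "\<delta> \<le> q j - q k" using \<delta> pjk by linarith
    then have \<epsilon>: "0 \<le> \<epsilon>" "\<epsilon> \<le> 1" "\<epsilon> * (q j - q k) = \<delta>" using pos \<delta> by (auto simp: \<epsilon>_def)
    define q' where "q' = (\<lambda>i. q i - (if i = j then \<delta> else 0) + (if i = k then \<delta> else 0))"
    have sum_q': "(\<Sum>i<l. q' i) = (\<Sum>i<l. q i) - (if j < l then \<delta> else 0) + (if k < l then \<delta> else 0)" for l
      by (simp add: q'_def sum.distrib sum_subtractf)
    define \<tau> where "\<tau> = transpose j k"
    have \<tau>: "\<tau> permutes {..<n}" using j k by (auto simp: \<tau>_def intro!: permutes_swap_id)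
    have \<tau>\<tau>: "\<tau> (\<tau> i) = i" for i by (simp add: \<tau>_def)
    have q'_eq: "q' i = (1 - \<epsilon>) * q i + \<epsilon> * q (\<tau> i)" for i
      using \<epsilon>(3) k(1) by (auto simp: q'_def \<tau>_def transpose_def algebra_simps)
    have "\<exists>t. (\<forall>\<pi>. 0 \<le> t \<pi>) \<and> (\<Sum>\<pi> | \<pi> permutes {..<n}. t \<pi>) = 1 \<and>
      (\<forall>i<n. p i = (\<Sum>\<pi> | \<pi> permutes {..<n}. t \<pi> * q' (\<pi> i)))"
    proof (rule less.hyps)
      have "{i. i < n \<and> p i \<noteq> q' i} \<subset> {i. i < n \<and> p i \<noteq> q i}"
      proof
        show "{i. i < n \<and> p i \<noteq> q' i} \<subseteq> {i. i < n \<and> p i \<noteq> q i}"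
          using j k by (auto simp: q'_def)
        have "q' j = p j \<or> q' k = p k" using k(1) by (auto simp: q'_def \<delta>_def)
        then have "j \<notin> {i. i < n \<and> p i \<noteq> q' i} \<or> k \<notin> {i. i < n \<and> p i \<noteq> q' i}" by auto
        moreover have "j \<in> {i. i < n \<and> p i \<noteq> q i}" "k \<in> {i. i < n \<and> p i \<noteq> q i}"
          using j k by auto
        ultimately show "{i. i < n \<and> p i \<noteq> q' i} \<noteq> {i. i < n \<and> p i \<noteq> q i}" by metis
      qed
      then show "card {i. i < n \<and> p i \<noteq> q' i} < card {i. i < n \<and> p i \<noteq> q i}"
        by (intro psubset_card_mono) auto
      show "(\<Sum>i<n. p i) = (\<Sum>i<n. q' i)" using less.prems(2) j k by (simp add: sum_q')
      \<comment> \<open>Only prefix sums with \<open>j < l \<le> k\<close> lose the mass \<delta>.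
        There the domination before \<open>j\<close>, the gap at \<open>j\<close> and
        \<open>p i \<le> q i\<close> strictly between \<open>j\<close> and \<open>k\<close> make up
        for it.\<close>
      show "(\<Sum>i<l. p i) \<le> (\<Sum>i<l. q' i)" if l: "l \<le> n" for l
      proof (cases "j < l \<and> l \<le> k")
        case True
        then have "(\<Sum>i=Suc j..<l. p i) \<le> (\<Sum>i=Suc j..<l. q i)"
          using between by (intro sum_mono) auto
        then show ?thesis
          using True less.prems(1)[of j] j(1) \<delta>(2) sum_lessThan_split_at[of j l p]
            sum_lessThan_split_at[of j l q] by (simp add: sum_q')
      next
        case False
        then show ?thesis using less.prems(1)[OF l] k(1) by (auto simp: sum_q')
      qed
    qed
    then obtain t where t: "\<forall>\<pi>. 0 \<le> t \<pi>" "(\<Sum>\<pi> | \<pi> permutes {..<n}. t \<pi>) = 1"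
      "\<forall>i<n. p i = (\<Sum>\<pi> | \<pi> permutes {..<n}. t \<pi> * q' (\<pi> i))" by blast
    \<comment> \<open>As \<open>q'\<close> mixes \<open>q\<close> with
      \<open>q \<circ> \<tau>\<close>, the weights are mixed in the same way; since \<tau> is an
      involution, reindexing moves it from the argument of \<open>q\<close> to the index of the
      weight.\<close>
    define t' where "t' = (\<lambda>\<pi>. (1 - \<epsilon>) * t \<pi> + \<epsilon> * t (\<tau> \<circ> \<pi>))"
    have sum_t': "(\<Sum>\<pi> | \<pi> permutes {..<n}. t' \<pi> * f \<pi>) =
      (1 - \<epsilon>) * (\<Sum>\<pi> | \<pi> permutes {..<n}. t \<pi> * f \<pi>) +
      \<epsilon> * (\<Sum>\<pi> | \<pi> permutes {..<n}. t \<pi> * f (\<tau> \<circ> \<pi>))" for f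
    proof -
      have "(\<Sum>\<pi> | \<pi> permutes {..<n}. t (\<tau> \<circ> \<pi>) * f \<pi>) =
          (\<Sum>\<pi> | \<pi> permutes {..<n}. t (\<tau> \<circ> \<pi>) * f (\<tau> \<circ> (\<tau> \<circ> \<pi>)))"
        by (simp add: comp_def \<tau>\<tau>)
      also have "\<dots> = (\<Sum>\<pi> | \<pi> permutes {..<n}. t \<pi> * f (\<tau> \<circ> \<pi>))"
        using setum_permutations_compose_left[OF \<tau>, of "\<lambda>\<pi>. t \<pi> * f (\<tau> \<circ> \<pi>)"] by simp
      finally show ?thesis
        by (simp add: t'_def distrib_right sum.distrib mult.assoc flip: sum_distrib_left)
    qed
    have "\<forall>\<pi>. 0 \<le> t' \<pi>" using t(1) \<epsilon> by (simp add: t'_def)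
    moreover have "(\<Sum>\<pi> | \<pi> permutes {..<n}. t' \<pi>) = 1"
      using sum_t'[of "\<lambda>_. 1"] t(2) by simp
    moreover have "p i = (\<Sum>\<pi> | \<pi> permutes {..<n}. t' \<pi> * q (\<pi> i))" if "i < n" for i
      using t(3) that unfolding sum_t' q'_eq
      by (simp add: distrib_left sum.distrib mult.left_commute sum_distrib_left)
    ultimately show ?thesis by blast
  qed
qed

section \<open>Fidelity with a pure state\<close>

definition basis_fun :: "nat \<Rightarrow> nat \<Rightarrow> complex" where
  "basis_fun i = (\<lambda>r. if r = i then 1 else 0)"

section \<open>Positive semidefinite matrices and their roots\<close>

lemma cip_basis_fun: "j < n \<Longrightarrow> cip n v (basis_fun j) = v j"
  by (simp add: cip_def basis_fun_def if_distrib cong: if_cong)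

lemma mv_basis_fun: "j < n \<Longrightarrow> mv n H (basis_fun j) i = H i j"
  by (simp add: mv_def basis_fun_def if_distrib cong: if_cong)

lemma complex_of_real_nonneg_iff: "0 \<le> complex_of_real x \<longleftrightarrow> 0 \<le> x"
  by (simp add: less_eq_complex_def)

definition psd :: "nat \<Rightarrow> (nat \<Rightarrow> nat \<Rightarrow> complex) \<Rightarrow> bool" where
  "psd n H \<longleftrightarrow> (\<forall>v. 0 \<le> cip n (mv n H v) v)"

lemma cip_add_right: "cip n v (\<lambda>i. u i + w i) = cip n v u + cip n v w"
  unfolding cip_def by (simp add: sum.distrib algebra_simps)

text \<open>In the order on complex numbers nonnegativity includes being real. Realness of the
  quadratic form at \<open>u + w\<close> and at \<open>u + \<i> w\<close> gives, by polarization,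
  the imaginary and the real part of the symmetry.\<close>

lemma psd_imp_hermitian:
  assumes "psd n H"
  shows "hermitian n H"
  unfolding hermitian_def
proof (intro allI impI)
  fix i j assume ij: "i < n" "j < n"
  define B where "B = (\<lambda>u v. cip n (mv n H u) v)"
  have real: "Im (B v v) = 0" for v
    using assms unfolding psd_def B_def less_eq_complex_def by auto
  have expand: "B (\<lambda>r. u r + c * w r) (\<lambda>r. u r + c * w r) =
      B u u + cnj c * B u w + c * B w u + c * cnj c * B w w" for u w c
    unfolding B_def mv_add mv_scale cip_add_left cip_add_right cip_scale_left cip_scale_right
    by (simp add: algebra_simps)
  let ?u = "basis_fun i" and ?w = "basis_fun j"
  have "Im (B ?u ?w) + Im (B ?w ?u) = 0"
    using expand[of ?u 1 ?w] real[of ?u] real[of ?w] real[of "\<lambda>r. ?u r + 1 * ?w r"] by simp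
  moreover have "Re (B ?w ?u) - Re (B ?u ?w) = 0"
    using expand[of ?u \<i> ?w] real[of ?u] real[of ?w] real[of "\<lambda>r. ?u r + \<i> * ?w r"] by simp
  moreover have "B ?u ?w = H j i" "B ?w ?u = H i j"
    using ij by (simp_all add: B_def cip_basis_fun mv_basis_fun)
  ultimately show "H j i = cnj (H i j)" by (simp add: complex_eq_iff)
qed

lemma mv_eqI_ons:
  assumes u: "ons n {..<n} u" and eq: "\<And>k i. k < n \<Longrightarrow> i < n \<Longrightarrow> mv n B (u k) i = mv n C (u k) i"
    and ij: "i < n" "j < n"
  shows "B i j = C i j"
proof -
  have *: "mv n H (basis_fun j) i = (\<Sum>k<n. cip n (basis_fun j) (u k) * mv n H (u k) i)" for H
  proof -
    have "mv n H (basis_fun j) = mv n H (\<lambda>i. \<Sum>k<n. cip n (basis_fun j) (u k) * u k i)"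
      using expand_ons[OF u] by (intro mv_cong) auto
    then show ?thesis by (simp add: mv_sum)
  qed
  have "mv n B (basis_fun j) i = mv n C (basis_fun j) i"
    unfolding * using eq ij by (intro sum.cong) auto
  then show ?thesis using ij by (simp add: mv_basis_fun)
qed

lemma mv_mv: "mv n B (mv n C v) i = mv n (\<lambda>i j. \<Sum>k<n. B i k * C k j) v i"
proof -
  have "mv n B (mv n C v) i = (\<Sum>k<n. \<Sum>j<n. B i k * C k j * v j)"
    by (simp add: mv_def sum_distrib_left mult.assoc)
  also have "\<dots> = (\<Sum>j<n. \<Sum>k<n. B i k * C k j * v j)" by (rule sum.swap)
  finally show ?thesis by (simp add: mv_def sum_distrib_right)
qed

text \<open>On an eigenvector \<open>u\<close> of \<open>B\<close> with eigenvalue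
  \<open>l \<ge> 0\<close> the squares agree, so \<open>(C + l) (C - l) u = 0\<close>. For
  \<open>l > 0\<close> the vector \<open>z = (C - l) u\<close> satisfies \<open>C z = - l z\<close>,
  and positivity of \<open>C\<close> forces \<open>z = 0\<close>. For \<open>l = 0\<close> the
  squared norm of \<open>C u\<close> is the inner product of \<open>u\<close> with
  \<open>C (C u) = 0\<close>. Hence \<open>C\<close> acts like \<open>B\<close> on an
  eigenbasis.\<close>

lemma psd_root_unique:
  assumes B: "psd n B" and C: "psd n C"
    and eq: "\<And>i j. i < n \<Longrightarrow> j < n \<Longrightarrow> (\<Sum>k<n. B i k * B k j) = (\<Sum>k<n. C i k * C k j)"
    and ij: "i < n" "j < n"
  shows "B i j = C i j"
proof -
  obtain u and l :: "nat \<Rightarrow> real" where u: "ons n {..<n} u"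
    and l: "\<forall>k<n. \<forall>i<n. mv n B (u k) i = of_real (l k) * u k i"
    using spectral[OF psd_imp_hermitian[OF B]] by blast
  have C_u: "mv n C (u k) i = of_real (l k) * u k i" if k: "k < n" and i: "i < n" for k i
  proof -
    have "cip n (mv n B (u k)) (u k) = of_real (l k) * cip n (u k) (u k)"
      unfolding cip_scale_left[symmetric] using l k by (intro cip_cong) auto
    then have "cip n (mv n B (u k)) (u k) = of_real (l k)" using onsD[OF u, of k k] k by simp
    moreover have "0 \<le> cip n (mv n B (u k)) (u k)" using B by (simp add: psd_def)
    ultimately have l0: "0 \<le> l k" by (simp add: less_eq_complex_def)
    have BB: "mv n B (mv n B (u k)) i = (of_real (l k))\<^sup>2 * u k i" if "i < n" for i
    proof -
      have "mv n B (mv n B (u k)) = mv n B (\<lambda>i. of_real (l k) * u k i)"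
        using l k by (intro mv_cong) auto
      then show ?thesis using l k that by (simp add: mv_scale power2_eq_square)
    qed
    have CC: "mv n C (mv n C (u k)) i = (of_real (l k))\<^sup>2 * u k i" if "i < n" for i
    proof -
      have "mv n C (mv n C (u k)) i = mv n B (mv n B (u k)) i"
        unfolding mv_mv unfolding mv_def using eq that by (intro sum.cong) auto
      then show ?thesis using BB that by simp
    qed
    show ?thesis
    proof (cases "l k = 0")
      case True
      have "cip n (mv n C (u k)) (mv n C (u k)) = cip n (u k) (mv n C (mv n C (u k)))"
        by (rule cip_hermitian[OF psd_imp_hermitian[OF C]])
      also have "\<dots> = cip n (u k) (\<lambda>i. 0 * u k i)" using CC True by (intro cip_cong) auto
      also have "\<dots> = 0" by (simp add: cip_def)
      finally have "\<forall>i<n. mv n C (u k) i = 0" by (simp add: cip_self sqn_eq_0_iff)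
      then show ?thesis using True i by simp
    next
      case False
      define z where "z = (\<lambda>i. mv n C (u k) i - of_real (l k) * u k i)"
      have "mv n C z i = - of_real (l k) * z i" if "i < n" for i
      proof -
        have "mv n C z i = mv n C (mv n C (u k)) i - of_real (l k) * mv n C (u k) i"
          by (simp add: z_def mv_def sum_subtractf algebra_simps sum_distrib_left)
        then show ?thesis using CC[OF that] by (simp add: z_def power2_eq_square algebra_simps)
      qed
      then have "cip n (mv n C z) z = cip n (\<lambda>i. - of_real (l k) * z i) z"
        by (intro cip_cong) auto
      also have "\<dots> = of_real (- l k * sqn n z)" by (simp only: cip_scale_left cip_self) simp
      finally have eq: "cip n (mv n C z) z = of_real (- l k * sqn n z)" .
      have "0 \<le> cip n (mv n C z) z" using C by (simp add: psd_def)
      then have "0 \<le> - l k * sqn n z" unfolding eq complex_of_real_nonneg_iff .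
      moreover have "0 \<le> l k * sqn n z" using l0 sqn_nonneg[of n z] by simp
      ultimately have "l k * sqn n z = 0" by simp
      then have "sqn n z = 0" using False by simp
      then show ?thesis using i by (simp add: sqn_eq_0_iff z_def)
    qed
  qed
  show ?thesis
    by (rule mv_eqI_ons[OF u _ ij]) (use l C_u in auto)
qed

lemma psd_root_exists:
  assumes H: "psd n H"
  shows "\<exists>R. psd n R \<and> (\<forall>i<n. \<forall>j<n. (\<Sum>k<n. R i k * R k j) = H i j)"
proof -
  obtain u and l :: "nat \<Rightarrow> real" where u: "ons n {..<n} u"
    and l: "\<forall>k<n. \<forall>i<n. mv n H (u k) i = of_real (l k) * u k i"
    using spectral[OF psd_imp_hermitian[OF H]] by blast
  have l0: "0 \<le> l k" if "k < n" for k
  proof -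
    have "cip n (mv n H (u k)) (u k) = of_real (l k) * cip n (u k) (u k)"
      unfolding cip_scale_left[symmetric] using l that by (intro cip_cong) auto
    then have "cip n (mv n H (u k)) (u k) = of_real (l k)" using onsD[OF u, of k k] that by simp
    moreover have "0 \<le> cip n (mv n H (u k)) (u k)" using H by (simp add: psd_def)
    ultimately show ?thesis by (simp add: less_eq_complex_def)
  qed
  define R where "R = (\<lambda>i j. \<Sum>k<n. of_real (sqrt (l k)) * u k i * cnj (u k j))"
  have mvR: "mv n R v = (\<lambda>i. \<Sum>k<n. (of_real (sqrt (l k)) * cip n v (u k)) * u k i)" for v
  proof
    fix i
    have "mv n R v i = (\<Sum>j<n. \<Sum>k<n. of_real (sqrt (l k)) * u k i * cnj (u k j) * v j)"
      by (simp add: mv_def R_def sum_distrib_right)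
    also have "\<dots> = (\<Sum>k<n. \<Sum>j<n. of_real (sqrt (l k)) * u k i * cnj (u k j) * v j)"
      by (rule sum.swap)
    finally show "mv n R v i = (\<Sum>k<n. (of_real (sqrt (l k)) * cip n v (u k)) * u k i)"
      by (simp add: cip_def sum_distrib_left sum_distrib_right ac_simps)
  qed
  have R_u: "mv n R (u k) i = of_real (sqrt (l k)) * u k i" if "k < n" for k i
  proof -
    have "mv n R (u k) i = (\<Sum>k'<n. if k' = k then of_real (sqrt (l k)) * u k i else 0)"
      unfolding mvR using that onsD[OF u, of k] by (intro sum.cong) auto
    then show ?thesis using that by simp
  qed
  have "psd n R"
    unfolding psd_def
  proof
    fix v
    have "cip n (mv n R v) v = (\<Sum>k<n. of_real (sqrt (l k)) * (cip n v (u k) * cnj (cip n v (u k))))"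
      unfolding mvR cip_sum_left by (simp add: cnj_cip mult.assoc)
    also have "\<dots> = of_real (\<Sum>k<n. sqrt (l k) * (cmod (cip n v (u k)))\<^sup>2)"
      unfolding complex_norm_square[symmetric] by simp
    finally have eq: "cip n (mv n R v) v = of_real (\<Sum>k<n. sqrt (l k) * (cmod (cip n v (u k)))\<^sup>2)" .
    show "0 \<le> cip n (mv n R v) v"
      unfolding eq complex_of_real_nonneg_iff using l0 by (intro sum_nonneg) auto
  qed
  moreover have "(\<Sum>k<n. R i k * R k j) = H i j" if "i < n" "j < n" for i j
  proof (rule mv_eqI_ons[OF u _ that])
    fix k i assume ki: "k < n" "i < n"
    have "mv n (\<lambda>i j. \<Sum>k<n. R i k * R k j) (u k) i = mv n R (mv n R (u k)) i"
      by (simp only: mv_mv)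
    also have "mv n R (mv n R (u k)) = mv n R (\<lambda>i. of_real (sqrt (l k)) * u k i)"
      by (intro mv_cong R_u ki)
    also have "mv n R (\<lambda>i. of_real (sqrt (l k)) * u k i) i = of_real (sqrt (l k) * sqrt (l k)) * u k i"
      unfolding mv_scale R_u[OF ki(1)] by (simp only: of_real_mult mult.assoc)
    also have "\<dots> = mv n H (u k) i" using l l0 ki by simp
    finally show "mv n (\<lambda>i j. \<Sum>k<n. R i k * R k j) (u k) i = mv n H (u k) i" .
  qed
  ultimately show ?thesis by blast
qed

section \<open>Passage to the matrices of the definitions, and the fidelity with a pure
  state\<close>

abbreviation ent :: "complex mat \<Rightarrow> nat \<Rightarrow> nat \<Rightarrow> complex" where
  "ent A i j \<equiv> A $$ (i, j)"

lemma cip_ent: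
  assumes "A \<in> carrier_mat n n" "v \<in> carrier_vec n"
  shows "(A *\<^sub>v v) \<bullet>c v = cip n (mv n (ent A) (($) v)) (($) v)"
  using assms
  by (auto simp: scalar_prod_def cip_def mv_def atLeast0LessThan intro!: sum.cong)

lemma positive_semidefinite_iff:
  "positive_semidefinite n A \<longleftrightarrow> A \<in> carrier_mat n n \<and> psd n (ent A)"
proof (cases "A \<in> carrier_mat n n")
  case A: True
  have "0 \<le> cip n (mv n (ent A) v) v" if "\<forall>v\<in>carrier_vec n. 0 \<le> (A *\<^sub>v v) \<bullet>c v" for v
  proof -
    have "(A *\<^sub>v vec n v) \<bullet>c vec n v = cip n (mv n (ent A) v) v"
      using A by (subst cip_ent) (auto intro!: cip_cong simp: mv_def)
    then show ?thesis using that by (metis vec_carrier)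
  qed
  then show ?thesis
    using A by (auto simp: positive_semidefinite_def psd_def cip_ent)
qed (simp add: positive_semidefinite_def)

lemma mult_ent:
  assumes "A \<in> carrier_mat n m" "B \<in> carrier_mat m k" "i < n" "j < k"
  shows "(A * B) $$ (i, j) = (\<Sum>r<m. A $$ (i, r) * B $$ (r, j))"
  using assms by (auto simp: scalar_prod_def atLeast0LessThan intro!: sum.cong)

text \<open>Uniqueness resolves the definite description, so that roots are computed by exhibiting
  them.\<close>

lemma mat_sqrt_eqI:
  assumes B: "positive_semidefinite n B" and A: "B * B = A"
  shows "mat_sqrt A = B"
  unfolding mat_sqrt_def
proof (rule the_equality)
  have BC: "B \<in> carrier_mat n n" using B by (simp add: positive_semidefinite_def)
  then have dim: "dim_row A = n" using A by auto
  show "positive_semidefinite (dim_row A) B \<and> B * B = A" using B A dim by simp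
  fix C assume C: "positive_semidefinite (dim_row A) C \<and> C * C = A"
  then have CC: "C \<in> carrier_mat n n" by (simp add: positive_semidefinite_def dim)
  have "C $$ (i, j) = B $$ (i, j)" if "i < n" "j < n" for i j
  proof (rule psd_root_unique[of n "ent C" "ent B"])
    show "psd n (ent C)" "psd n (ent B)"
      using B C by (simp_all add: positive_semidefinite_iff dim)
    show "(\<Sum>k<n. ent C i k * ent C k j) = (\<Sum>k<n. ent B i k * ent B k j)" if "i < n" "j < n" for i j
      using mult_ent[OF BC BC that] mult_ent[OF CC CC that] C A by simp
  qed (use that in auto)
  then show "C = B" using BC CC by (intro eq_matI) auto
qed

lemma mat_sqrt_works:
  assumes "positive_semidefinite n A"
  shows "positive_semidefinite n (mat_sqrt A)" "mat_sqrt A * mat_sqrt A = A"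
proof -
  have A: "A \<in> carrier_mat n n" "psd n (ent A)" using assms by (simp_all add: positive_semidefinite_iff)
  obtain R where R: "psd n R" "\<forall>i<n. \<forall>j<n. (\<Sum>k<n. R i k * R k j) = ent A i j"
    using psd_root_exists[OF A(2)] by blast
  define S where "S = mat n n (\<lambda>(i, j). R i j)"
  have S: "S \<in> carrier_mat n n" by (simp add: S_def)
  have "cip n (mv n (ent S) v) v = cip n (mv n R v) v" for v
    by (intro cip_cong) (auto simp: mv_def S_def)
  then have psd: "positive_semidefinite n S" using R(1) S by (simp add: positive_semidefinite_iff psd_def)
  have SS: "S * S = A"
  proof (rule eq_matI)
    fix i j assume "i < dim_row A" "j < dim_col A"
    then have ij: "i < n" "j < n" using A by auto
    show "(S * S) $$ (i, j) = A $$ (i, j)"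
      unfolding mult_ent[OF S S ij] using R(2) ij by (simp add: S_def)
  qed (use A S in auto)
  from mat_sqrt_eqI[OF psd SS] psd SS
  show "positive_semidefinite n (mat_sqrt A)" "mat_sqrt A * mat_sqrt A = A" by auto
qed

lemma index_mat_adjoint:
  "i < dim_col A \<Longrightarrow> j < dim_row A \<Longrightarrow> mat_adjoint A $$ (i, j) = cnj (A $$ (j, i))"
  by (simp add: mat_adjoint_def mat_of_rows_def)

lemma mat_adjoint_carrier: "A \<in> carrier_mat n m \<Longrightarrow> mat_adjoint A \<in> carrier_mat m n"
  by (auto simp: mat_adjoint_def)

text \<open>These facts evaluate the fidelity with a pure state: \<open>c = 1\<close> gives the root
  of \<open>ket_bra \<phi>\<close>, and the root of the expectation of the other state gives the
  absolute value and its trace.\<close>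

lemma scaled_ket_bra:
  assumes \<phi>: "pure_state n \<phi>" and c: "0 \<le> c"
  shows "positive_semidefinite n (of_real c \<cdot>\<^sub>m ket_bra \<phi>)"
    and "(of_real c \<cdot>\<^sub>m ket_bra \<phi>) * (of_real c \<cdot>\<^sub>m ket_bra \<phi>) = of_real (c * c) \<cdot>\<^sub>m ket_bra \<phi>"
    and "mat_trace (of_real c \<cdot>\<^sub>m ket_bra \<phi>) = of_real c"
proof -
  have dim: "dim_vec \<phi> = n" and norm: "(\<Sum>k<n. \<phi> $ k * cnj (\<phi> $ k)) = 1"
    using \<phi> by (auto simp: pure_state_def scalar_prod_def atLeast0LessThan)
  let ?K = "of_real c \<cdot>\<^sub>m ket_bra \<phi>"
  have K: "?K \<in> carrier_mat n n" by (auto simp: ket_bra_def dim)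
  have K_ent: "?K $$ (i, j) = of_real c * (\<phi> $ i * cnj (\<phi> $ j))" if "i < n" "j < n" for i j
    using that by (simp add: ket_bra_def dim)
  have "0 \<le> cip n (mv n (ent ?K) v) v" for v
  proof -
    have "mv n (ent ?K) v i = of_real c * cip n v (($) \<phi>) * \<phi> $ i" if "i < n" for i
      using that K_ent by (simp add: mv_def cip_def sum_distrib_left sum_distrib_right ac_simps)
    then have "cip n (mv n (ent ?K) v) v = cip n (\<lambda>i. of_real c * cip n v (($) \<phi>) * \<phi> $ i) v"
      by (intro cip_cong) auto
    also have "\<dots> = of_real c * (cip n v (($) \<phi>) * cnj (cip n v (($) \<phi>)))"
      by (simp only: cip_scale_left cnj_cip mult.assoc)
    also have "\<dots> = of_real (c * (cmod (cip n v (($) \<phi>)))\<^sup>2)"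
      by (simp only: complex_norm_square[symmetric] of_real_mult of_real_power)
    finally have eq: "cip n (mv n (ent ?K) v) v = of_real (c * (cmod (cip n v (($) \<phi>)))\<^sup>2)" .
    show ?thesis unfolding eq complex_of_real_nonneg_iff using c by simp
  qed
  then show "positive_semidefinite n ?K" using K by (simp add: positive_semidefinite_iff psd_def)
  show "?K * ?K = of_real (c * c) \<cdot>\<^sub>m ket_bra \<phi>"
  proof (rule eq_matI)
    fix i j assume "i < dim_row (of_real (c * c) \<cdot>\<^sub>m ket_bra \<phi>)" "j < dim_col (of_real (c * c) \<cdot>\<^sub>m ket_bra \<phi>)"
    then have ij: "i < n" "j < n" by (auto simp: ket_bra_def dim)
    have "(?K * ?K) $$ (i, j) = (\<Sum>k<n. of_real (c * c) * (\<phi> $ i * cnj (\<phi> $ j)) * (\<phi> $ k * cnj (\<phi> $ k)))"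
      unfolding mult_ent[OF K K ij] using K_ent ij by (intro sum.cong) (auto simp: ac_simps)
    also have "\<dots> = of_real (c * c) * (\<phi> $ i * cnj (\<phi> $ j))"
      by (simp only: norm mult_1_right flip: sum_distrib_left)
    finally show "(?K * ?K) $$ (i, j) = (of_real (c * c) \<cdot>\<^sub>m ket_bra \<phi>) $$ (i, j)"
      using ij by (simp add: ket_bra_def dim)
  qed (auto simp: ket_bra_def dim)
  have "mat_trace ?K = (\<Sum>i<n. of_real c * (\<phi> $ i * cnj (\<phi> $ i)))"
    unfolding mat_trace_def using K K_ent by auto
  then show "mat_trace ?K = of_real c" by (simp only: norm mult_1_right flip: sum_distrib_left)
qed

text \<open>With \<open>R\<close> the root of \<rho> and \<open>X = R * ket_bra \<phi>\<close>, the
  adjoint of \<open>X\<close> times \<open>X\<close> is \<open>c\<close> times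
  \<open>ket_bra \<phi>\<close>, where \<open>c\<close> is the squared norm of
  \<open>R \<phi>\<close>. Its root has trace \<open>sqrt c\<close>, and moving one \<open>R\<close>
  across the inner product identifies \<open>c\<close> with the expectation of \<rho>.\<close>

lemma fidelity_pure:
  assumes \<rho>: "positive_semidefinite n \<rho>" and \<phi>: "pure_state n \<phi>"
  shows "fidelity \<rho> (ket_bra \<phi>) = sqrt (Re (cip n (mv n (ent \<rho>) (($) \<phi>)) (($) \<phi>)))"
proof -
  have dim: "dim_vec \<phi> = n" using \<phi> by (simp add: pure_state_def)
  have one: "of_real 1 \<cdot>\<^sub>m ket_bra \<phi> = ket_bra \<phi>" by (intro eq_matI) auto
  have \<sigma>: "mat_sqrt (ket_bra \<phi>) = ket_bra \<phi>"
    using mat_sqrt_eqI[OF scaled_ket_bra(1)[OF \<phi>, of 1] scaled_ket_bra(2)[OF \<phi>, of 1]]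
    unfolding mult_1_right one by simp
  define R where "R = mat_sqrt \<rho>"
  have Rp: "positive_semidefinite n R" and RR: "R * R = \<rho>"
    using mat_sqrt_works[OF \<rho>] by (simp_all add: R_def)
  then have R: "R \<in> carrier_mat n n" "psd n (ent R)" by (simp_all add: positive_semidefinite_iff)
  define c where "c = sqn n (mv n (ent R) (($) \<phi>))"
  have "of_real c = cip n (mv n (ent R) (($) \<phi>)) (mv n (ent R) (($) \<phi>))" by (simp add: c_def cip_self)
  also have "\<dots> = cip n (mv n (ent R) (mv n (ent R) (($) \<phi>))) (($) \<phi>)"
    by (rule cip_hermitian[OF psd_imp_hermitian[OF R(2)], symmetric])
  also have "\<dots> = cip n (mv n (ent \<rho>) (($) \<phi>)) (($) \<phi>)"
  proof (intro cip_cong refl)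
    fix i assume "i < n"
    then show "mv n (ent R) (mv n (ent R) (($) \<phi>)) i = mv n (ent \<rho>) (($) \<phi>) i"
      unfolding mv_mv unfolding mv_def RR[symmetric]
      using mult_ent[OF R(1) R(1)] by (intro sum.cong) auto
  qed
  finally have c: "c = Re (cip n (mv n (ent \<rho>) (($) \<phi>)) (($) \<phi>))" by (metis Re_complex_of_real)
  have c0: "0 \<le> c" by (simp add: c_def sqn_nonneg)
  define X where "X = R * ket_bra \<phi>"
  have K: "ket_bra \<phi> \<in> carrier_mat n n" by (auto simp: ket_bra_def dim)
  have X: "X \<in> carrier_mat n n" using R K by (simp add: X_def)
  have X_ent: "X $$ (k, i) = mv n (ent R) (($) \<phi>) k * cnj (\<phi> $ i)" if "k < n" "i < n" for k i
    unfolding X_def mult_ent[OF R(1) K that] mv_def using that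
    by (simp add: sum_distrib_left sum_distrib_right ket_bra_def dim ac_simps)
  have "mat_adjoint X * X = of_real c \<cdot>\<^sub>m ket_bra \<phi>"
  proof (rule eq_matI)
    fix i j assume "i < dim_row (of_real c \<cdot>\<^sub>m ket_bra \<phi>)" "j < dim_col (of_real c \<cdot>\<^sub>m ket_bra \<phi>)"
    then have ij: "i < n" "j < n" by (auto simp: ket_bra_def dim)
    have "(mat_adjoint X * X) $$ (i, j) = (\<Sum>k<n. \<phi> $ i * cnj (\<phi> $ j) *
        (mv n (ent R) (($) \<phi>) k * cnj (mv n (ent R) (($) \<phi>) k)))"
      unfolding mult_ent[OF mat_adjoint_carrier[OF X] X ij]
      using ij X by (intro sum.cong) (auto simp: index_mat_adjoint X_ent ac_simps)
    also have "\<dots> = \<phi> $ i * cnj (\<phi> $ j) * of_real c"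
      unfolding c_def cip_self[symmetric] by (simp only: cip_def sum_distrib_left)
    finally show "(mat_adjoint X * X) $$ (i, j) = (of_real c \<cdot>\<^sub>m ket_bra \<phi>) $$ (i, j)"
      using ij by (simp add: ket_bra_def dim)
  qed (use X in \<open>auto simp: ket_bra_def dim mat_adjoint_def\<close>)
  then have "mat_abs X = of_real (sqrt c) \<cdot>\<^sub>m ket_bra \<phi>"
    unfolding mat_abs_def using c0 scaled_ket_bra(1,2)[OF \<phi>, of "sqrt c"]
    by (intro mat_sqrt_eqI) auto
  then have "fidelity \<rho> (ket_bra \<phi>) = sqrt c"
    unfolding fidelity_def \<sigma> R_def[symmetric] X_def[symmetric]
    using scaled_ket_bra(3)[OF \<phi>, of "sqrt c"] c0 by simp
  then show ?thesis by (simp add: c)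
qed

section \<open>Local measurements\<close>

definition coef :: "nat \<Rightarrow> complex vec \<Rightarrow> nat \<Rightarrow> nat \<Rightarrow> complex" where
  "coef dB v i j = v $ (i * dB + j)"

section \<open>Coefficient matrices of vectors in a tensor product\<close>

lemma pair_index_less: "i < m \<Longrightarrow> j < n \<Longrightarrow> i * n + j < m * (n :: nat)"
proof -
  assume "i < m" "j < n"
  then have "i * n + j < Suc i * n" by simp
  also have "\<dots> \<le> m * n" using \<open>i < m\<close> by (intro mult_le_mono1) simp
  finally show ?thesis .
qed

lemma sum_pair_index: "(\<Sum>x<m * n. f x) = (\<Sum>i<m. \<Sum>j<n. f (i * n + j :: nat))"
proof -
  have "sum f {i * n..<i * n + n} = (\<Sum>j<n. f (i * n + j))" for i
    by (simp add: sum.atLeastLessThan_shift_0 atLeast0LessThan)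
  then show ?thesis by (simp flip: sum.nat_group)
qed

lemma sqn_coef: "sqn (m * n) (($) v) = (\<Sum>i<m. sqn n (coef n v i))"
  unfolding sqn_def coef_def by (rule sum_pair_index)

lemma sqn_coef': "sqn (m * n) (($) v) = (\<Sum>j<n. sqn m (\<lambda>i. coef n v i j))"
  unfolding sqn_coef unfolding sqn_def by (rule sum.swap)

lemma cip_coef: "cip (m * n) (($) v) (($) w) = (\<Sum>i<m. cip n (coef n v i) (coef n w i))"
  unfolding cip_def coef_def by (rule sum_pair_index)

lemma index_mult_vec:
  assumes "A \<in> carrier_mat n m" "v \<in> carrier_vec m" "i < n"
  shows "(A *\<^sub>v v) $ i = (\<Sum>j<m. A $$ (i, j) * v $ j)"
  using assms by (auto simp: scalar_prod_def atLeast0LessThan intro!: sum.cong)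

lemma tensor_mat_carrier:
  "A \<in> carrier_mat a b \<Longrightarrow> B \<in> carrier_mat c d \<Longrightarrow> tensor_mat A B \<in> carrier_mat (a * c) (b * d)"
  by (auto simp: tensor_mat_def)

lemma coef_tensor_mat:
  assumes A: "A \<in> carrier_mat a b" and B: "B \<in> carrier_mat c d" and v: "v \<in> carrier_vec (b * d)"
    and ij: "i < a" "j < c"
  shows "coef c (tensor_mat A B *\<^sub>v v) i j = (\<Sum>x<b. \<Sum>y<d. A $$ (i, x) * B $$ (j, y) * coef d v x y)"
proof -
  have "coef c (tensor_mat A B *\<^sub>v v) i j =
      (\<Sum>x<b. \<Sum>y<d. tensor_mat A B $$ (i * c + j, x * d + y) * v $ (x * d + y))"
    using pair_index_less[OF ij]
    by (simp add: coef_def index_mult_vec[OF tensor_mat_carrier[OF A B] v] sum_pair_index)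
  also have "\<dots> = (\<Sum>x<b. \<Sum>y<d. A $$ (i, x) * B $$ (j, y) * coef d v x y)"
    using A B ij by (intro sum.cong refl) (auto simp: tensor_mat_def coef_def pair_index_less)
  finally show ?thesis .
qed

text \<open>An operator of the first party acts on each column of the coefficient matrix, one of the
  second party on each row; this reduces local measurements to \<open>mv\<close>.\<close>

lemma coef_tensor_fst:
  assumes K: "K \<in> carrier_mat d dA" and v: "v \<in> carrier_vec (dA * dB)" and ij: "i < d" "j < dB"
  shows "coef dB (tensor_mat K (1\<^sub>m dB) *\<^sub>v v) i j = (\<Sum>x<dA. K $$ (i, x) * coef dB v x j)"
proof -
  have "coef dB (tensor_mat K (1\<^sub>m dB) *\<^sub>v v) i j =
      (\<Sum>x<dA. \<Sum>y<dB. if y = j then K $$ (i, x) * coef dB v x y else 0)"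
    unfolding coef_tensor_mat[OF K one_carrier_mat v ij] using ij by (intro sum.cong) auto
  then show ?thesis using ij by simp
qed

lemma coef_tensor_snd:
  assumes K: "K \<in> carrier_mat d dB" and v: "v \<in> carrier_vec (dA * dB)" and ij: "i < dA" "j < d"
  shows "coef d (tensor_mat (1\<^sub>m dA) K *\<^sub>v v) i j = (\<Sum>y<dB. K $$ (j, y) * coef dB v i y)"
proof -
  have "coef d (tensor_mat (1\<^sub>m dA) K *\<^sub>v v) i j =
      (\<Sum>x<dA. if x = i then (\<Sum>y<dB. K $$ (j, y) * coef dB v x y) else 0)"
    unfolding coef_tensor_mat[OF one_carrier_mat K v ij] using ij by (intro sum.cong) auto
  then show ?thesis using ij by simp
qed

text \<open>Stacked on top of each other, the Kraus operators form an isometry; completeness is this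
  fact read through adjoints. The lemma is applied to rows, to columns and to partial inner products
  of a coefficient matrix.\<close>

lemma kraus_isometric:
  assumes K: "\<forall>k<m. K k \<in> carrier_mat (d k) n"
    and complete: "mat_sum n (\<lambda>k. mat_adjoint (K k) * K k) m = 1\<^sub>m n"
  shows "(\<Sum>k<m. sqn (d k) (mv n (ent (K k)) v)) = sqn n v"
proof -
  have *: "(\<Sum>k<m. \<Sum>r<d k. cnj (K k $$ (r, i)) * K k $$ (r, j)) = (if i = j then 1 else 0)"
    if ij: "i < n" "j < n" for i j
  proof -
    have "(mat_adjoint (K k) * K k) $$ (i, j) = (\<Sum>r<d k. cnj (K k $$ (r, i)) * K k $$ (r, j))"
      if "k < m" for k
    proof -
      have Kk: "K k \<in> carrier_mat (d k) n" using K that by blast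
      show ?thesis
        unfolding mult_ent[OF mat_adjoint_carrier[OF Kk] Kk ij]
        using Kk ij by (intro sum.cong) (auto simp: index_mat_adjoint)
    qed
    then have "(\<Sum>k<m. \<Sum>r<d k. cnj (K k $$ (r, i)) * K k $$ (r, j)) =
        mat_sum n (\<lambda>k. mat_adjoint (K k) * K k) m $$ (i, j)"
      using ij by (simp add: mat_sum_def)
    then show ?thesis using ij by (simp add: complete)
  qed
  have adj: "mv (d k) (\<lambda>i j. cnj (ent (K k) j i)) (mv n (ent (K k)) v) i =
      (\<Sum>j<n. (\<Sum>r<d k. cnj (K k $$ (r, i)) * K k $$ (r, j)) * v j)" for k i
  proof -
    have "mv (d k) (\<lambda>i j. cnj (ent (K k) j i)) (mv n (ent (K k)) v) i =
        (\<Sum>r<d k. \<Sum>j<n. cnj (K k $$ (r, i)) * K k $$ (r, j) * v j)"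
      by (simp add: mv_def sum_distrib_left mult.assoc)
    also have "\<dots> = (\<Sum>j<n. \<Sum>r<d k. cnj (K k $$ (r, i)) * K k $$ (r, j) * v j)" by (rule sum.swap)
    finally show ?thesis by (simp add: sum_distrib_right)
  qed
  have "of_real (\<Sum>k<m. sqn (d k) (mv n (ent (K k)) v)) =
      (\<Sum>k<m. cip n v (mv (d k) (\<lambda>i j. cnj (ent (K k) j i)) (mv n (ent (K k)) v)))"
    by (simp add: cip_self[symmetric] cip_mv_adjoint)
  also have "\<dots> = cip n v (\<lambda>i. \<Sum>k<m. 1 * mv (d k) (\<lambda>i j. cnj (ent (K k) j i)) (mv n (ent (K k)) v) i)"
    unfolding cip_sum_right by simp
  also have "\<dots> = cip n v v"
  proof (intro cip_cong refl)
    fix i assume i: "i < n"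
    have "(\<Sum>k<m. mv (d k) (\<lambda>i j. cnj (ent (K k) j i)) (mv n (ent (K k)) v) i) =
        (\<Sum>j<n. (\<Sum>k<m. \<Sum>r<d k. cnj (K k $$ (r, i)) * K k $$ (r, j)) * v j)"
      unfolding adj by (subst sum.swap) (simp add: sum_distrib_right)
    also have "\<dots> = (\<Sum>j<n. if j = i then v j else 0)"
      using * i by (intro sum.cong) auto
    finally show "(\<Sum>k<m. 1 * mv (d k) (\<lambda>i j. cnj (ent (K k) j i)) (mv n (ent (K k)) v) i) = v i"
      using i by simp
  qed
  finally show ?thesis by (simp only: cip_self of_real_eq_iff)
qed

text \<open>
  A measurement of the second party does not touch the projector of the first party that attains
  the Ky Fan norm of the initial state.
\<close>

lemma ky_fan_measurement:
  assumes S: "schmidt dA dB M r s a b"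
    and iso: "\<And>v. (\<Sum>k<m. sqn (d k) (mv dB (K k) v)) = sqn dB v"
    and S': "\<And>k. k < m \<Longrightarrow> schmidt dA (d k) (\<lambda>i. mv dB (K k) (M i)) (r' k) (s' k) (a' k) (b' k)"
  shows "(\<Sum>i<l. s i) \<le> (\<Sum>k<m. \<Sum>i<l. s' k i)"
proof -
  have w: "(\<lambda>j. cip dA (\<lambda>i. mv dB (K k) (M i) j) e) = mv dB (K k) (\<lambda>j. cip dA (\<lambda>i. M i j) e)" for k e
    by (simp add: mv_def cip_sum_left)
  have "(\<Sum>i<l. s i) = (\<Sum>y<min l r. \<Sum>k<m. sqn (d k) (\<lambda>j. cip dA (\<lambda>i. mv dB (K k) (M i) j) (a y)))"
    unfolding w iso by (rule ky_fan_attained[OF S, symmetric])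
  also have "\<dots> = (\<Sum>k<m. \<Sum>y<min l r. sqn (d k) (\<lambda>j. cip dA (\<lambda>i. mv dB (K k) (M i) j) (a y)))"
    by (rule sum.swap)
  also have "\<dots> \<le> (\<Sum>k<m. \<Sum>i<l. s' k i)"
    using ons_mono[OF schmidtD(4)[OF S], of "{..<min l r}"]
    by (intro sum_mono ky_fan_le[OF S']) auto
  finally show ?thesis .
qed

text \<open>A choice among Schmidt decompositions, with no appeal to uniqueness. The bound
  \<open>r \<le> dA\<close> belongs to the choice because it makes the coefficients vanish from
  \<open>dA\<close> on.\<close>

definition schmidt_coeffs :: "nat \<Rightarrow> nat \<Rightarrow> (nat \<Rightarrow> nat \<Rightarrow> complex) \<Rightarrow> nat \<Rightarrow> real" where
  "schmidt_coeffs dA dB M = (SOME s. \<exists>r a b. r \<le> dA \<and> schmidt dA dB M r s a b)"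

lemma schmidt_coeffs:
  obtains r a b where "r \<le> dA" "schmidt dA dB M r (schmidt_coeffs dA dB M) a b"
proof -
  have "\<exists>s r a b. r \<le> dA \<and> schmidt dA dB M r s a b" using schmidt_exists[of dA dB M] by blast
  from someI_ex[OF this] show ?thesis using that unfolding schmidt_coeffs_def by blast
qed

lemma schmidt_cong:
  "(\<And>i j. i < dA \<Longrightarrow> j < dB \<Longrightarrow> M i j = M' i j) \<Longrightarrow> schmidt dA dB M r s a b = schmidt dA dB M' r s a b"
  unfolding schmidt_def by auto

abbreviation vcoeffs :: "nat \<Rightarrow> nat \<Rightarrow> complex vec \<Rightarrow> nat \<Rightarrow> real" where
  "vcoeffs dA dB v \<equiv> schmidt_coeffs dA dB (coef dB v)"

lemma ky_fan_tensor_snd: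
  assumes K: "\<forall>k<m. K k \<in> carrier_mat (d k) dB"
    and complete: "mat_sum dB (\<lambda>k. mat_adjoint (K k) * K k) m = 1\<^sub>m dB"
    and v: "v \<in> carrier_vec (dA * dB)"
  shows "(\<Sum>i<l. vcoeffs dA dB v i) \<le> (\<Sum>k<m. \<Sum>i<l. vcoeffs dA (d k) (tensor_mat (1\<^sub>m dA) (K k) *\<^sub>v v) i)"
proof -
  obtain r a b where S: "schmidt dA dB (coef dB v) r (vcoeffs dA dB v) a b"
    by (rule schmidt_coeffs)
  have "\<exists>r a b. schmidt dA (d k) (\<lambda>i. mv dB (ent (K k)) (coef dB v i)) r
      (vcoeffs dA (d k) (tensor_mat (1\<^sub>m dA) (K k) *\<^sub>v v)) a b" if k: "k < m" for k
  proof -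
    have Kk: "K k \<in> carrier_mat (d k) dB" using K k by blast
    obtain r a b where "schmidt dA (d k) (coef (d k) (tensor_mat (1\<^sub>m dA) (K k) *\<^sub>v v)) r
        (vcoeffs dA (d k) (tensor_mat (1\<^sub>m dA) (K k) *\<^sub>v v)) a b" by (rule schmidt_coeffs)
    then have "schmidt dA (d k) (\<lambda>i. mv dB (ent (K k)) (coef dB v i)) r
        (vcoeffs dA (d k) (tensor_mat (1\<^sub>m dA) (K k) *\<^sub>v v)) a b"
      by (subst (asm) schmidt_cong) (auto simp: coef_tensor_snd[OF Kk v] mv_def)
    then show ?thesis by blast
  qed
  then obtain r' a' b' where "\<And>k. k < m \<Longrightarrow> schmidt dA (d k) (\<lambda>i. mv dB (ent (K k)) (coef dB v i)) (r' k)
      (vcoeffs dA (d k) (tensor_mat (1\<^sub>m dA) (K k) *\<^sub>v v)) (a' k) (b' k)" by metis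
  then show ?thesis
    by (rule ky_fan_measurement[OF S kraus_isometric[OF K complete]])
qed

text \<open>Schmidt decompositions are symmetric in the parties, so the argument for the second
  party applies to the transposed coefficient matrices.\<close>

lemma ky_fan_tensor_fst:
  assumes K: "\<forall>k<m. K k \<in> carrier_mat (d k) dA"
    and complete: "mat_sum dA (\<lambda>k. mat_adjoint (K k) * K k) m = 1\<^sub>m dA"
    and v: "v \<in> carrier_vec (dA * dB)"
  shows "(\<Sum>i<l. vcoeffs dA dB v i) \<le> (\<Sum>k<m. \<Sum>i<l. vcoeffs (d k) dB (tensor_mat (K k) (1\<^sub>m dB) *\<^sub>v v) i)"
proof -
  obtain r a b where "schmidt dA dB (coef dB v) r (vcoeffs dA dB v) a b"
    by (rule schmidt_coeffs)
  then have S: "schmidt dB dA (\<lambda>j i. coef dB v i j) r (vcoeffs dA dB v) b a"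
    by (rule schmidt_transpose)
  have "\<exists>r a b. schmidt dB (d k) (\<lambda>j. mv dA (ent (K k)) (\<lambda>i. coef dB v i j)) r
      (vcoeffs (d k) dB (tensor_mat (K k) (1\<^sub>m dB) *\<^sub>v v)) a b" if k: "k < m" for k
  proof -
    have Kk: "K k \<in> carrier_mat (d k) dA" using K k by blast
    obtain r a b where "schmidt (d k) dB (coef dB (tensor_mat (K k) (1\<^sub>m dB) *\<^sub>v v)) r
        (vcoeffs (d k) dB (tensor_mat (K k) (1\<^sub>m dB) *\<^sub>v v)) a b" by (rule schmidt_coeffs)
    from schmidt_transpose[OF this]
    have "schmidt dB (d k) (\<lambda>j. mv dA (ent (K k)) (\<lambda>i. coef dB v i j)) r
        (vcoeffs (d k) dB (tensor_mat (K k) (1\<^sub>m dB) *\<^sub>v v)) b a"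
      by (subst (asm) schmidt_cong) (auto simp: coef_tensor_fst[OF Kk v] mv_def)
    then show ?thesis by blast
  qed
  then obtain r' a' b' where "\<And>k. k < m \<Longrightarrow> schmidt dB (d k) (\<lambda>j. mv dA (ent (K k)) (\<lambda>i. coef dB v i j)) (r' k)
      (vcoeffs (d k) dB (tensor_mat (K k) (1\<^sub>m dB) *\<^sub>v v)) (a' k) (b' k)" by metis
  then show ?thesis
    by (rule ky_fan_measurement[OF S kraus_isometric[OF K complete]])
qed

lemma sqn_tensor_snd:
  assumes K: "\<forall>k<m. K k \<in> carrier_mat (d k) dB"
    and complete: "mat_sum dB (\<lambda>k. mat_adjoint (K k) * K k) m = 1\<^sub>m dB"
    and v: "v \<in> carrier_vec (dA * dB)"
  shows "(\<Sum>k<m. sqn (dA * d k) (($) (tensor_mat (1\<^sub>m dA) (K k) *\<^sub>v v))) = sqn (dA * dB) (($) v)"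
proof -
  have "sqn (dA * d k) (($) (tensor_mat (1\<^sub>m dA) (K k) *\<^sub>v v)) =
      (\<Sum>i<dA. sqn (d k) (mv dB (ent (K k)) (coef dB v i)))" if "k < m" for k
    unfolding sqn_coef unfolding sqn_def
    using K that v by (intro sum.cong refl) (auto simp: coef_tensor_snd mv_def)
  then have "(\<Sum>k<m. sqn (dA * d k) (($) (tensor_mat (1\<^sub>m dA) (K k) *\<^sub>v v))) =
      (\<Sum>k<m. \<Sum>i<dA. sqn (d k) (mv dB (ent (K k)) (coef dB v i)))" by simp
  also have "\<dots> = (\<Sum>i<dA. sqn dB (coef dB v i))"
    by (subst sum.swap) (simp only: kraus_isometric[OF K complete])
  finally show ?thesis by (simp only: sqn_coef)
qed

lemma sqn_tensor_fst:
  assumes K: "\<forall>k<m. K k \<in> carrier_mat (d k) dA"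
    and complete: "mat_sum dA (\<lambda>k. mat_adjoint (K k) * K k) m = 1\<^sub>m dA"
    and v: "v \<in> carrier_vec (dA * dB)"
  shows "(\<Sum>k<m. sqn (d k * dB) (($) (tensor_mat (K k) (1\<^sub>m dB) *\<^sub>v v))) = sqn (dA * dB) (($) v)"
proof -
  have "sqn (d k * dB) (($) (tensor_mat (K k) (1\<^sub>m dB) *\<^sub>v v)) =
      (\<Sum>j<dB. sqn (d k) (mv dA (ent (K k)) (\<lambda>i. coef dB v i j)))" if "k < m" for k
    unfolding sqn_coef' unfolding sqn_def
    using K that v by (intro sum.cong refl) (auto simp: coef_tensor_fst mv_def)
  then have "(\<Sum>k<m. sqn (d k * dB) (($) (tensor_mat (K k) (1\<^sub>m dB) *\<^sub>v v))) =
      (\<Sum>k<m. \<Sum>j<dB. sqn (d k) (mv dA (ent (K k)) (\<lambda>i. coef dB v i j)))" by simp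
  also have "\<dots> = (\<Sum>j<dB. sqn dA (\<lambda>i. coef dB v i j))"
    by (subst sum.swap) (simp only: kraus_isometric[OF K complete])
  finally show ?thesis by (simp only: sqn_coef')
qed

section \<open>Conjugation by Kraus operators\<close>

lemma mat_adjoint_mult:
  fixes A B :: "complex mat"
  assumes A: "A \<in> carrier_mat n m" and B: "B \<in> carrier_mat m k"
  shows "mat_adjoint (A * B) = mat_adjoint B * mat_adjoint A"
proof (rule eq_matI)
  note AB = mult_carrier_mat[OF A B]
  fix i j assume "i < dim_row (mat_adjoint B * mat_adjoint A)" "j < dim_col (mat_adjoint B * mat_adjoint A)"
  then have ij: "i < k" "j < n"
    using mult_carrier_mat[OF mat_adjoint_carrier[OF B] mat_adjoint_carrier[OF A]] by auto
  have "mat_adjoint (A * B) $$ (i, j) = cnj ((A * B) $$ (j, i))"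
    using AB ij by (intro index_mat_adjoint) auto
  also have "\<dots> = (\<Sum>r<m. mat_adjoint B $$ (i, r) * mat_adjoint A $$ (r, j))"
    unfolding mult_ent[OF A B ij(2,1)] using A B ij
    by (auto simp: index_mat_adjoint mult.commute intro!: sum.cong)
  finally show "mat_adjoint (A * B) $$ (i, j) = (mat_adjoint B * mat_adjoint A) $$ (i, j)"
    by (simp only: mult_ent[OF mat_adjoint_carrier[OF B] mat_adjoint_carrier[OF A] ij])
qed (use A B in \<open>auto simp: mat_adjoint_def\<close>)

lemma kraus_apply_carrier: "K \<in> carrier_mat m n \<Longrightarrow> \<rho> \<in> carrier_mat n n \<Longrightarrow> kraus_apply K \<rho> \<in> carrier_mat m m"
  unfolding kraus_apply_def by (intro mult_carrier_mat mat_adjoint_carrier)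

lemma kraus_apply_mult:
  assumes A: "A \<in> carrier_mat k m" and B: "B \<in> carrier_mat m n" and \<rho>: "\<rho> \<in> carrier_mat n n"
  shows "kraus_apply (A * B) \<rho> = kraus_apply A (kraus_apply B \<rho>)"
proof -
  note A' = mat_adjoint_carrier[OF A] and B' = mat_adjoint_carrier[OF B]
  have "A * B * \<rho> * (mat_adjoint B * mat_adjoint A) = A * B * \<rho> * mat_adjoint B * mat_adjoint A"
    by (rule assoc_mult_mat[OF mult_carrier_mat[OF mult_carrier_mat[OF A B] \<rho>] B' A', symmetric])
  also have "A * B * \<rho> * mat_adjoint B = A * (B * \<rho> * mat_adjoint B)"
    by (simp only: assoc_mult_mat[OF A B \<rho>] assoc_mult_mat[OF A mult_carrier_mat[OF B \<rho>] B'])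
  finally show ?thesis unfolding kraus_apply_def mat_adjoint_mult[OF A B] .
qed

lemma index_kraus_apply:
  assumes K: "K \<in> carrier_mat m n" and \<rho>: "\<rho> \<in> carrier_mat n n" and ij: "i < m" "j < m"
  shows "kraus_apply K \<rho> $$ (i, j) = (\<Sum>y<n. \<Sum>x<n. K $$ (i, x) * \<rho> $$ (x, y) * cnj (K $$ (j, y)))"
proof -
  have "kraus_apply K \<rho> $$ (i, j) = (\<Sum>y<n. (K * \<rho>) $$ (i, y) * mat_adjoint K $$ (y, j))"
    unfolding kraus_apply_def using ij
    by (intro mult_ent[OF mult_carrier_mat[OF K \<rho>] mat_adjoint_carrier[OF K]])
  also have "\<dots> = (\<Sum>y<n. (\<Sum>x<n. K $$ (i, x) * \<rho> $$ (x, y)) * cnj (K $$ (j, y)))"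
    using K ij by (intro sum.cong refl) (auto simp: mult_ent[OF K \<rho>] index_mat_adjoint)
  finally show ?thesis by (simp add: sum_distrib_right)
qed

lemma index_ket_bra: "i < dim_vec v \<Longrightarrow> j < dim_vec v \<Longrightarrow> ket_bra v $$ (i, j) = v $ i * cnj (v $ j)"
  by (simp add: ket_bra_def)

lemma kraus_apply_ket_bra:
  assumes K: "K \<in> carrier_mat m n" and v: "v \<in> carrier_vec n"
  shows "kraus_apply K (ket_bra v) = ket_bra (K *\<^sub>v v)"
proof (rule eq_matI)
  have kb: "ket_bra v \<in> carrier_mat n n" using v by (auto simp: ket_bra_def)
  fix i j assume "i < dim_row (ket_bra (K *\<^sub>v v))" "j < dim_col (ket_bra (K *\<^sub>v v))"
  then have ij: "i < m" "j < m" using K by (auto simp: ket_bra_def)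
  have "kraus_apply K (ket_bra v) $$ (i, j) = (\<Sum>y<n. \<Sum>x<n. (K $$ (i, x) * v $ x) * cnj (K $$ (j, y) * v $ y))"
    unfolding index_kraus_apply[OF K kb ij] using v
    by (intro sum.cong refl) (auto simp: ket_bra_def)
  also have "\<dots> = (\<Sum>x<n. K $$ (i, x) * v $ x) * cnj (\<Sum>y<n. K $$ (j, y) * v $ y)"
    unfolding cnj_sum sum_product by (rule sum.swap)
  finally show "kraus_apply K (ket_bra v) $$ (i, j) = ket_bra (K *\<^sub>v v) $$ (i, j)"
    using ij K by (subst index_ket_bra) (auto simp only: index_mult_vec[OF K v] dim_mult_mat_vec)
qed (use K kraus_apply_carrier[OF K, of "ket_bra v"] v in \<open>auto simp: ket_bra_def\<close>)

section \<open>Upper bound\<close>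

lemma sum_list_map_concat: "(\<Sum>x\<leftarrow>concat xss. f x) = (\<Sum>xs\<leftarrow>xss. \<Sum>x\<leftarrow>xs. f x)"
  by (induction xss) auto

lemma sum_list_map_upt: "(\<Sum>k\<leftarrow>[0..<m]. f k) = (\<Sum>k<m. f k)"
  by (simp add: interv_sum_list_conv_sum_set_nat atLeast0LessThan)

text \<open>Invariant for the induction over protocols. Besides the Kraus operators of the whole
  protocol it records that the total squared norm is kept and that prefix sums of Schmidt
  coefficients do not decrease, for every vector and not only for unit vectors, since a later round
  receives unnormalized branches. Lists are used because the Kraus operators of the branches are
  concatenated.\<close>

definition locc_kraus ::
  "nat \<Rightarrow> nat \<Rightarrow> nat \<Rightarrow> nat \<Rightarrow> (complex mat \<Rightarrow> complex mat) \<Rightarrow> complex mat list \<Rightarrow> bool" where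
  "locc_kraus dA dB dA' dB' \<Gamma> Ls \<longleftrightarrow>
     set Ls \<subseteq> carrier_mat (dA' * dB') (dA * dB) \<and>
     (\<forall>\<rho>\<in>carrier_mat (dA * dB) (dA * dB). \<Gamma> \<rho> \<in> carrier_mat (dA' * dB') (dA' * dB') \<and>
        (\<forall>i<dA' * dB'. \<forall>j<dA' * dB'. \<Gamma> \<rho> $$ (i, j) = (\<Sum>L\<leftarrow>Ls. kraus_apply L \<rho> $$ (i, j)))) \<and>
     (\<forall>v\<in>carrier_vec (dA * dB).
        (\<Sum>L\<leftarrow>Ls. sqn (dA' * dB') (($) (L *\<^sub>v v))) = sqn (dA * dB) (($) v) \<and>
        (\<forall>l. (\<Sum>i<l. vcoeffs dA dB v i) \<le> (\<Sum>L\<leftarrow>Ls. \<Sum>i<l. vcoeffs dA' dB' (L *\<^sub>v v) i)))"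

lemma locc_kraus_id: "locc_kraus dA dB dA dB (\<lambda>\<rho>. \<rho>) [1\<^sub>m (dA * dB)]"
proof -
  let ?n = "dA * dB"
  have "mat_adjoint (1\<^sub>m ?n) = (1\<^sub>m ?n :: complex mat)"
    using mat_adjoint_carrier[OF one_carrier_mat[of ?n]]
    by (intro eq_matI) (auto simp: index_mat_adjoint)
  then have "kraus_apply (1\<^sub>m ?n) \<rho> = \<rho>" if "\<rho> \<in> carrier_mat ?n ?n" for \<rho>
    using that by (simp add: kraus_apply_def)
  then show ?thesis by (auto simp: locc_kraus_def)
qed

text \<open>One round in a form common to both parties: \<open>T k\<close> is the local operator
  tensored with an identity, and \<open>e k\<close>, \<open>f k\<close> are the dimensions after
  outcome \<open>k\<close>. Kraus operators of the continuation are composed with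
  \<open>T k\<close>, and both estimates chain.\<close>

lemma locc_kraus_round:
  assumes T: "\<And>k. k < m \<Longrightarrow> T k \<in> carrier_mat (e k * f k) (dA * dB)"
    and norm: "\<And>v. v \<in> carrier_vec (dA * dB) \<Longrightarrow>
       (\<Sum>k<m. sqn (e k * f k) (($) (T k *\<^sub>v v))) = sqn (dA * dB) (($) v)"
    and ky_fan: "\<And>v l. v \<in> carrier_vec (dA * dB) \<Longrightarrow>
       (\<Sum>i<l. vcoeffs dA dB v i) \<le> (\<Sum>k<m. \<Sum>i<l. vcoeffs (e k) (f k) (T k *\<^sub>v v) i)"
    and rest: "\<And>k. k < m \<Longrightarrow> locc_kraus (e k) (f k) dA' dB' (\<Gamma> k) (Ls k)"
  shows "locc_kraus dA dB dA' dB' (\<lambda>\<rho>. mat_sum (dA' * dB') (\<lambda>k. \<Gamma> k (kraus_apply (T k) \<rho>)) m)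
     (concat (map (\<lambda>k. map (\<lambda>L. L * T k) (Ls k)) [0..<m]))"
proof -
  let ?n = "dA * dB" and ?n' = "dA' * dB'"
  let ?Ls = "concat (map (\<lambda>k. map (\<lambda>L. L * T k) (Ls k)) [0..<m])"
  have Ls: "L \<in> carrier_mat ?n' (e k * f k)" if "k < m" "L \<in> set (Ls k)" for k L
    using rest[OF that(1)] that(2) by (auto simp: locc_kraus_def)
  have sum: "(\<Sum>L\<leftarrow>?Ls. F L) = (\<Sum>k<m. \<Sum>L\<leftarrow>Ls k. F (L * T k))" for F :: "complex mat \<Rightarrow> 'b :: comm_monoid_add"
    by (simp add: sum_list_map_concat comp_def sum_list_map_upt)
  have "set ?Ls \<subseteq> carrier_mat ?n' ?n"
    using T Ls by (fastforce intro: mult_carrier_mat)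
  moreover have "mat_sum ?n' (\<lambda>k. \<Gamma> k (kraus_apply (T k) \<rho>)) m $$ (i, j) =
      (\<Sum>L\<leftarrow>?Ls. kraus_apply L \<rho> $$ (i, j))"
    if \<rho>: "\<rho> \<in> carrier_mat ?n ?n" and ij: "i < ?n'" "j < ?n'" for \<rho> i j
  proof -
    have "\<Gamma> k (kraus_apply (T k) \<rho>) $$ (i, j) = (\<Sum>L\<leftarrow>Ls k. kraus_apply (L * T k) \<rho> $$ (i, j))"
      if k: "k < m" for k
    proof -
      have "\<Gamma> k (kraus_apply (T k) \<rho>) $$ (i, j) = (\<Sum>L\<leftarrow>Ls k. kraus_apply L (kraus_apply (T k) \<rho>) $$ (i, j))"
        using rest[OF k] kraus_apply_carrier[OF T[OF k] \<rho>] ij by (auto simp: locc_kraus_def)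
      also have "\<dots> = (\<Sum>L\<leftarrow>Ls k. kraus_apply (L * T k) \<rho> $$ (i, j))"
        using kraus_apply_mult[OF Ls[OF k] T[OF k] \<rho>] by (intro arg_cong[of _ _ sum_list] map_cong) auto
      finally show ?thesis .
    qed
    then show ?thesis unfolding sum using ij by (simp add: mat_sum_def)
  qed
  moreover have "(\<Sum>L\<leftarrow>?Ls. sqn ?n' (($) (L *\<^sub>v v))) = sqn ?n (($) v) \<and>
      (\<forall>l. (\<Sum>i<l. vcoeffs dA dB v i) \<le> (\<Sum>L\<leftarrow>?Ls. \<Sum>i<l. vcoeffs dA' dB' (L *\<^sub>v v) i))"
    if v: "v \<in> carrier_vec ?n" for v
  proof -
    have Tv: "T k *\<^sub>v v \<in> carrier_vec (e k * f k)" if "k < m" for k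
      using T[OF that] v by simp
    have assoc: "(\<Sum>L\<leftarrow>Ls k. F ((L * T k) *\<^sub>v v)) = (\<Sum>L\<leftarrow>Ls k. F (L *\<^sub>v (T k *\<^sub>v v)))"
      if "k < m" for k and F :: "complex vec \<Rightarrow> real"
      using assoc_mult_mat_vec[OF Ls[OF that] T[OF that] v]
      by (intro arg_cong[of _ _ sum_list] map_cong) auto
    have "(\<Sum>L\<leftarrow>?Ls. sqn ?n' (($) (L *\<^sub>v v))) = (\<Sum>k<m. \<Sum>L\<leftarrow>Ls k. sqn ?n' (($) (L *\<^sub>v (T k *\<^sub>v v))))"
      unfolding sum by (intro sum.cong refl assoc) simp
    also have "\<dots> = (\<Sum>k<m. sqn (e k * f k) (($) (T k *\<^sub>v v)))"
      using rest Tv by (intro sum.cong refl) (simp add: locc_kraus_def)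
    also have "\<dots> = sqn ?n (($) v)" by (rule norm[OF v])
    finally have 1: "(\<Sum>L\<leftarrow>?Ls. sqn ?n' (($) (L *\<^sub>v v))) = sqn ?n (($) v)" .
    have "(\<Sum>i<l. vcoeffs dA dB v i) \<le> (\<Sum>L\<leftarrow>?Ls. \<Sum>i<l. vcoeffs dA' dB' (L *\<^sub>v v) i)" for l
    proof -
      have "(\<Sum>i<l. vcoeffs dA dB v i) \<le> (\<Sum>k<m. \<Sum>i<l. vcoeffs (e k) (f k) (T k *\<^sub>v v) i)"
        by (rule ky_fan[OF v])
      also have "\<dots> \<le> (\<Sum>k<m. \<Sum>L\<leftarrow>Ls k. \<Sum>i<l. vcoeffs dA' dB' (L *\<^sub>v (T k *\<^sub>v v)) i)"
        using rest Tv by (intro sum_mono) (simp add: locc_kraus_def)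
      also have "\<dots> = (\<Sum>L\<leftarrow>?Ls. \<Sum>i<l. vcoeffs dA' dB' (L *\<^sub>v v) i)"
        unfolding sum by (intro sum.cong refl assoc[symmetric]) simp
      finally show ?thesis .
    qed
    with 1 show ?thesis by blast
  qed
  ultimately show ?thesis unfolding locc_kraus_def by (auto simp: mat_sum_def)
qed

lemma locc_imp_locc_kraus: "locc dA dB dA' dB' \<Gamma> \<Longrightarrow> \<exists>Ls. locc_kraus dA dB dA' dB' \<Gamma> Ls"
proof (induction rule: locc.induct)
  case (locc_stop dA dB)
  show ?case using locc_kraus_id by blast
next
  case (locc_fst m K d dA dB dA' dB' \<Gamma>)
  from locc_fst(3) obtain Ls where Ls: "\<And>k. k < m \<Longrightarrow> locc_kraus (d k) dB dA' dB' (\<Gamma> k) (Ls k)"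
    by metis
  note K = locc_fst(1,2)
  show ?case
    by (rule exI, rule locc_kraus_round[where e = d and f = "\<lambda>_. dB"])
      (use K sqn_tensor_fst[OF K] ky_fan_tensor_fst[OF K] Ls in \<open>auto intro!: tensor_mat_carrier\<close>)
next
  case (locc_snd m K d dB dA dA' dB' \<Gamma>)
  from locc_snd(3) obtain Ls where Ls: "\<And>k. k < m \<Longrightarrow> locc_kraus dA (d k) dA' dB' (\<Gamma> k) (Ls k)"
    by metis
  note K = locc_snd(1,2)
  show ?case
    by (rule exI, rule locc_kraus_round[where f = d and e = "\<lambda>_. dA"])
      (use K sqn_tensor_snd[OF K] ky_fan_tensor_snd[OF K] Ls in \<open>auto intro!: tensor_mat_carrier\<close>)
qed

lemma L2_set_sum_le: "L2_set (\<lambda>k. \<Sum>y<r. x k y) K \<le> (\<Sum>y<(r :: nat). L2_set (\<lambda>k. x k y) K)"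
proof (induction r)
  case 0
  then show ?case by (simp add: L2_set_def)
next
  case (Suc r)
  then show ?case using L2_set_triangle_ineq[of "\<lambda>k. \<Sum>y<r. x k y" "\<lambda>k. x k r" K] by simp
qed

lemma sqn_vcoeffs: "(\<Sum>i<dA. vcoeffs dA dB v i) = sqn (dA * dB) (($) v)"
proof -
  obtain r a b where r: "r \<le> dA" and S: "schmidt dA dB (coef dB v) r (vcoeffs dA dB v) a b"
    by (rule schmidt_coeffs)
  have "(\<Sum>i<dA. vcoeffs dA dB v i) = (\<Sum>i<r. vcoeffs dA dB v i)"
    using r schmidtD(3)[OF S] by (intro sum.mono_neutral_right) auto
  then show ?thesis by (simp add: sum_schmidt_coefficients[OF S, symmetric] sqn_coef)
qed

lemma vcoeffs_props:
  "antimono (vcoeffs dA dB v)" "0 \<le> vcoeffs dA dB v i" "dA \<le> i \<Longrightarrow> vcoeffs dA dB v i = 0"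
proof -
  obtain r a b where r: "r \<le> dA" and S: "schmidt dA dB (coef dB v) r (vcoeffs dA dB v) a b"
    by (rule schmidt_coeffs)
  show "antimono (vcoeffs dA dB v)" "0 \<le> vcoeffs dA dB v i" "dA \<le> i \<Longrightarrow> vcoeffs dA dB v i = 0"
    using schmidtD(1-3)[OF S] r by auto
qed

text \<open>Stands in for uniqueness of the coefficients: the first vectors of the given
  decomposition compete in Ky Fan's principle for the chosen one.\<close>

lemma schmidt_prefix_sum:
  assumes "schmidt dA dB (coef dB v) r s a b"
  shows "(\<Sum>i<l. s i) \<le> (\<Sum>i<l. vcoeffs dA dB v i)"
proof -
  obtain r' a' b' where S: "schmidt dA dB (coef dB v) r' (vcoeffs dA dB v) a' b'"
    by (rule schmidt_coeffs)
  have "(\<Sum>i<l. s i) = (\<Sum>y<min l r. sqn dB (\<lambda>j. cip dA (\<lambda>i. coef dB v i j) (a y)))"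
    by (rule ky_fan_attained[OF assms, symmetric])
  also have "\<dots> \<le> (\<Sum>i<l. vcoeffs dA dB v i)"
    using ons_mono[OF schmidtD(4)[OF assms], of "{..<min l r}"] by (intro ky_fan_le[OF S]) auto
  finally show ?thesis .
qed

text \<open>The members carry their probabilities as squared norms, so the expectation of \<rho> is
  the plain sum of squared overlaps; the same formula for an arbitrary vector shows
  positivity.\<close>

lemma fidelity_ensemble:
  assumes \<phi>: "pure_state n \<phi>" and ws: "set ws \<subseteq> carrier_vec n" and \<rho>: "\<rho> \<in> carrier_mat n n"
    and eq: "\<And>i j. i < n \<Longrightarrow> j < n \<Longrightarrow> \<rho> $$ (i, j) = (\<Sum>w\<leftarrow>ws. w $ i * cnj (w $ j))"
  shows "fidelity \<rho> (ket_bra \<phi>) = sqrt (\<Sum>w\<leftarrow>ws. (cmod (cip n (($) w) (($) \<phi>)))\<^sup>2)"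
proof -
  have *: "cip n (mv n (ent \<rho>) v) v = of_real (\<Sum>w\<leftarrow>ws. (cmod (cip n (($) w) v))\<^sup>2)" for v
  proof -
    have "mv n (ent \<rho>) v i = (\<Sum>w\<leftarrow>ws. cnj (cip n (($) w) v) * w $ i)" if "i < n" for i
    proof -
      have "mv n (ent \<rho>) v i = (\<Sum>j<n. \<Sum>w\<leftarrow>ws. w $ i * cnj (w $ j) * v j)"
        using eq that by (simp add: mv_def sum_list_mult_const)
      also have "\<dots> = (\<Sum>w\<leftarrow>ws. \<Sum>j<n. w $ i * cnj (w $ j) * v j)"
        by (induction ws) (auto simp: sum.distrib)
      also have "\<dots> = (\<Sum>w\<leftarrow>ws. cnj (cip n (($) w) v) * w $ i)"
        by (simp add: cip_def sum_distrib_left sum_distrib_right ac_simps)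
      finally show ?thesis .
    qed
    then have "cip n (mv n (ent \<rho>) v) v = cip n (\<lambda>i. \<Sum>w\<leftarrow>ws. cnj (cip n (($) w) v) * w $ i) v"
      by (intro cip_cong) auto
    also have "\<dots> = (\<Sum>w\<leftarrow>ws. cnj (cip n (($) w) v) * cip n (($) w) v)"
    proof -
      have "cip n (\<lambda>i. \<Sum>w\<leftarrow>us. c w * w $ i) v = (\<Sum>w\<leftarrow>us. c w * cip n (($) w) v)" for us c
      proof (induction us)
        case Nil
        then show ?case by (simp add: cip_def)
      next
        case (Cons w us)
        then show ?case by (simp add: cip_add_left cip_scale_left)
      qed
      then show ?thesis .
    qed
    also have "\<dots> = (\<Sum>w\<leftarrow>ws. of_real ((cmod (cip n (($) w) v))\<^sup>2))"
      by (intro arg_cong[of _ _ sum_list] map_cong refl) (metis complex_norm_square mult.commute of_real_power)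
    also have "\<dots> = of_real (\<Sum>w\<leftarrow>ws. (cmod (cip n (($) w) v))\<^sup>2)"
      by (induction ws) auto
    finally show ?thesis .
  qed
  have "psd n (ent \<rho>)"
    unfolding psd_def * complex_of_real_nonneg_iff by (auto intro!: sum_list_nonneg)
  then have "positive_semidefinite n \<rho>" using \<rho> by (simp add: positive_semidefinite_iff)
  from fidelity_pure[OF this \<phi>] show ?thesis unfolding * by simp
qed

text \<open>The branches \<open>us\<close> and \<open>ws\<close> after the two stages define
  \<open>p'\<close> and \<open>p''\<close> by adding up their coefficients position by position.
  Sums of decreasing sequences decrease, so \<open>p'\<close> and \<open>p''\<close> are sorted
  distributions although no single branch need have them; the middle dimension \<open>n\<close>
  bounds the support of \<open>p'\<close>.\<close>

theorem locc_fidelity_bound: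
  assumes \<psi>: "pure_state (dA * dB) \<psi>" and \<phi>: "pure_state (dA' * dB') \<phi>"
    and S\<psi>: "schmidt dA dB (coef dB \<psi>) r p a b"
    and S\<phi>: "schmidt dA' dB' (coef dB' \<phi>) r' q c d"
    and \<Gamma>: "locc dA dB n n \<Gamma>" and \<Gamma>': "locc n n dA' dB' \<Gamma>'"
  shows "\<exists>p' p''. antimono p' \<and> (\<forall>i. 0 \<le> p' i) \<and> (\<forall>i\<ge>n. p' i = 0) \<and> (\<Sum>i<n. p' i) = 1 \<and>
     antimono p'' \<and> (\<forall>i. 0 \<le> p'' i) \<and> (\<forall>i\<ge>dA'. p'' i = 0) \<and> (\<Sum>i<dA'. p'' i) = 1 \<and>
     (\<forall>l. (\<Sum>i<l. p i) \<le> (\<Sum>i<l. p' i)) \<and> (\<forall>l. (\<Sum>i<l. p' i) \<le> (\<Sum>i<l. p'' i)) \<and>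
     fidelity ((\<Gamma>' \<circ> \<Gamma>) (ket_bra \<psi>)) (ket_bra \<phi>) \<le> (\<Sum>y<r'. sqrt (p'' y) * sqrt (q y))"
proof -
  let ?n = "dA * dB" and ?n' = "dA' * dB'"
  obtain Ls where Ls: "locc_kraus dA dB n n \<Gamma> Ls" using locc_imp_locc_kraus[OF \<Gamma>] by blast
  obtain Ls' where Ls': "locc_kraus n n dA' dB' \<Gamma>' Ls'" using locc_imp_locc_kraus[OF \<Gamma>'] by blast
  have \<psi>c: "\<psi> \<in> carrier_vec ?n" using \<psi> by (simp add: pure_state_def)
  have "of_real (sqn ?n (($) \<psi>)) = (1 :: complex)"
    using \<psi> by (auto simp: pure_state_def scalar_prod_def cip_def atLeast0LessThan simp flip: cip_self)
  then have \<psi>1: "sqn ?n (($) \<psi>) = 1" by simp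
  have Lc: "L \<in> carrier_mat (n * n) ?n" if "L \<in> set Ls" for L
    using Ls that by (auto simp: locc_kraus_def)
  have Lc': "L \<in> carrier_mat ?n' (n * n)" if "L \<in> set Ls'" for L
    using Ls' that by (auto simp: locc_kraus_def)
  have L\<psi>: "L *\<^sub>v \<psi> \<in> carrier_vec (n * n)" if "L \<in> set Ls" for L
    using Lc[OF that] \<psi>c by simp
  define us where "us = map (\<lambda>L. L *\<^sub>v \<psi>) Ls"
  define ws where "ws = concat (map (\<lambda>u. map (\<lambda>L. L *\<^sub>v u) Ls') us)"
  have us: "set us \<subseteq> carrier_vec (n * n)" using L\<psi> by (auto simp: us_def)
  then have ws: "set ws \<subseteq> carrier_vec ?n'" using Lc' by (fastforce simp: ws_def)
  have sum_us: "(\<Sum>u\<leftarrow>us. F u) = (\<Sum>L\<leftarrow>Ls. F (L *\<^sub>v \<psi>))" for F :: "complex vec \<Rightarrow> real"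
    by (simp add: us_def comp_def)
  have sum_ws: "(\<Sum>w\<leftarrow>ws. F w) = (\<Sum>u\<leftarrow>us. \<Sum>L\<leftarrow>Ls'. F (L *\<^sub>v u))" for F :: "complex vec \<Rightarrow> real"
    by (simp add: ws_def sum_list_map_concat comp_def)
  define p' where "p' = (\<lambda>i. \<Sum>u\<leftarrow>us. vcoeffs n n u i)"
  define p'' where "p'' = (\<lambda>i. \<Sum>w\<leftarrow>ws. vcoeffs dA' dB' w i)"
  have swap: "(\<Sum>i<l. \<Sum>x\<leftarrow>xs. F x i) = (\<Sum>x\<leftarrow>xs. \<Sum>i<(l :: nat). F x i)"
    for l and xs :: "complex vec list" and F :: "complex vec \<Rightarrow> nat \<Rightarrow> real"
    by (induction xs) (auto simp: sum.distrib)
  have anti: "antimono (\<lambda>i. \<Sum>x\<leftarrow>xs. vcoeffs a b x i)" for xs a b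
  proof (rule antimonoI)
    fix i j :: nat assume "i \<le> j"
    then show "(\<Sum>x\<leftarrow>xs. vcoeffs a b x j) \<le> (\<Sum>x\<leftarrow>xs. vcoeffs a b x i)"
      using vcoeffs_props(1) by (intro sum_list_mono) (auto simp: antimono_def)
  qed
  have "antimono p'" "antimono p''" unfolding p'_def p''_def by (rule anti)+
  moreover have "\<forall>i. 0 \<le> p' i" "\<forall>i. 0 \<le> p'' i"
    unfolding p'_def p''_def using vcoeffs_props(2) by (auto intro!: sum_list_nonneg)
  moreover have "\<forall>i\<ge>n. p' i = 0" "\<forall>i\<ge>dA'. p'' i = 0"
    unfolding p'_def p''_def using vcoeffs_props(3) by (auto simp: sum_list_0 cong: map_cong)
  moreover have "(\<Sum>i<n. p' i) = 1"
  proof -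
    have "(\<Sum>i<n. p' i) = (\<Sum>L\<leftarrow>Ls. sqn (n * n) (($) (L *\<^sub>v \<psi>)))"
      unfolding p'_def swap unfolding sum_us sqn_vcoeffs ..
    also have "\<dots> = sqn ?n (($) \<psi>)" using Ls \<psi>c by (simp add: locc_kraus_def)
    finally show ?thesis by (simp add: \<psi>1)
  qed
  moreover have "(\<Sum>i<dA'. p'' i) = 1"
  proof -
    have "(\<Sum>i<dA'. p'' i) = (\<Sum>u\<leftarrow>us. \<Sum>L\<leftarrow>Ls'. sqn ?n' (($) (L *\<^sub>v u)))"
      unfolding p''_def swap unfolding sum_ws sqn_vcoeffs ..
    also have "\<dots> = (\<Sum>u\<leftarrow>us. sqn (n * n) (($) u))"
      using Ls' us by (intro arg_cong[of _ _ sum_list] map_cong refl) (auto simp: locc_kraus_def)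
    also have "\<dots> = sqn ?n (($) \<psi>)" unfolding sum_us using Ls \<psi>c by (simp add: locc_kraus_def)
    finally show ?thesis by (simp add: \<psi>1)
  qed
  moreover have "(\<Sum>i<l. p i) \<le> (\<Sum>i<l. p' i)" for l
  proof -
    have "(\<Sum>i<l. p i) \<le> (\<Sum>i<l. vcoeffs dA dB \<psi> i)" by (rule schmidt_prefix_sum[OF S\<psi>])
    also have "\<dots> \<le> (\<Sum>L\<leftarrow>Ls. \<Sum>i<l. vcoeffs n n (L *\<^sub>v \<psi>) i)"
      using Ls \<psi>c by (simp add: locc_kraus_def)
    finally show ?thesis unfolding p'_def swap unfolding sum_us .
  qed
  moreover have "(\<Sum>i<l. p' i) \<le> (\<Sum>i<l. p'' i)" for l
    unfolding p'_def p''_def swap unfolding sum_ws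
    using Ls' us by (intro sum_list_mono) (auto simp: locc_kraus_def)
  moreover have "fidelity ((\<Gamma>' \<circ> \<Gamma>) (ket_bra \<psi>)) (ket_bra \<phi>) \<le> (\<Sum>y<r'. sqrt (p'' y) * sqrt (q y))"
  proof -
    have kb: "ket_bra \<psi> \<in> carrier_mat ?n ?n" using \<psi>c by (auto simp: ket_bra_def)
    define \<rho> where "\<rho> = \<Gamma> (ket_bra \<psi>)"
    have \<rho>: "\<rho> \<in> carrier_mat (n * n) (n * n)" using Ls kb by (auto simp: \<rho>_def locc_kraus_def)
    have \<rho>_ent: "\<rho> $$ (i, j) = (\<Sum>u\<leftarrow>us. u $ i * cnj (u $ j))" if ij: "i < n * n" "j < n * n" for i j
    proof -
      have "\<rho> $$ (i, j) = (\<Sum>L\<leftarrow>Ls. kraus_apply L (ket_bra \<psi>) $$ (i, j))"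
        using Ls kb ij by (auto simp: \<rho>_def locc_kraus_def)
      also have "\<dots> = (\<Sum>L\<leftarrow>Ls. (L *\<^sub>v \<psi>) $ i * cnj ((L *\<^sub>v \<psi>) $ j))"
      proof (intro arg_cong[of _ _ sum_list] map_cong refl)
        fix L assume L: "L \<in> set Ls"
        show "kraus_apply L (ket_bra \<psi>) $$ (i, j) = (L *\<^sub>v \<psi>) $ i * cnj ((L *\<^sub>v \<psi>) $ j)"
          unfolding kraus_apply_ket_bra[OF Lc[OF L] \<psi>c]
          using Lc[OF L] ij by (intro index_ket_bra) auto
      qed
      finally show ?thesis by (simp add: us_def comp_def)
    qed
    have "\<Gamma>' \<rho> $$ (i, j) = (\<Sum>w\<leftarrow>ws. w $ i * cnj (w $ j))" if ij: "i < ?n'" "j < ?n'" for i j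
    proof -
      have "kraus_apply L \<rho> $$ (i, j) = (\<Sum>u\<leftarrow>us. (L *\<^sub>v u) $ i * cnj ((L *\<^sub>v u) $ j))"
        if L: "L \<in> set Ls'" for L
      proof -
        note Lc = Lc'[OF L]
        \<comment> \<open>Linearity of the Kraus map over the ensemble, at the level of entries,
          because \<rho> is known as an ensemble only through its entries.\<close>
        have lin: "(\<Sum>y<n * n. \<Sum>x<n * n. L $$ (i, x) * (\<Sum>u\<leftarrow>xs. u $ x * cnj (u $ y)) * cnj (L $$ (j, y))) =
            (\<Sum>u\<leftarrow>xs. (L *\<^sub>v u) $ i * cnj ((L *\<^sub>v u) $ j))" if "set xs \<subseteq> carrier_vec (n * n)" for xs
          using that
        proof (induction xs)
          case (Cons u xs)
          then have u: "u \<in> carrier_vec (n * n)" by simp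
          have "(\<Sum>y<n * n. \<Sum>x<n * n. L $$ (i, x) * (u $ x * cnj (u $ y)) * cnj (L $$ (j, y))) =
              kraus_apply L (ket_bra u) $$ (i, j)"
            using u by (subst index_kraus_apply[OF Lc _ ij]) (auto simp: ket_bra_def intro!: sum.cong)
          also have "\<dots> = (L *\<^sub>v u) $ i * cnj ((L *\<^sub>v u) $ j)"
            unfolding kraus_apply_ket_bra[OF Lc u] using Lc ij by (intro index_ket_bra) auto
          finally show ?case using Cons by (simp add: algebra_simps sum.distrib)
        qed simp
        have "kraus_apply L \<rho> $$ (i, j) = (\<Sum>y<n * n. \<Sum>x<n * n. L $$ (i, x) * (\<Sum>u\<leftarrow>us. u $ x * cnj (u $ y)) * cnj (L $$ (j, y)))"
          unfolding index_kraus_apply[OF Lc \<rho> ij] using \<rho>_ent by (intro sum.cong refl) auto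
        then show ?thesis unfolding lin[OF us] .
      qed
      then have "\<Gamma>' \<rho> $$ (i, j) = (\<Sum>L\<leftarrow>Ls'. \<Sum>u\<leftarrow>us. (L *\<^sub>v u) $ i * cnj ((L *\<^sub>v u) $ j))"
        using Ls' \<rho> ij by (simp add: locc_kraus_def cong: map_cong)
      also have "\<dots> = (\<Sum>u\<leftarrow>us. \<Sum>L\<leftarrow>Ls'. (L *\<^sub>v u) $ i * cnj ((L *\<^sub>v u) $ j))"
        by (induction us) (auto simp: sum_list_addf)
      finally show ?thesis by (simp add: ws_def sum_list_map_concat comp_def)
    qed
    moreover have "\<Gamma>' \<rho> \<in> carrier_mat ?n' ?n'" using Ls' \<rho> by (auto simp: locc_kraus_def)
    ultimately have "fidelity ((\<Gamma>' \<circ> \<Gamma>) (ket_bra \<psi>)) (ket_bra \<phi>) =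
        sqrt (\<Sum>w\<leftarrow>ws. (cmod (cip ?n' (($) w) (($) \<phi>)))\<^sup>2)"
      using fidelity_ensemble[OF \<phi> ws, of "\<Gamma>' \<rho>"] by (simp add: \<rho>_def)
    also have "\<dots> \<le> sqrt (\<Sum>w\<leftarrow>ws. (\<Sum>y<r'. sqrt (vcoeffs dA' dB' w y) * sqrt (q y))\<^sup>2)"
    proof (intro real_sqrt_le_mono sum_list_mono power_mono)
      fix w
      obtain t e f where "schmidt dA' dB' (coef dB' w) t (vcoeffs dA' dB' w) e f"
        by (rule schmidt_coeffs)
      from overlap_le[OF this S\<phi>]
      show "cmod (cip ?n' (($) w) (($) \<phi>)) \<le> (\<Sum>y<r'. sqrt (vcoeffs dA' dB' w y) * sqrt (q y))"
        by (simp add: cip_coef)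
    qed simp
    also have "\<dots> = L2_set (\<lambda>k. \<Sum>y<r'. sqrt (vcoeffs dA' dB' (ws ! k) y) * sqrt (q y)) {..<length ws}"
      by (simp add: L2_set_def sum_list_sum_nth atLeast0LessThan)
    also have "\<dots> \<le> (\<Sum>y<r'. L2_set (\<lambda>k. sqrt (vcoeffs dA' dB' (ws ! k) y) * sqrt (q y)) {..<length ws})"
      by (rule L2_set_sum_le)
    \<comment> \<open>For fixed \<open>y\<close> the norm over the ensemble of the roots of the
      coefficients is the root of their total, \<open>p'' y\<close>.\<close>
    also have "\<dots> = (\<Sum>y<r'. sqrt (p'' y) * sqrt (q y))"
    proof (intro sum.cong refl)
      fix y
      have "(sqrt (vcoeffs dA' dB' (ws ! k) y) * sqrt (q y))\<^sup>2 = vcoeffs dA' dB' (ws ! k) y * q y" for k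
        using vcoeffs_props(2) schmidtD(2)[OF S\<phi>] by (simp add: power_mult_distrib)
      then show "L2_set (\<lambda>k. sqrt (vcoeffs dA' dB' (ws ! k) y) * sqrt (q y)) {..<length ws} = sqrt (p'' y) * sqrt (q y)"
        by (simp add: L2_set_def p''_def sum_list_sum_nth atLeast0LessThan real_sqrt_mult flip: sum_distrib_right)
    qed
    finally show ?thesis .
  qed
  ultimately show ?thesis by blast
qed

section \<open>Nielsen's protocol\<close>

text \<open>The missing Kraus operators are \<open>|e\<^sub>0\<rangle>\<langle>e\<^sub>j| G\<close> for the projector \<open>G\<close> onto the orthogonal complement.\<close>

lemma kraus_completion:
  assumes K: "\<And>k. k < m \<Longrightarrow> K k \<in> carrier_mat d' d" and d': "0 < d'"
    and a: "ons d I a" "finite I"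
    and gram: "\<And>i j. i < d \<Longrightarrow> j < d \<Longrightarrow>
      (\<Sum>k<m. \<Sum>r<d'. cnj (K k $$ (r, i)) * K k $$ (r, j)) = (\<Sum>x\<in>I. a x i * cnj (a x j))"
  obtains m' K' where "m \<le> m'" "\<forall>k<m. K' k = K k" "\<forall>k<m'. K' k \<in> carrier_mat d' d"
    "mat_sum d (\<lambda>k. mat_adjoint (K' k) * K' k) m' = 1\<^sub>m d"
    "\<forall>k<m'. m \<le> k \<longrightarrow> (\<forall>x\<in>I. \<forall>r<d'. mv d (ent (K' k)) (a x) r = 0)"
proof -
  define G where "G = (\<lambda>i j. (if i = j then 1 else 0) - (\<Sum>x\<in>I. a x i * cnj (a x j)))"
  have G_cnj: "cnj (G i j) = G j i" for i j by (auto simp: G_def mult.commute)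
  have Ga: "mv d G (a x) i = 0" if "x \<in> I" "i < d" for x i
  proof -
    have "(\<Sum>j<d. (\<Sum>y\<in>I. a y i * cnj (a y j)) * a x j) = (\<Sum>j<d. \<Sum>y\<in>I. a y i * (a x j * cnj (a y j)))"
      by (simp add: sum_distrib_left sum_distrib_right ac_simps)
    also have "\<dots> = (\<Sum>y\<in>I. a y i * cip d (a x) (a y))"
      by (subst sum.swap) (simp add: cip_def sum_distrib_left)
    also have "\<dots> = (\<Sum>y\<in>I. if x = y then a y i else 0)"
      using a that by (intro sum.cong) (auto simp: onsD)
    finally have "(\<Sum>j<d. (\<Sum>y\<in>I. a y i * cnj (a y j)) * a x j) = a x i"
      using a that by simp
    moreover have "(\<Sum>j<d. (if i = j then 1 else 0) * a x j) = a x i"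
      using that by (simp add: if_distrib[of "\<lambda>z. z * _"] cong: if_cong)
    ultimately show ?thesis by (simp add: mv_def G_def left_diff_distrib sum_subtractf)
  qed
  \<comment> \<open>\<open>G\<close> is Hermitian and annihilates every \<open>a x\<close>, hence
    idempotent; so its rows, used as Kraus operators, add exactly \<open>G\<close> to the
    completeness relation.\<close>
  have GG: "(\<Sum>j<d. cnj (G j i) * G j i') = G i i'" if "i < d" "i' < d" for i i'
  proof -
    have "(\<Sum>j<d. cnj (G j i) * G j i') =
        (\<Sum>j<d. G i j * (if j = i' then 1 else 0)) - (\<Sum>j<d. \<Sum>x\<in>I. G i j * a x j * cnj (a x i'))"
      unfolding G_cnj by (subst (2) G_def) (simp add: right_diff_distrib sum_subtractf sum_distrib_left mult.assoc)
    also have "(\<Sum>j<d. \<Sum>x\<in>I. G i j * a x j * cnj (a x i')) = (\<Sum>x\<in>I. mv d G (a x) i * cnj (a x i'))"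
      by (subst sum.swap) (simp add: mv_def sum_distrib_right)
    also have "\<dots> = 0" using Ga that by simp
    finally show ?thesis using that by (simp add: if_distrib[of "\<lambda>z. _ * z"] cong: if_cong)
  qed
  \<comment> \<open>The output vector \<open>e\<^sub>0\<close> exists because \<open>0 < d'\<close>;
    operator \<open>m + k\<close> carries row \<open>k\<close> of \<open>G\<close>.\<close>
  define K' where "K' = (\<lambda>k. if k < m then K k else mat d' d (\<lambda>(r, i). if r = 0 then G (k - m) i else 0))"
  have K'c: "K' k \<in> carrier_mat d' d" for k using K by (simp add: K'_def)
  have complete: "mat_sum d (\<lambda>k. mat_adjoint (K' k) * K' k) (m + d) = 1\<^sub>m d"
  proof (rule eq_matI)
    fix i j assume "i < dim_row (1\<^sub>m d :: complex mat)" "j < dim_col (1\<^sub>m d :: complex mat)"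
    then have ij: "i < d" "j < d" by auto
    have new: "(\<Sum>r<d'. cnj (K' (k + m) $$ (r, i)) * K' (k + m) $$ (r, j)) = cnj (G k i) * G k j" for k
    proof -
      have "(\<Sum>r<d'. cnj (K' (k + m) $$ (r, i)) * K' (k + m) $$ (r, j)) =
          (\<Sum>r<d'. if r = 0 then cnj (G k i) * G k j else 0)"
        using ij by (intro sum.cong) (auto simp: K'_def)
      then show ?thesis using d' by simp
    qed
    have "mat_sum d (\<lambda>k. mat_adjoint (K' k) * K' k) (m + d) $$ (i, j) =
        (\<Sum>k<m + d. \<Sum>r<d'. cnj (K' k $$ (r, i)) * K' k $$ (r, j))"
    proof -
      have "(mat_adjoint (K' k) * K' k) $$ (i, j) = (\<Sum>r<d'. cnj (K' k $$ (r, i)) * K' k $$ (r, j))" for k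
        unfolding mult_ent[OF mat_adjoint_carrier[OF K'c] K'c ij]
        using K'c[of k] ij by (intro sum.cong) (auto simp: index_mat_adjoint)
      then show ?thesis using ij by (simp add: mat_sum_def)
    qed
    also have "\<dots> = (\<Sum>k<m. \<Sum>r<d'. cnj (K' k $$ (r, i)) * K' k $$ (r, j)) +
        (\<Sum>k<d. \<Sum>r<d'. cnj (K' (k + m) $$ (r, i)) * K' (k + m) $$ (r, j))"
      using sum.atLeastLessThan_concat[of 0 m "m + d" "\<lambda>k. \<Sum>r<d'. cnj (K' k $$ (r, i)) * K' k $$ (r, j)"]
        sum.shift_bounds_nat_ivl[of "\<lambda>k. \<Sum>r<d'. cnj (K' k $$ (r, i)) * K' k $$ (r, j)" 0 m d]
      by (simp add: atLeast0LessThan add.commute)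
    also have "(\<Sum>k<m. \<Sum>r<d'. cnj (K' k $$ (r, i)) * K' k $$ (r, j)) = (\<Sum>x\<in>I. a x i * cnj (a x j))"
      using gram[OF ij] by (simp add: K'_def)
    also have "(\<Sum>k<d. \<Sum>r<d'. cnj (K' (k + m) $$ (r, i)) * K' (k + m) $$ (r, j)) = G i j"
      unfolding new by (rule GG[OF ij])
    finally show "mat_sum d (\<lambda>k. mat_adjoint (K' k) * K' k) (m + d) $$ (i, j) = 1\<^sub>m d $$ (i, j)"
      using ij by (simp add: G_def)
  qed (auto simp: mat_sum_def)
  have zero: "mv d (ent (K' k)) (a x) r = 0" if "m \<le> k" "k < m + d" "x \<in> I" "r < d'" for k x r
  proof -
    have "mv d (ent (K' k)) (a x) r = (if r = 0 then mv d G (a x) (k - m) else 0)"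
      using that by (auto simp: mv_def K'_def)
    then show ?thesis using Ga[OF that(3), of "k - m"] that by simp
  qed
  show ?thesis
    by (rule that[of "m + d" K']) (use K'c complete zero in \<open>auto simp: K'_def\<close>)
qed

section \<open>Operators built from rank-one terms\<close>

definition sum_ket_bra :: "nat \<Rightarrow> nat \<Rightarrow> 'x set \<Rightarrow> ('x \<Rightarrow> real) \<Rightarrow> ('x \<Rightarrow> nat \<Rightarrow> complex) \<Rightarrow> ('x \<Rightarrow> nat \<Rightarrow> complex) \<Rightarrow> complex mat" where
  "sum_ket_bra d' d I g f a = mat d' d (\<lambda>(s, l). \<Sum>i\<in>I. of_real (g i) * f i s * cnj (a i l))"

lemma sum_ket_bra_carrier [simp]: "sum_ket_bra d' d I g f a \<in> carrier_mat d' d"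
  by (simp add: sum_ket_bra_def)

text \<open>Weighting the inner products by \<open>g\<close> leaves the vectors \<open>f i\<close>
  with \<open>g i = 0\<close> arbitrary; in Nielsen's protocol some of them are zero.\<close>

lemma sum_ket_bra_gram:
  assumes f: "\<And>i j. i \<in> I \<Longrightarrow> j \<in> I \<Longrightarrow>
      of_real (g i * g j) * cip d' (f i) (f j) = (if i = j then of_real (h i) else 0)"
    and "finite I" and l: "l < d" "l' < d"
  shows "(\<Sum>s<d'. cnj (sum_ket_bra d' d I g f a $$ (s, l)) * sum_ket_bra d' d I g f a $$ (s, l')) =
     (\<Sum>i\<in>I. of_real (h i) * (a i l * cnj (a i l')))"
proof -
  have "(\<Sum>s<d'. cnj (sum_ket_bra d' d I g f a $$ (s, l)) * sum_ket_bra d' d I g f a $$ (s, l')) =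
      cip d' (\<lambda>s. \<Sum>i\<in>I. (of_real (g i) * cnj (a i l')) * f i s) (\<lambda>s. \<Sum>i\<in>I. (of_real (g i) * cnj (a i l)) * f i s)"
    using l by (simp add: cip_def sum_ket_bra_def ac_simps)
  also have "\<dots> = (\<Sum>i\<in>I. \<Sum>j\<in>I. (a j l * cnj (a i l')) * (of_real (g i * g j) * cip d' (f i) (f j)))"
    unfolding cip_sum_left cip_sum_right by (simp add: sum_distrib_left ac_simps)
  also have "\<dots> = (\<Sum>i\<in>I. \<Sum>j\<in>I. if i = j then of_real (h i) * (a j l * cnj (a i l')) else 0)"
    using f by (intro sum.cong refl) (auto simp: ac_simps)
  finally show ?thesis using assms(2) by simp
qed

lemma mv_sum_ket_bra:
  assumes a: "ons d I a" "finite I" and v: "\<And>l. l < d \<Longrightarrow> v l = (\<Sum>x\<in>I. z x * a x l)" and s: "s < d'"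
  shows "mv d (ent (sum_ket_bra d' d I g f a)) v s = (\<Sum>i\<in>I. of_real (g i) * f i s * z i)"
proof -
  have "mv d (ent (sum_ket_bra d' d I g f a)) v s = (\<Sum>l<d. \<Sum>i\<in>I. of_real (g i) * f i s * (v l * cnj (a i l)))"
    using s by (simp add: mv_def sum_ket_bra_def sum_distrib_left sum_distrib_right ac_simps)
  also have "\<dots> = (\<Sum>i\<in>I. of_real (g i) * f i s * cip d v (a i))"
    by (subst sum.swap) (simp add: cip_def sum_distrib_left)
  also have "\<dots> = (\<Sum>i\<in>I. of_real (g i) * f i s * z i)"
  proof (intro sum.cong refl)
    fix i assume i: "i \<in> I"
    have "cip d v (a i) = cip d (\<lambda>l. \<Sum>x\<in>I. z x * a x l) (a i)" using v by (intro cip_cong) auto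
    then show "of_real (g i) * f i s * cip d v (a i) = of_real (g i) * f i s * z i"
      by (simp add: cip_ons_sum_left[OF a i])
  qed
  finally show ?thesis .
qed

definition bivec :: "nat \<Rightarrow> nat \<Rightarrow> (nat \<Rightarrow> nat \<Rightarrow> complex) \<Rightarrow> complex vec" where
  "bivec dA dB M = vec (dA * dB) (\<lambda>x. M (x div dB) (x mod dB))"

lemma bivec_carrier [simp]: "bivec dA dB M \<in> carrier_vec (dA * dB)"
  by (simp add: bivec_def)

lemma coef_bivec: "i < dA \<Longrightarrow> j < dB \<Longrightarrow> coef dB (bivec dA dB M) i j = M i j"
  by (simp add: coef_def bivec_def pair_index_less)

lemma coef_eqI:
  assumes "v \<in> carrier_vec (dA * dB)" "w \<in> carrier_vec (dA * dB)"
    and "\<And>i j. i < dA \<Longrightarrow> j < dB \<Longrightarrow> coef dB v i j = coef dB w i j"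
  shows "v = w"
proof (rule eq_vecI)
  fix x assume "x < dim_vec w"
  then have x: "x < dA * dB" using assms(2) by simp
  then have "0 < dB" by (cases "dB = 0") auto
  then have "x div dB < dA" "x mod dB < dB" using x by (auto simp: less_mult_imp_div_less)
  from assms(3)[OF this] show "v $ x = w $ x" by (simp add: coef_def)
qed (use assms in auto)

lemma ket_bra_zero: "ket_bra (0\<^sub>v n) = 0\<^sub>m n n"
  by (rule eq_matI) (auto simp: ket_bra_def)

lemma ket_bra_smult: "ket_bra (of_real s \<cdot>\<^sub>v v) = of_real (s\<^sup>2) \<cdot>\<^sub>m ket_bra v"
  by (rule eq_matI) (auto simp: ket_bra_def power2_eq_square)

text \<open>The partial isometry from \<open>b x\<close> to \<open>e x\<close> is completed to a
  measurement whose additional Kraus operators vanish on the span of the \<open>b x\<close>, so on a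
  vector supported there only the first outcome contributes. The empty family yields a protocol that
  sends 0 to 0.\<close>

lemma locc_snd_isometry:
  assumes b: "ons dB J b" and e: "ons dB' J e" and J: "finite J" and dB': "0 < dB'"
  shows "\<exists>\<Gamma>. locc dA dB dA dB' \<Gamma> \<and> (\<forall>w\<in>carrier_vec (dA * dB). \<forall>z.
       (\<forall>i<dA. \<forall>j<dB. coef dB w i j = (\<Sum>x\<in>J. z x i * b x j)) \<longrightarrow>
       \<Gamma> (ket_bra w) = ket_bra (bivec dA dB' (\<lambda>i j. \<Sum>x\<in>J. z x i * e x j)))"
proof -
  let ?K = "sum_ket_bra dB' dB J (\<lambda>_. 1) e b"
  have gram: "(\<Sum>k<Suc 0. \<Sum>s<dB'. cnj (?K $$ (s, l)) * ?K $$ (s, l')) = (\<Sum>x\<in>J. b x l * cnj (b x l'))"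
    if "l < dB" "l' < dB" for l l'
  proof -
    have "(\<Sum>s<dB'. cnj (?K $$ (s, l)) * ?K $$ (s, l')) = (\<Sum>x\<in>J. of_real 1 * (b x l * cnj (b x l')))"
      by (rule sum_ket_bra_gram[OF _ J that]) (simp add: onsD[OF e])
    then show ?thesis by simp
  qed
  obtain m K where m: "Suc 0 \<le> m" and K0: "\<forall>k<Suc 0. K k = ?K" and K: "\<forall>k<m. K k \<in> carrier_mat dB' dB"
    "mat_sum dB (\<lambda>k. mat_adjoint (K k) * K k) m = 1\<^sub>m dB"
    and zero: "\<forall>k<m. Suc 0 \<le> k \<longrightarrow> (\<forall>x\<in>J. \<forall>r<dB'. mv dB (ent (K k)) (b x) r = 0)"
    by (rule kraus_completion[of "Suc 0" "\<lambda>_. ?K" dB' dB J b, OF sum_ket_bra_carrier dB' b J gram])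
  define \<Gamma> where "\<Gamma> = (\<lambda>\<rho>. mat_sum (dA * dB') (\<lambda>k. kraus_apply (tensor_mat (1\<^sub>m dA) (K k)) \<rho>) m)"
  have locc: "locc dA dB dA dB' \<Gamma>"
    unfolding \<Gamma>_def
    by (rule locc.locc_snd[where d = "\<lambda>_. dB'" and \<Gamma> = "\<lambda>_ \<rho>. \<rho>"]) (use K in \<open>auto intro: locc.locc_stop\<close>)
  have "\<Gamma> (ket_bra w) = ket_bra (bivec dA dB' (\<lambda>i j. \<Sum>x\<in>J. z x i * e x j))"
    if w: "w \<in> carrier_vec (dA * dB)"
      and wz: "\<And>i j. i < dA \<Longrightarrow> j < dB \<Longrightarrow> coef dB w i j = (\<Sum>x\<in>J. z x i * b x j)" for w z
  proof -
    let ?T = "\<lambda>k. tensor_mat (1\<^sub>m dA) (K k)" and ?u = "bivec dA dB' (\<lambda>i j. \<Sum>x\<in>J. z x i * e x j)"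
    have T: "?T k \<in> carrier_mat (dA * dB') (dA * dB)" if "k < m" for k
      using K(1) that by (intro tensor_mat_carrier) auto
    have Tw: "coef dB' (?T k *\<^sub>v w) i j = mv dB (ent (K k)) (\<lambda>l. \<Sum>x\<in>J. z x i * b x l) j"
      if "k < m" "i < dA" "j < dB'" for k i j
      using K(1) that wz by (subst coef_tensor_snd[OF _ w, where d = dB']) (auto simp: mv_def)
    have T0: "?T 0 *\<^sub>v w = ?u"
    proof (rule coef_eqI)
      fix i j assume ij: "i < dA" "j < dB'"
      have "coef dB' (?T 0 *\<^sub>v w) i j = mv dB (ent ?K) (\<lambda>l. \<Sum>x\<in>J. z x i * b x l) j"
        using Tw[of 0 i j] m ij K0 by simp
      also have "\<dots> = (\<Sum>x\<in>J. of_real 1 * e x j * z x i)"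
        by (rule mv_sum_ket_bra[OF b J refl ij(2)])
      finally show "coef dB' (?T 0 *\<^sub>v w) i j = coef dB' ?u i j"
        using ij by (simp add: coef_bivec mult.commute)
    qed (use T[of 0] m w in auto)
    have Tk: "?T k *\<^sub>v w = 0\<^sub>v (dA * dB')" if k: "k < m" "1 \<le> k" for k
    proof (rule coef_eqI)
      fix i j assume ij: "i < dA" "j < dB'"
      have "coef dB' (?T k *\<^sub>v w) i j = 0" using zero k ij by (simp add: Tw mv_sum)
      then show "coef dB' (?T k *\<^sub>v w) i j = coef dB' (0\<^sub>v (dA * dB')) i j"
        using ij by (simp add: coef_def pair_index_less)
    qed (use T[OF k(1)] w in auto)
    have kr: "kraus_apply (?T k) (ket_bra w) = ket_bra (?T k *\<^sub>v w)" if "k < m" for k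
      by (rule kraus_apply_ket_bra[OF T[OF that] w])
    show ?thesis
    proof (rule eq_matI)
      fix i j assume "i < dim_row (ket_bra ?u)" "j < dim_col (ket_bra ?u)"
      then have ij: "i < dA * dB'" "j < dA * dB'" by (auto simp: ket_bra_def bivec_def)
      have "\<Gamma> (ket_bra w) $$ (i, j) = (\<Sum>k<m. kraus_apply (?T k) (ket_bra w) $$ (i, j))"
        using ij by (simp add: \<Gamma>_def mat_sum_def)
      also have "\<dots> = (\<Sum>k<m. if k = 0 then ket_bra ?u $$ (i, j) else 0)"
      proof (intro sum.cong refl)
        fix k assume "k \<in> {..<m}"
        then show "kraus_apply (?T k) (ket_bra w) $$ (i, j) = (if k = 0 then ket_bra ?u $$ (i, j) else 0)"
          using ij kr[of k] T0 Tk[of k] by (cases "k = 0") (simp_all add: ket_bra_zero)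
      qed
      finally show "\<Gamma> (ket_bra w) $$ (i, j) = ket_bra ?u $$ (i, j)" using m by simp
    qed (auto simp: \<Gamma>_def mat_sum_def ket_bra_def bivec_def)
  qed
  with locc show ?thesis by (intro exI[of _ \<Gamma>] conjI ballI allI impI) auto
qed

text \<open>Measurement outcomes are numbered, so the permutations are enumerated by natural
  numbers.\<close>

lemma majorized_imp_convex_combination_of_permutations':
  fixes p q :: "nat \<Rightarrow> real"
  assumes "antimono p" "\<And>l. (\<Sum>i<l. p i) \<le> (\<Sum>i<l. q i)" "(\<Sum>i<n. p i) = (\<Sum>i<n. q i)"
  obtains m :: nat and t \<pi> where "\<forall>k<m. 0 \<le> t k" "\<forall>k<m. \<pi> k permutes {..<n}" "(\<Sum>k<m. t k) = 1"
    "\<forall>i<n. p i = (\<Sum>k<m. t k * q (\<pi> k i))"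
proof -
  let ?P = "{\<pi>. \<pi> permutes {..<n}}"
  obtain t where t: "\<forall>\<pi>. 0 \<le> t \<pi>" "(\<Sum>\<pi>\<in>?P. t \<pi>) = 1"
    "\<forall>i<n. p i = (\<Sum>\<pi>\<in>?P. t \<pi> * q (\<pi> i))"
    using majorized_imp_convex_combination_of_permutations[of n p q] assms
    by (auto simp: antimono_def)
  have "finite ?P" by (simp add: finite_permutations)
  then obtain \<pi> where \<pi>: "bij_betw \<pi> {..<card ?P} ?P"
    using ex_bij_betw_nat_finite[of ?P] by (auto simp: atLeast0LessThan)
  show ?thesis
  proof (rule that[of "card ?P" "\<lambda>k. t (\<pi> k)" \<pi>])
    show "\<forall>k<card ?P. \<pi> k permutes {..<n}" using bij_betw_apply[OF \<pi>] by auto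
    show "(\<Sum>k<card ?P. t (\<pi> k)) = 1" using t(2) sum.reindex_bij_betw[OF \<pi>, of t] by simp
    show "\<forall>i<n. p i = (\<Sum>k<card ?P. t (\<pi> k) * q (\<pi> k i))"
      using t(3) sum.reindex_bij_betw[OF \<pi>, of "\<lambda>\<pi>. t \<pi> * q (\<pi> _)"] by simp
  qed (use t(1) in auto)
qed

text \<open>
  Nielsen's protocol. Writing \<open>p\<close> as \<open>\<Sum>\<^sub>k t\<^sub>k (q \<circ> \<pi>\<^sub>k)\<close>, the first party measures with the Kraus
  operators \<open>\<Sum>\<^sub>i (t\<^sub>k q(\<pi>\<^sub>k i) / p\<^sub>i)\<^bsup>1/2\<^esup> |c(\<pi>\<^sub>k i)\<rangle>\<langle>a\<^sub>i|\<close>, and the second party then maps \<open>b\<^sub>i\<close> to \<open>d(\<pi>\<^sub>k i)\<close>.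
\<close>

theorem nielsen:
  assumes \<psi>: "\<psi> \<in> carrier_vec (dA * dB)" and \<phi>: "\<phi> \<in> carrier_vec (dA' * dB')"
    and S: "schmidt dA dB (coef dB \<psi>) r p a b"
    and T: "schmidt dA' dB' (coef dB' \<phi>) r' q c d"
    and sums: "(\<Sum>i<r. p i) = 1" "(\<Sum>i<r'. q i) = 1"
    and le: "\<And>l. (\<Sum>i<l. p i) \<le> (\<Sum>i<l. q i)"
    and pos: "0 < dA'" "0 < dB'"
  obtains \<Gamma> where "locc dA dB dA' dB' \<Gamma>" "\<Gamma> (ket_bra \<psi>) = ket_bra \<phi>"
proof -
  note SD = schmidtD[OF S] and TD = schmidtD[OF T]
  \<comment> \<open>A common length for two sequences that vanish from \<open>r\<close> and from
    \<open>r'\<close> on; a permutation may send an index below \<open>r\<close> beyond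
    \<open>r'\<close>.\<close>
  define n where "n = r + r'"
  have "(\<Sum>i<n. p i) = (\<Sum>i<r. p i)" "(\<Sum>i<n. q i) = (\<Sum>i<r'. q i)"
    by (rule sum.mono_neutral_right; simp add: n_def SD(3) TD(3))+
  then have total: "(\<Sum>i<n. p i) = (\<Sum>i<n. q i)" using sums by simp
  obtain m :: nat and t \<pi> where t0: "\<forall>k<m. 0 \<le> t k" and \<pi>: "\<forall>k<m. \<pi> k permutes {..<n}"
    and t1: "(\<Sum>k<m. t k) = 1" and p_eq: "\<forall>i<n. p i = (\<Sum>k<m. t k * q (\<pi> k i))"
    by (rule majorized_imp_convex_combination_of_permutations'[OF SD(1) le total])
  \<comment> \<open>The Kraus operators divide by \<open>p i\<close>, so they live on the support of
    \<open>p\<close>; their completion covers the rest of the space.\<close>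
  define I where "I = {i. i < r \<and> 0 < p i}"
  have I: "finite I" "I \<subseteq> {..<r}" "I \<subseteq> {..<n}" by (auto simp: I_def n_def)
  have aI: "ons dA I a" and bI: "ons dB I b"
    using ons_mono[OF SD(4) I(2)] ons_mono[OF SD(5) I(2)] by auto
  have coef_\<psi>: "coef dB \<psi> i j = (\<Sum>x\<in>I. of_real (sqrt (p x)) * a x i * b x j)" if "i < dA" "j < dB" for i j
    unfolding SD(6)[OF that] using SD(2) by (intro sum.mono_neutral_right) (auto simp: I_def less_le)
  \<comment> \<open>Positions from \<open>r'\<close> on carry no Schmidt vector and are filled with
    0; there \<open>q\<close>, and with it the factor \<open>g\<close>, vanishes.\<close>
  define c' where "c' = (\<lambda>j s. if j < r' then c j s else 0)"
  define g where "g = (\<lambda>k i. sqrt (t k * q (\<pi> k i) / p i))"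
  have g_sq: "(g k i)\<^sup>2 = t k * q (\<pi> k i) / p i" if "k < m" "i \<in> I" for k i
    using t0 TD(2) that by (simp add: g_def I_def)
  have inj: "\<pi> k i = \<pi> k j \<longleftrightarrow> i = j" if "k < m" for k i j
    using \<pi> that by (meson permutes_inj injD)
  have cc: "cip dA' (c' j) (c' j') = (if j = j' \<and> j < r' then 1 else 0)" for j j'
  proof (cases "j < r' \<and> j' < r'")
    case True
    then show ?thesis using onsD[OF TD(4), of j j'] by (simp add: c'_def)
  qed (auto simp: cip_def c'_def)
  define A where "A = (\<lambda>k. sum_ket_bra dA' dA I (g k) (\<lambda>i. c' (\<pi> k i)) a)"
  have A_gram: "(\<Sum>k<m. \<Sum>s<dA'. cnj (A k $$ (s, l)) * A k $$ (s, l')) = (\<Sum>x\<in>I. a x l * cnj (a x l'))"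
    if l: "l < dA" "l' < dA" for l l'
  proof -
    have "(\<Sum>s<dA'. cnj (A k $$ (s, l)) * A k $$ (s, l')) = (\<Sum>i\<in>I. of_real ((g k i)\<^sup>2) * (a i l * cnj (a i l')))"
      if k: "k < m" for k
      unfolding A_def
    proof (rule sum_ket_bra_gram[OF _ I(1) l])
      fix i j assume ij: "i \<in> I" "j \<in> I"
      have "g k i = 0" if "\<not> \<pi> k i < r'" using that TD(3) by (simp add: g_def)
      then show "of_real (g k i * g k j) * cip dA' (c' (\<pi> k i)) (c' (\<pi> k j)) =
          (if i = j then of_real ((g k i)\<^sup>2) else 0)"
        using k by (auto simp: cc inj power2_eq_square)
    qed
    then have "(\<Sum>k<m. \<Sum>s<dA'. cnj (A k $$ (s, l)) * A k $$ (s, l')) =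
        (\<Sum>k<m. \<Sum>i\<in>I. of_real ((g k i)\<^sup>2) * (a i l * cnj (a i l')))" by simp
    also have "\<dots> = (\<Sum>i\<in>I. of_real (\<Sum>k<m. (g k i)\<^sup>2) * (a i l * cnj (a i l')))"
      by (subst sum.swap) (simp add: sum_distrib_right)
    also have "\<dots> = (\<Sum>i\<in>I. a i l * cnj (a i l'))"
    proof (intro sum.cong refl)
      fix i assume i: "i \<in> I"
      \<comment> \<open>Dividing the convex combination for \<open>p i\<close> by \<open>p i\<close>
        gives completeness on the support.\<close>
      have "(\<Sum>k<m. (g k i)\<^sup>2) = (\<Sum>k<m. t k * q (\<pi> k i)) / p i"
        unfolding sum_divide_distrib using g_sq i by (intro sum.cong) auto
      also have "\<dots> = 1" using p_eq i I(3) by (auto simp: I_def)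
      finally show "of_real (\<Sum>k<m. (g k i)\<^sup>2) * (a i l * cnj (a i l')) = a i l * cnj (a i l')" by simp
    qed
    finally show ?thesis .
  qed
  have Ac: "A k \<in> carrier_mat dA' dA" for k by (simp add: A_def)
  obtain m' K where m': "m \<le> m'" and KA: "\<forall>k<m. K k = A k" and K: "\<forall>k<m'. K k \<in> carrier_mat dA' dA"
    "mat_sum dA (\<lambda>k. mat_adjoint (K k) * K k) m' = 1\<^sub>m dA"
    and zero: "\<forall>k<m'. m \<le> k \<longrightarrow> (\<forall>x\<in>I. \<forall>s<dA'. mv dA (ent (K k)) (a x) s = 0)"
    by (rule kraus_completion[of m A dA' dA I a, OF Ac pos(1) aI I(1) A_gram])
  let ?T = "\<lambda>k. tensor_mat (K k) (1\<^sub>m dB)"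
  have Tc: "?T k \<in> carrier_mat (dA' * dB) (dA * dB)" if "k < m'" for k
    using K(1) that by (intro tensor_mat_carrier) auto
  have T\<psi>: "coef dB (?T k *\<^sub>v \<psi>) s j = mv dA (ent (K k)) (\<lambda>l. \<Sum>x\<in>I. (of_real (sqrt (p x)) * b x j) * a x l) s"
    if "k < m'" "s < dA'" "j < dB" for k s j
    using K(1) that coef_\<psi> by (subst coef_tensor_fst[OF _ \<psi>, where d = dA']) (auto simp: mv_def ac_simps)
  have "\<exists>\<Gamma>. locc dA' dB dA' dB' \<Gamma> \<and>
      \<Gamma> (ket_bra (?T k *\<^sub>v \<psi>)) = (if k < m then of_real (t k) else 0) \<cdot>\<^sub>m ket_bra \<phi>"
    if k: "k < m'" for k
  proof (cases "k < m")
    case True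
    \<comment> \<open>Only these indices have a vector \<open>d (\<pi> k i)\<close> to which the
      second party can rotate \<open>b i\<close>.\<close>
    define J where "J = {i \<in> I. \<pi> k i < r'}"
    have J: "finite J" "J \<subseteq> I" using I by (auto simp: J_def)
    have "ons dB' J (\<lambda>i. d (\<pi> k i))"
      using onsD[OF TD(5)] inj[OF True] by (auto simp: ons_def J_def)
    from locc_snd_isometry[OF ons_mono[OF bI J(2)] this J(1) pos(2), of dA']
    obtain \<Gamma> where \<Gamma>: "locc dA' dB dA' dB' \<Gamma>"
      and \<Gamma>_eq: "\<forall>w\<in>carrier_vec (dA' * dB). \<forall>z.
       (\<forall>i<dA'. \<forall>j<dB. coef dB w i j = (\<Sum>x\<in>J. z x i * b x j)) \<longrightarrow>
       \<Gamma> (ket_bra w) = ket_bra (bivec dA' dB' (\<lambda>i j. \<Sum>x\<in>J. z x i * d (\<pi> k x) j))"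
      by (elim exE conjE)
    have "coef dB (?T k *\<^sub>v \<psi>) s j = (\<Sum>x\<in>J. (of_real (sqrt (t k * q (\<pi> k x))) * c (\<pi> k x) s) * b x j)"
      if sj: "s < dA'" "j < dB" for s j
    proof -
      have "coef dB (?T k *\<^sub>v \<psi>) s j = (\<Sum>i\<in>I. of_real (g k i) * c' (\<pi> k i) s * (of_real (sqrt (p i)) * b i j))"
        unfolding T\<psi>[OF k sj] using KA True sj
        by (simp only: A_def) (rule mv_sum_ket_bra[OF aI I(1) refl])
      also have "\<dots> = (\<Sum>i\<in>J. of_real (g k i) * c' (\<pi> k i) s * (of_real (sqrt (p i)) * b i j))"
        using I by (intro sum.mono_neutral_right) (auto simp: J_def c'_def)
      also have "\<dots> = (\<Sum>x\<in>J. (of_real (sqrt (t k * q (\<pi> k x))) * c (\<pi> k x) s) * b x j)"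
      proof (intro sum.cong refl)
        fix x assume x: "x \<in> J"
        then have "g k x * sqrt (p x) = sqrt (t k * q (\<pi> k x))"
          by (simp add: g_def J_def I_def real_sqrt_divide)
        then show "of_real (g k x) * c' (\<pi> k x) s * (of_real (sqrt (p x)) * b x j) =
            (of_real (sqrt (t k * q (\<pi> k x))) * c (\<pi> k x) s) * b x j"
          using x by (simp add: J_def c'_def ac_simps flip: of_real_mult)
      qed
      finally show ?thesis .
    qed
    then have "\<Gamma> (ket_bra (?T k *\<^sub>v \<psi>)) =
        ket_bra (bivec dA' dB' (\<lambda>i j. \<Sum>x\<in>J. (of_real (sqrt (t k * q (\<pi> k x))) * c (\<pi> k x) i) * d (\<pi> k x) j))"
      using Tc[OF k] \<psi> by (intro \<Gamma>_eq[rule_format]) auto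
    also have "bivec dA' dB' (\<lambda>i j. \<Sum>x\<in>J. (of_real (sqrt (t k * q (\<pi> k x))) * c (\<pi> k x) i) * d (\<pi> k x) j) =
        of_real (sqrt (t k)) \<cdot>\<^sub>v \<phi>"
    proof (rule coef_eqI)
      fix i j assume ij: "i < dA'" "j < dB'"
      define F where "F = (\<lambda>y. if y < r' then of_real (sqrt (t k * q y)) * c y i * d y j else 0)"
      have "(\<Sum>x\<in>J. (of_real (sqrt (t k * q (\<pi> k x))) * c (\<pi> k x) i) * d (\<pi> k x) j) = (\<Sum>x\<in>J. F (\<pi> k x))"
        by (intro sum.cong) (auto simp: F_def J_def)
      also have "\<dots> = (\<Sum>x<n. F (\<pi> k x))"
      proof (rule sum.mono_neutral_left)
        \<comment> \<open>If \<open>\<pi> k x < r'\<close> but \<open>x\<close> is outside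
          \<open>J\<close>, then \<open>p x = 0\<close>. This is a sum of nonnegative terms, one of
          which is \<open>t k * q (\<pi> k x)\<close>.\<close>
        show "\<forall>x\<in>{..<n} - J. F (\<pi> k x) = 0"
        proof
          fix x assume x: "x \<in> {..<n} - J"
          show "F (\<pi> k x) = 0"
          proof (cases "\<pi> k x < r'")
            case lt: True
            have "p x = 0" using x lt SD(2)[of x] SD(3)[of x] by (auto simp: J_def I_def not_less)
            then have "(\<Sum>k<m. t k * q (\<pi> k x)) = 0" using p_eq x by auto
            then have "t k * q (\<pi> k x) = 0"
              using t0 TD(2) True by (subst (asm) sum_nonneg_eq_0_iff) auto
            then show ?thesis by (simp add: F_def)
          qed (simp add: F_def)
        qed
      qed (use I J in auto)
      also have "\<dots> = (\<Sum>y<n. F y)"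
        using sum.permute[of "\<pi> k" "{..<n}" F] \<pi> True by (simp add: comp_def)
      also have "\<dots> = (\<Sum>y<r'. F y)"
        by (rule sum.mono_neutral_right) (auto simp: F_def n_def)
      also have "\<dots> = of_real (sqrt (t k)) * coef dB' \<phi> i j"
        using TD(6)[OF ij] by (simp add: F_def sum_distrib_left real_sqrt_mult ac_simps)
      finally show "coef dB' (bivec dA' dB' (\<lambda>i j. \<Sum>x\<in>J. (of_real (sqrt (t k * q (\<pi> k x))) * c (\<pi> k x) i) * d (\<pi> k x) j)) i j =
          coef dB' (of_real (sqrt (t k)) \<cdot>\<^sub>v \<phi>) i j"
        using ij \<phi> by (simp add: coef_bivec coef_def[of _ "_ \<cdot>\<^sub>v _"] pair_index_less) (simp add: coef_def)
    qed (use \<phi> in auto)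
    also have "ket_bra (of_real (sqrt (t k)) \<cdot>\<^sub>v \<phi>) = of_real (t k) \<cdot>\<^sub>m ket_bra \<phi>"
      using t0 True by (simp add: ket_bra_smult)
    finally show ?thesis using \<Gamma> True by auto
  next
    case False
    \<comment> \<open>The completing operators kill \<psi>, so these outcomes have probability 0; a
      protocol of the right dimensions must still continue them, and the empty family supplies
      one.\<close>
    have none: "ons dB {} b" "ons dB' {} d" by (simp_all add: ons_def)
    from locc_snd_isometry[OF none finite.emptyI pos(2), of dA']
    obtain \<Gamma> where \<Gamma>: "locc dA' dB dA' dB' \<Gamma>"
      and \<Gamma>_eq: "\<forall>w\<in>carrier_vec (dA' * dB). (\<forall>i<dA'. \<forall>j<dB. coef dB w i j = 0) \<longrightarrow>
       \<Gamma> (ket_bra w) = ket_bra (bivec dA' dB' (\<lambda>i j. 0))"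
      by auto
    have "coef dB (?T k *\<^sub>v \<psi>) s j = 0" if "s < dA'" "j < dB" for s j
      using T\<psi>[OF k that] zero k False that by (simp add: mv_sum)
    then have "\<Gamma> (ket_bra (?T k *\<^sub>v \<psi>)) = ket_bra (bivec dA' dB' (\<lambda>i j. 0))"
      using \<Gamma>_eq Tc[OF k] \<psi> by simp
    also have "\<dots> = 0 \<cdot>\<^sub>m ket_bra \<phi>"
      using \<phi> by (intro eq_matI) (auto simp: ket_bra_def bivec_def)
    finally show ?thesis using \<Gamma> False by auto
  qed
  then obtain \<Gamma> where \<Gamma>: "\<forall>k<m'. locc dA' dB dA' dB' (\<Gamma> k)"
    and \<Gamma>_eq: "\<And>k. k < m' \<Longrightarrow> \<Gamma> k (ket_bra (?T k *\<^sub>v \<psi>)) = (if k < m then of_real (t k) else 0) \<cdot>\<^sub>m ket_bra \<phi>"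
    by metis
  let ?\<Gamma> = "\<lambda>\<rho>. mat_sum (dA' * dB') (\<lambda>k. \<Gamma> k (kraus_apply (?T k) \<rho>)) m'"
  have "locc dA dB dA' dB' ?\<Gamma>"
    by (rule locc.locc_fst[where d = "\<lambda>_. dA'"]) (use K \<Gamma> in auto)
  moreover have "?\<Gamma> (ket_bra \<psi>) = ket_bra \<phi>"
  proof (rule eq_matI)
    fix i j assume "i < dim_row (ket_bra \<phi>)" "j < dim_col (ket_bra \<phi>)"
    then have ij: "i < dA' * dB'" "j < dA' * dB'" using \<phi> by (auto simp: ket_bra_def)
    have "?\<Gamma> (ket_bra \<psi>) $$ (i, j) = (\<Sum>k<m'. \<Gamma> k (ket_bra (?T k *\<^sub>v \<psi>)) $$ (i, j))"
      using ij kraus_apply_ket_bra[OF Tc \<psi>] by (simp add: mat_sum_def)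
    also have "\<dots> = (\<Sum>k<m'. (if k < m then of_real (t k) else 0) * ket_bra \<phi> $$ (i, j))"
    proof (intro sum.cong refl)
      fix k assume "k \<in> {..<m'}"
      moreover have "dim_row (ket_bra \<phi>) = dA' * dB'" "dim_col (ket_bra \<phi>) = dA' * dB'"
        using \<phi> by (auto simp: ket_bra_def)
      ultimately show "\<Gamma> k (ket_bra (?T k *\<^sub>v \<psi>)) $$ (i, j) =
          (if k < m then of_real (t k) else 0) * ket_bra \<phi> $$ (i, j)"
        using ij by (simp add: \<Gamma>_eq)
    qed
    also have "\<dots> = (\<Sum>k<m. of_real (t k) * ket_bra \<phi> $$ (i, j))"
      using m' by (intro sum.mono_neutral_cong_right) auto
    also have "\<dots> = of_real (\<Sum>k<m. t k) * ket_bra \<phi> $$ (i, j)"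
      by (simp add: sum_distrib_right)
    finally show "?\<Gamma> (ket_bra \<psi>) $$ (i, j) = ket_bra \<phi> $$ (i, j)" by (simp add: t1)
  qed (use \<phi> in \<open>auto simp: mat_sum_def ket_bra_def\<close>)
  ultimately show ?thesis by (rule that)
qed

section \<open>Equality of the two fidelities\<close>

lemma ons_of_orthonormal_family:
  assumes "orthonormal_family n X f"
  shows "ons n X (\<lambda>x. ($) (f x))"
  unfolding ons_def
proof (intro ballI)
  fix x y assume "x \<in> X" "y \<in> X"
  then have f: "f x \<in> carrier_vec n" "f y \<in> carrier_vec n" "f x \<bullet>c f y = (if x = y then 1 else 0)"
    using assms by (auto simp: orthonormal_family_def)
  have "cip n (($) (f x)) (($) (f y)) = f x \<bullet>c f y"
    using f(1,2) by (simp add: cip_def scalar_prod_def atLeast0LessThan)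
  then show "cip n (($) (f x)) (($) (f y)) = (if x = y then 1 else 0)" using f(3) by simp
qed

lemma schmidt_of_orthonormal_families:
  assumes P: "P \<in> distributions X" and a: "orthonormal_family dA X a" and b: "orthonormal_family dB X b"
    and M: "\<And>i j. i < dA \<Longrightarrow> j < dB \<Longrightarrow> M i j = (\<Sum>x\<in>X. of_real (sqrt (P x)) * a x $ i * b x $ j)"
  shows "\<exists>a b. schmidt dA dB M (card X) (decreasing X P) a b"
proof -
  have X: "finite X" and nonneg: "\<And>x. x \<in> X \<Longrightarrow> 0 \<le> P x" using P by (auto simp: distributions_def)
  obtain g where g: "bij_betw g {..<card X} X" "\<forall>i<card X. P (g i) = decreasing X P i"
    by (rule decreasing_enumeration[OF X])
  have ons: "ons d {..<card X} (\<lambda>k. ($) (f (g k)))" if f: "orthonormal_family d X f" for f d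
    unfolding ons_def
  proof (intro ballI)
    fix k k' assume k: "k \<in> {..<card X}" "k' \<in> {..<card X}"
    then have gX: "g k \<in> X" "g k' \<in> X" using g(1) by (auto simp: bij_betw_def)
    have "cip d (($) (f (g k))) (($) (f (g k'))) = (if g k = g k' then 1 else 0)"
      by (rule onsD[OF ons_of_orthonormal_family[OF f] gX])
    also have "g k = g k' \<longleftrightarrow> k = k'" using g(1) k by (auto simp: bij_betw_def inj_on_def)
    finally show "cip d (($) (f (g k))) (($) (f (g k'))) = (if k = k' then 1 else 0)" .
  qed
  have "M i j = (\<Sum>k<card X. of_real (sqrt (decreasing X P k)) * a (g k) $ i * b (g k) $ j)"
    if "i < dA" "j < dB" for i j
  proof -
    have "M i j = (\<Sum>k<card X. of_real (sqrt (P (g k))) * a (g k) $ i * b (g k) $ j)"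
      unfolding M[OF that] by (rule sum.reindex_bij_betw[OF g(1), symmetric])
    then show ?thesis using g(2) by simp
  qed
  then have "schmidt dA dB M (card X) (decreasing X P) (\<lambda>k. ($) (a (g k))) (\<lambda>k. ($) (b (g k)))"
    unfolding schmidt_def using ons[OF a] ons[OF b]
    by (auto intro!: antimono_decreasing decreasing_nonneg decreasing_eq_0 X nonneg)
  then show ?thesis by blast
qed

lemma tensor_vec_index:
  "v \<in> carrier_vec dA \<Longrightarrow> w \<in> carrier_vec dB \<Longrightarrow> i < dA \<Longrightarrow> j < dB \<Longrightarrow>
    tensor_vec v w $ (i * dB + j) = v $ i * w $ j"
  by (auto simp: tensor_vec_def pair_index_less)

lemma schmidt_distributionD:
  assumes "schmidt_distribution dA dB \<psi> X P"
  obtains a b where "P \<in> distributions X" "orthonormal_family dA X a" "orthonormal_family dB X b"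
    "\<forall>i<dA. \<forall>j<dB. coef dB \<psi> i j = (\<Sum>x\<in>X. of_real (sqrt (P x)) * a x $ i * b x $ j)"
proof -
  obtain a b where P: "P \<in> distributions X" and a: "orthonormal_family dA X a"
    and b: "orthonormal_family dB X b"
    and \<psi>: "\<forall>i<dA * dB. \<psi> $ i = (\<Sum>x\<in>X. of_real (sqrt (P x)) * tensor_vec (a x) (b x) $ i)"
    using assms unfolding schmidt_distribution_def by (elim conjE exE)
  have "coef dB \<psi> i j = (\<Sum>x\<in>X. of_real (sqrt (P x)) * a x $ i * b x $ j)" if ij: "i < dA" "j < dB" for i j
  proof -
    have "coef dB \<psi> i j = (\<Sum>x\<in>X. of_real (sqrt (P x)) * tensor_vec (a x) (b x) $ (i * dB + j))"
      using \<psi> pair_index_less[OF ij] by (simp add: coef_def)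
    also have "\<dots> = (\<Sum>x\<in>X. of_real (sqrt (P x)) * a x $ i * b x $ j)"
    proof (intro sum.cong refl)
      fix x assume "x \<in> X"
      then have "tensor_vec (a x) (b x) $ (i * dB + j) = a x $ i * b x $ j"
        using a b ij by (intro tensor_vec_index) (auto simp: orthonormal_family_def)
      then show "of_real (sqrt (P x)) * tensor_vec (a x) (b x) $ (i * dB + j) =
          of_real (sqrt (P x)) * a x $ i * b x $ j" by simp
    qed
    finally show ?thesis .
  qed
  with P a b show ?thesis by (intro that) auto
qed

text \<open>The enumeration \<open>g\<close> is a parameter so that the new distribution can be
  ordered in the same way as another one on \<open>Y\<close>.\<close>

lemma distribution_of_sequence:
  assumes g: "bij_betw g {..<card Y} Y" and Y: "finite Y"
    and f: "antimono f" "\<And>i. 0 \<le> f i" "\<And>i. card Y \<le> i \<Longrightarrow> f i = 0" "(\<Sum>i<card Y. f i) = 1"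
  obtains P where "P \<in> distributions Y" "decreasing Y P = f" "\<forall>i<card Y. P (g i) = f i"
proof -
  define P where "P = (\<lambda>y. f (inv_into {..<card Y} g y))"
  have Pg: "P (g i) = f i" if "i < card Y" for i
    using g that by (simp add: P_def bij_betw_inv_into_left)
  have "sum P Y = (\<Sum>i<card Y. P (g i))" by (rule sum.reindex_bij_betw[OF g, symmetric])
  also have "\<dots> = 1" using Pg f(4) by simp
  finally have "P \<in> distributions Y" using Y f(2) by (simp add: distributions_def P_def)
  moreover have "decreasing Y P = f"
  proof
    fix i
    have "decreasing Y P i = (if i < card Y then f i else 0)"
      by (rule decreasing_eqI[where f = f, OF g]) (use Pg f(1) in \<open>auto simp: antimono_def\<close>)
    then show "decreasing Y P i = f i" using f(3) by simp
  qed
  ultimately show ?thesis using that Pg by blast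
qed

section \<open>Bit strings and bounds for distributions\<close>

lemma finite_bit_strings: "finite (bit_strings N)" and card_bit_strings: "card (bit_strings N) = 2 ^ N"
proof -
  have "bit_strings N = {bs. set bs \<subseteq> UNIV \<and> length bs = N}" by (simp add: bit_strings_def)
  then show "finite (bit_strings N)" "card (bit_strings N) = 2 ^ N"
    using finite_lists_length_eq[of "UNIV :: bool set" N] card_lists_length_eq[of "UNIV :: bool set" N]
    by simp_all
qed

lemma distributions_prefix_sum_le:
  assumes "P \<in> distributions X"
  shows "(\<Sum>i<l. decreasing X P i) \<le> 1"
proof -
  have X: "finite X" "\<And>x. x \<in> X \<Longrightarrow> 0 \<le> P x" "sum P X = 1" using assms by (auto simp: distributions_def)
  have "(\<Sum>i<l. decreasing X P i) \<le> (\<Sum>i<max l (card X). decreasing X P i)"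
    using X by (intro sum_mono2) (auto intro: decreasing_nonneg)
  also have "\<dots> = (\<Sum>i<card X. decreasing X P i)"
    using X by (intro sum.mono_neutral_right) (auto simp: decreasing_eq_0)
  finally show ?thesis using sum_decreasing[OF X(1), of P] X(3) by simp
qed

text \<open>Arithmetic-geometric mean inequality in each term; it bounds the set whose supremum is
  taken.\<close>

lemma dist_fidelity_le_1:
  assumes "P \<in> distributions Y" "Q \<in> distributions Y"
  shows "dist_fidelity Y P Q \<le> 1"
proof -
  have "dist_fidelity Y P Q \<le> (\<Sum>y\<in>Y. (P y + Q y) / 2)"
    unfolding dist_fidelity_def
  proof (intro sum_mono)
    fix y assume "y \<in> Y"
    then have "0 \<le> P y" "0 \<le> Q y" using assms by (auto simp: distributions_def)
    then show "sqrt (P y) * sqrt (Q y) \<le> (P y + Q y) / 2"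
      using arith_geo_mean_sqrt[of "P y" "Q y"] by (simp add: real_sqrt_mult)
  qed
  also have "\<dots> = 1" using assms by (simp add: distributions_def sum.distrib flip: sum_divide_distrib)
  finally show ?thesis .
qed

text \<open>Mass beyond the size of \<open>Y\<close> is useless for the fidelity with a distribution on \<open>Y\<close>: move it to the largest value.\<close>

lemma fold_tail:
  fixes p :: "nat \<Rightarrow> real"
  assumes p: "antimono p" "\<And>i. 0 \<le> p i" "\<And>i. m \<le> i \<Longrightarrow> p i = 0" "(\<Sum>i<m. p i) = 1" and n: "0 < n"
  obtains f where "antimono f" "\<forall>i. 0 \<le> f i" "\<forall>i\<ge>n. f i = 0" "(\<Sum>i<n. f i) = 1"
    "\<forall>l. (\<Sum>i<l. p i) \<le> (\<Sum>i<l. f i)" "\<forall>i<n. p i \<le> f i"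
proof -
  \<comment> \<open>All mass from index \<open>n\<close> on: the upper limit \<open>n + m\<close>
    lies beyond the support of \<open>p\<close> whether or not \<open>n\<close> is below
    \<open>m\<close>.\<close>
  define T where "T = (\<Sum>i=n..<n + m. p i)"
  have T: "0 \<le> T" by (simp add: T_def p(2) sum_nonneg)
  define f where "f = (\<lambda>i. (if i < n then p i else 0) + (if i = 0 then T else 0))"
  have total: "(\<Sum>i<l. p i) \<le> 1" for l
  proof -
    have "(\<Sum>i<l. p i) \<le> (\<Sum>i<max l m. p i)" using p(2) by (intro sum_mono2) auto
    also have "\<dots> = (\<Sum>i<m. p i)" using p(3) by (intro sum.mono_neutral_right) auto
    finally show ?thesis by (simp add: p(4))
  qed
  have "(\<Sum>i<n. p i) + T = (\<Sum>i<n + m. p i)"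
    using sum.atLeastLessThan_concat[of 0 n "n + m" p] by (simp add: T_def atLeast0LessThan)
  also have "\<dots> = (\<Sum>i<m. p i)" using p(3) by (intro sum.mono_neutral_right) auto
  finally have sum_T: "(\<Sum>i<n. p i) + T = 1" by (simp add: p(4))
  have sum_f: "(\<Sum>i<l. f i) = (\<Sum>i<min l n. p i) + T" if "0 < l" for l
  proof -
    have "(\<Sum>i<l. if i < n then p i else 0) = (\<Sum>i<min l n. p i)"
      by (intro sum.mono_neutral_cong_right) auto
    then show ?thesis using that by (simp add: f_def sum.distrib)
  qed
  show ?thesis
  proof (rule that[of f])
    show "antimono f"
    proof (rule antimonoI)
      fix i j :: nat assume "i \<le> j"
      then show "f j \<le> f i" using p(1,2) T by (auto simp: f_def antimono_def add_increasing2)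
    qed
    show "\<forall>l. (\<Sum>i<l. p i) \<le> (\<Sum>i<l. f i)"
    proof
      fix l
      show "(\<Sum>i<l. p i) \<le> (\<Sum>i<l. f i)"
      proof (cases "l = 0")
        case False
        then show ?thesis using total[of l] sum_T T by (cases "l \<le> n") (simp_all add: sum_f min_def)
      qed simp
    qed
    show "(\<Sum>i<n. f i) = 1" using sum_f[OF n] sum_T by simp
  qed (use p(2) n T in \<open>auto simp: f_def\<close>)
qed

theorem locc_fidelity_le:
  assumes \<psi>: "pure_state (dA * dB) \<psi>" and \<phi>: "pure_state (dA' * dB') \<phi>"
    and X: "schmidt_distribution dA dB \<psi> X P" and Y: "schmidt_distribution dA' dB' \<phi> Y Q"
    and \<Gamma>: "locc dA dB (2 ^ N) (2 ^ N) \<Gamma>" and \<Gamma>': "locc (2 ^ N) (2 ^ N) dA' dB' \<Gamma>'"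
  shows "\<exists>P''\<in>distributions Y. (\<exists>P'\<in>distributions (bit_strings N).
       majorized X P (bit_strings N) P' \<and> majorized (bit_strings N) P' Y P'') \<and>
     fidelity ((\<Gamma>' \<circ> \<Gamma>) (ket_bra \<psi>)) (ket_bra \<phi>) \<le> dist_fidelity Y P'' Q"
proof -
  obtain a b where P: "P \<in> distributions X" and a: "orthonormal_family dA X a" "orthonormal_family dB X b"
    "\<forall>i<dA. \<forall>j<dB. coef dB \<psi> i j = (\<Sum>x\<in>X. of_real (sqrt (P x)) * a x $ i * b x $ j)"
    by (rule schmidt_distributionD[OF X])
  obtain c d where Q: "Q \<in> distributions Y" and c: "orthonormal_family dA' Y c" "orthonormal_family dB' Y d"
    "\<forall>i<dA'. \<forall>j<dB'. coef dB' \<phi> i j = (\<Sum>x\<in>Y. of_real (sqrt (Q x)) * c x $ i * d x $ j)"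
    by (rule schmidt_distributionD[OF Y])
  obtain a' b' where S\<psi>: "schmidt dA dB (coef dB \<psi>) (card X) (decreasing X P) a' b'"
    using schmidt_of_orthonormal_families[OF P a(1,2)] a(3) by blast
  obtain c' d' where S\<phi>: "schmidt dA' dB' (coef dB' \<phi>) (card Y) (decreasing Y Q) c' d'"
    using schmidt_of_orthonormal_families[OF Q c(1,2)] c(3) by blast
  from locc_fidelity_bound[OF \<psi> \<phi> S\<psi> S\<phi> \<Gamma> \<Gamma>']
  obtain p' p'' where p': "antimono p'" "\<forall>i. 0 \<le> p' i" "\<forall>i\<ge>2 ^ N. p' i = 0" "(\<Sum>i<2 ^ N. p' i) = 1"
    and p'': "antimono p''" "\<forall>i. 0 \<le> p'' i" "\<forall>i\<ge>dA'. p'' i = 0" "(\<Sum>i<dA'. p'' i) = 1"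
    and le: "\<forall>l. (\<Sum>i<l. decreasing X P i) \<le> (\<Sum>i<l. p' i)" "\<forall>l. (\<Sum>i<l. p' i) \<le> (\<Sum>i<l. p'' i)"
    and fid: "fidelity ((\<Gamma>' \<circ> \<Gamma>) (ket_bra \<psi>)) (ket_bra \<phi>) \<le> (\<Sum>y<card Y. sqrt (p'' y) * sqrt (decreasing Y Q y))"
    by (elim exE conjE)
  have finY: "finite Y" and Q1: "sum Q Y = 1" and Q0: "\<And>y. y \<in> Y \<Longrightarrow> 0 \<le> Q y"
    using Q by (auto simp: distributions_def)
  have "Y \<noteq> {}" using Q1 by auto
  then have cY: "0 < card Y" using finY by (simp add: card_gt_0_iff)
  \<comment> \<open>The averaged sequence can have up to \<open>dA'\<close> nonzero values, possibly
    more than \<open>Y\<close> has elements.\<close>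
  obtain f where f: "antimono f" "\<forall>i. 0 \<le> f i" "\<forall>i\<ge>card Y. f i = 0" "(\<Sum>i<card Y. f i) = 1"
    "\<forall>l. (\<Sum>i<l. p'' i) \<le> (\<Sum>i<l. f i)" "\<forall>i<card Y. p'' i \<le> f i"
    by (rule fold_tail[of p'' dA' "card Y"]) (use p'' cY in auto)
  obtain g where g: "bij_betw g {..<card Y} Y" "\<forall>i<card Y. Q (g i) = decreasing Y Q i"
    by (rule decreasing_enumeration[OF finY])
  \<comment> \<open>The values are laid along the enumeration that sorts \<open>Q\<close>, so the
    sum over sorted positions becomes a fidelity on \<open>Y\<close>.\<close>
  obtain P'' where P'': "P'' \<in> distributions Y" "decreasing Y P'' = f" "\<forall>i<card Y. P'' (g i) = f i"
    by (rule distribution_of_sequence[OF g(1) finY, of f]) (use f in auto)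
  obtain h where h: "bij_betw h {..<card (bit_strings N)} (bit_strings N)"
    using ex_bij_betw_nat_finite[OF finite_bit_strings[of N]] by (auto simp: atLeast0LessThan)
  obtain P' where P': "P' \<in> distributions (bit_strings N)" "decreasing (bit_strings N) P' = p'"
    by (rule distribution_of_sequence[OF h finite_bit_strings, of p'])
      (use p' in \<open>auto simp: card_bit_strings\<close>)
  have "(\<Sum>y<card Y. sqrt (p'' y) * sqrt (decreasing Y Q y)) \<le> (\<Sum>y<card Y. sqrt (P'' (g y)) * sqrt (Q (g y)))"
    using f(2,6) P''(3) g(2) decreasing_nonneg[of Y Q, OF finY Q0] by (intro sum_mono mult_mono) auto
  also have "\<dots> = dist_fidelity Y P'' Q"
    unfolding dist_fidelity_def by (rule sum.reindex_bij_betw[OF g(1)])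
  finally have "fidelity ((\<Gamma>' \<circ> \<Gamma>) (ket_bra \<psi>)) (ket_bra \<phi>) \<le> dist_fidelity Y P'' Q"
    using fid by linarith
  moreover have "majorized X P (bit_strings N) P'" "majorized (bit_strings N) P' Y P''"
    using le f(5) unfolding majorized_def P'(2) P''(2) by (auto intro: order_trans)
  ultimately show ?thesis using P'(1) P''(1) by blast
qed

text \<open>Two runs of Nielsen's protocol, joined at the state \<omega> that is diagonal in the
  standard bases with the sorted values of \<open>P'\<close>. The final state \<chi> has the
  orthonormal families of \<phi>, so its overlap with \<phi> pairs \<open>P''\<close> and
  \<open>Q\<close> at equal elements of \<open>Y\<close>, whatever their order.\<close>

theorem locc_fidelity_attained:
  assumes \<psi>: "pure_state (dA * dB) \<psi>" and \<phi>: "pure_state (dA' * dB') \<phi>"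
    and X: "schmidt_distribution dA dB \<psi> X P" and Y: "schmidt_distribution dA' dB' \<phi> Y Q"
    and P'': "P'' \<in> distributions Y" and P': "P' \<in> distributions (bit_strings N)"
    and maj: "majorized X P (bit_strings N) P'" "majorized (bit_strings N) P' Y P''"
  shows "\<exists>\<Gamma> \<Gamma>'. locc dA dB (2 ^ N) (2 ^ N) \<Gamma> \<and> locc (2 ^ N) (2 ^ N) dA' dB' \<Gamma>' \<and>
     fidelity ((\<Gamma>' \<circ> \<Gamma>) (ket_bra \<psi>)) (ket_bra \<phi>) = dist_fidelity Y P'' Q"
proof -
  obtain a b where P: "P \<in> distributions X" and a: "orthonormal_family dA X a" "orthonormal_family dB X b"
    "\<forall>i<dA. \<forall>j<dB. coef dB \<psi> i j = (\<Sum>x\<in>X. of_real (sqrt (P x)) * a x $ i * b x $ j)"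
    by (rule schmidt_distributionD[OF X])
  obtain c d where Q: "Q \<in> distributions Y" and c: "orthonormal_family dA' Y c" "orthonormal_family dB' Y d"
    "\<forall>i<dA'. \<forall>j<dB'. coef dB' \<phi> i j = (\<Sum>x\<in>Y. of_real (sqrt (Q x)) * c x $ i * d x $ j)"
    by (rule schmidt_distributionD[OF Y])
  obtain a' b' where S\<psi>: "schmidt dA dB (coef dB \<psi>) (card X) (decreasing X P) a' b'"
    using schmidt_of_orthonormal_families[OF P a(1,2)] a(3) by blast
  have \<psi>c: "\<psi> \<in> carrier_vec (dA * dB)" and \<phi>c: "\<phi> \<in> carrier_vec (dA' * dB')"
    using \<psi> \<phi> by (simp_all add: pure_state_def)
  \<comment> \<open>Normalization of \<phi> rules out dimension 0, in which the protocol could not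
    complete its Kraus families.\<close>
  have pos: "0 < dA'" "0 < dB'"
    using \<phi> by (cases "dA' = 0"; cases "dB' = 0"; auto simp: pure_state_def scalar_prod_def)+
  have sum1: "(\<Sum>i<card Z. decreasing Z R i) = 1" if "R \<in> distributions Z" for Z :: "'z set" and R
    using that by (simp add: distributions_def sum_decreasing)
  let ?p' = "decreasing (bit_strings N) P'"
  define \<omega> where "\<omega> = bivec (2 ^ N) (2 ^ N) (\<lambda>i j. if i = j then of_real (sqrt (?p' i)) else 0)"
  have ons: "ons n {..<n} basis_fun" for n
    by (auto simp: ons_def cip_basis_fun) (auto simp: basis_fun_def)
  have nonneg: "\<And>x. x \<in> bit_strings N \<Longrightarrow> 0 \<le> P' x" using P' by (auto simp: distributions_def)
  have "coef (2 ^ N) \<omega> i j = (\<Sum>x<2 ^ N. of_real (sqrt (?p' x)) * basis_fun x i * basis_fun x j)"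
    if "i < 2 ^ N" "j < 2 ^ N" for i j
  proof -
    have "(\<Sum>x<2 ^ N. of_real (sqrt (?p' x)) * basis_fun x i * basis_fun x j) =
        (\<Sum>x<2 ^ N. if x = i then (if i = j then of_real (sqrt (?p' i)) else 0) else 0)"
      by (intro sum.cong) (auto simp: basis_fun_def)
    then show ?thesis using that by (simp add: \<omega>_def coef_bivec)
  qed
  then have S\<omega>: "schmidt (2 ^ N) (2 ^ N) (coef (2 ^ N) \<omega>) (2 ^ N) ?p' basis_fun basis_fun"
    unfolding schmidt_def using ons
    by (auto intro!: antimono_decreasing decreasing_nonneg decreasing_eq_0 finite_bit_strings nonneg
        simp: card_bit_strings)
  define \<chi> where "\<chi> = bivec dA' dB' (\<lambda>i j. \<Sum>x\<in>Y. of_real (sqrt (P'' x)) * c x $ i * d x $ j)"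
  have coef_\<chi>: "coef dB' \<chi> i j = (\<Sum>x\<in>Y. of_real (sqrt (P'' x)) * c x $ i * d x $ j)" if "i < dA'" "j < dB'" for i j
    using that by (simp add: \<chi>_def coef_bivec)
  obtain c' d' where S\<chi>: "schmidt dA' dB' (coef dB' \<chi>) (card Y) (decreasing Y P'') c' d'"
    using schmidt_of_orthonormal_families[OF P'' c(1,2), of "coef dB' \<chi>"] coef_\<chi> by blast
  have \<omega>c: "\<omega> \<in> carrier_vec (2 ^ N * 2 ^ N)" and \<chi>c: "\<chi> \<in> carrier_vec (dA' * dB')"
    by (simp_all add: \<omega>_def \<chi>_def)
  have bits1: "(\<Sum>i<2 ^ N. ?p' i) = 1" using sum1[OF P'] by (simp add: card_bit_strings)
  obtain \<Gamma> where \<Gamma>: "locc dA dB (2 ^ N) (2 ^ N) \<Gamma>" "\<Gamma> (ket_bra \<psi>) = ket_bra \<omega>"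
    by (rule nielsen[OF \<psi>c \<omega>c S\<psi> S\<omega> sum1[OF P] bits1]) (use maj(1) in \<open>auto simp: majorized_def\<close>)
  obtain \<Gamma>' where \<Gamma>': "locc (2 ^ N) (2 ^ N) dA' dB' \<Gamma>'" "\<Gamma>' (ket_bra \<omega>) = ket_bra \<chi>"
    by (rule nielsen[OF \<omega>c \<chi>c S\<omega> S\<chi> bits1 sum1[OF P'']]) (use maj(2) pos in \<open>auto simp: majorized_def\<close>)
  have ons_c: "ons dA' Y (\<lambda>y. ($) (c y))" "ons dB' Y (\<lambda>y. ($) (d y))"
    using c(1,2) by (auto intro: ons_of_orthonormal_family)
  have finY: "finite Y" using Q by (simp add: distributions_def)
  have "cip (dA' * dB') (($) \<chi>) (($) \<phi>) = (\<Sum>i<dA'. \<Sum>y\<in>Y. of_real (sqrt (P'' y)) * c y $ i * (of_real (sqrt (Q y)) * cnj (c y $ i)))"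
    unfolding cip_coef
  proof (intro sum.cong refl)
    fix i assume i: "i \<in> {..<dA'}"
    have "cip dB' (coef dB' \<chi> i) (coef dB' \<phi> i) =
        cip dB' (\<lambda>j. \<Sum>y\<in>Y. (of_real (sqrt (P'' y)) * c y $ i) * d y $ j) (\<lambda>j. \<Sum>y\<in>Y. (of_real (sqrt (Q y)) * c y $ i) * d y $ j)"
      using coef_\<chi> c(3) i by (intro cip_cong) auto
    also have "\<dots> = (\<Sum>y\<in>Y. cnj (of_real (sqrt (Q y)) * c y $ i) * (of_real (sqrt (P'' y)) * c y $ i))"
      unfolding cip_sum_right by (intro sum.cong refl) (simp only: cip_ons_sum_left[OF ons_c(2) finY])
    finally show "cip dB' (coef dB' \<chi> i) (coef dB' \<phi> i) =
        (\<Sum>y\<in>Y. of_real (sqrt (P'' y)) * c y $ i * (of_real (sqrt (Q y)) * cnj (c y $ i)))"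
      by (simp add: ac_simps)
  qed
  also have "\<dots> = (\<Sum>y\<in>Y. of_real (sqrt (P'' y) * sqrt (Q y)) * cip dA' (($) (c y)) (($) (c y)))"
    by (subst sum.swap) (simp add: cip_def sum_distrib_left ac_simps)
  also have "\<dots> = of_real (dist_fidelity Y P'' Q)"
    using onsD[OF ons_c(1)] by (simp add: dist_fidelity_def)
  finally have overlap: "cip (dA' * dB') (($) \<chi>) (($) \<phi>) = of_real (dist_fidelity Y P'' Q)" .
  have "0 \<le> dist_fidelity Y P'' Q"
    using P'' Q unfolding dist_fidelity_def distributions_def by (intro sum_nonneg) auto
  moreover have "fidelity (ket_bra \<chi>) (ket_bra \<phi>) = cmod (cip (dA' * dB') (($) \<chi>) (($) \<phi>))"
    using fidelity_ensemble[OF \<phi>, of "[\<chi>]" "ket_bra \<chi>"] \<chi>c by (simp add: ket_bra_def)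
  ultimately have "fidelity ((\<Gamma>' \<circ> \<Gamma>) (ket_bra \<psi>)) (ket_bra \<phi>) = dist_fidelity Y P'' Q"
    using \<Gamma>(2) \<Gamma>'(2) overlap by simp
  with \<Gamma>(1) \<Gamma>'(1) show ?thesis by blast
qed

text \<open>A point mass majorizes every distribution and serves at both stages; hence the supremum
  is taken over a nonempty set.\<close>

lemma majorizing_chain_exists:
  fixes P :: "'a \<Rightarrow> real" and Y :: "'b set"
  assumes P: "P \<in> distributions X" and Y: "finite Y" "Y \<noteq> {}"
  shows "\<exists>P''\<in>distributions Y. \<exists>P'\<in>distributions (bit_strings N).
    majorized X P (bit_strings N) P' \<and> majorized (bit_strings N) P' Y P''"
proof -
  define f where "f = (\<lambda>i :: nat. if i = 0 then 1 else 0 :: real)"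
  have *: "\<exists>R\<in>distributions Z. decreasing Z R = f" if Z: "finite Z" "0 < card Z" for Z :: "'z set"
  proof -
    obtain g where g: "bij_betw g {..<card Z} Z"
      using ex_bij_betw_nat_finite[OF Z(1)] by (auto simp: atLeast0LessThan)
    show ?thesis
      by (rule distribution_of_sequence[OF g Z(1), of f])
        (use Z(2) in \<open>auto simp: f_def antimono_def\<close>)
  qed
  obtain P' where P': "P' \<in> distributions (bit_strings N)" "decreasing (bit_strings N) P' = f"
    using *[OF finite_bit_strings[of N]] by (auto simp: card_bit_strings)
  obtain P'' where P'': "P'' \<in> distributions Y" "decreasing Y P'' = f"
    using *[OF Y(1)] Y by (auto simp: card_gt_0_iff)
  have "(\<Sum>i<l. decreasing X P i) \<le> (\<Sum>i<l. f i)" for l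
    using distributions_prefix_sum_le[OF P, of l] by (cases "l = 0") (simp_all add: f_def)
  then have "majorized X P (bit_strings N) P'" "majorized (bit_strings N) P' Y P''"
    by (simp_all add: majorized_def P'(2) P''(2))
  then show ?thesis using P'(1) P''(1) by blast
qed

text \<open>Mutual domination suffices: every LOCC fidelity lies below a fidelity of the
  majorization side, and every fidelity of that side is attained by a protocol.\<close>

theorem lemma31:
  fixes dA dB dA' dB' N :: nat
    and \<psi> \<phi> :: "complex vec"
    and X :: "'a set" and P\<^sub>\<psi> :: "'a \<Rightarrow> real"
    and Y :: "'b set" and P\<^sub>\<phi> :: "'b \<Rightarrow> real"
  assumes "pure_state (dA * dB) \<psi>"
    and "pure_state (dA' * dB') \<phi>"
    and "schmidt_distribution dA dB \<psi> X P\<^sub>\<psi>"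
    and "schmidt_distribution dA' dB' \<phi> Y P\<^sub>\<phi>"
  shows "locc_fidelity dA dB dA' dB' (ket_bra \<psi>) (ket_bra \<phi>) N =
         majorization_fidelity X P\<^sub>\<psi> Y P\<^sub>\<phi> N"
proof -
  let ?A = "{fidelity ((\<Gamma>' \<circ> \<Gamma>) (ket_bra \<psi>)) (ket_bra \<phi>) | \<Gamma> \<Gamma>'.
    locc dA dB (2 ^ N) (2 ^ N) \<Gamma> \<and> locc (2 ^ N) (2 ^ N) dA' dB' \<Gamma>'}"
  let ?B = "{dist_fidelity Y P'' P\<^sub>\<phi> | P''. P'' \<in> distributions Y \<and>
    (\<exists>P' \<in> distributions (bit_strings N).
       majorized X P\<^sub>\<psi> (bit_strings N) P' \<and> majorized (bit_strings N) P' Y P'')}"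
  have P: "P\<^sub>\<psi> \<in> distributions X" and Q: "P\<^sub>\<phi> \<in> distributions Y"
    using assms(3,4) by (auto simp: schmidt_distribution_def)
  have "finite Y" "Y \<noteq> {}" using Q by (auto simp: distributions_def)
  from majorizing_chain_exists[OF P this, of N] have B: "?B \<noteq> {}" by blast
  have AB: "\<exists>y\<in>?B. x \<le> y" if "x \<in> ?A" for x
    using that locc_fidelity_le[OF assms, of N] by blast
  have BA: "\<exists>x\<in>?A. y \<le> x" if yB: "y \<in> ?B" for y
  proof -
    obtain P'' P' where P'': "P'' \<in> distributions Y" "P' \<in> distributions (bit_strings N)"
      "majorized X P\<^sub>\<psi> (bit_strings N) P'" "majorized (bit_strings N) P' Y P''"
      and y: "y = dist_fidelity Y P'' P\<^sub>\<phi>"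
      using yB by blast
    obtain \<Gamma> \<Gamma>' where \<Gamma>: "locc dA dB (2 ^ N) (2 ^ N) \<Gamma>" "locc (2 ^ N) (2 ^ N) dA' dB' \<Gamma>'"
      and fid: "fidelity ((\<Gamma>' \<circ> \<Gamma>) (ket_bra \<psi>)) (ket_bra \<phi>) = dist_fidelity Y P'' P\<^sub>\<phi>"
      using locc_fidelity_attained[OF assms P''] by (elim exE conjE)
    have "y \<in> ?A" unfolding y using \<Gamma> fid[symmetric] by (intro CollectI exI conjI)
    then show ?thesis by blast
  qed
  \<comment> \<open>\<open>Sup\<close> on the reals is a supremum only for nonempty bounded sets;
    both properties are known on the majorization side and are carried over by domination.\<close>
  have "bdd_above ?B"
    using dist_fidelity_le_1[OF _ Q] by (intro bdd_aboveI[of _ 1]) auto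
  moreover from this AB have "bdd_above ?A"
    by (meson bdd_above_def order_trans)
  moreover have "?A \<noteq> {}" using B BA by blast
  ultimately have "Sup ?A = Sup ?B"
    using B AB BA by (intro antisym cSup_mono) auto
  then show ?thesis by (simp add: locc_fidelity_def majorization_fidelity_def)
qed

end
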